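(* Let $M$ be an almost complex surface in the nearly Kähler $S^3\times S^3$, with immersion $\phi=(p,q)\colon M\to S^3\times S^3$. For isothermal coordinates $(u,v)$ on $M$ with $J\phi_u=\phi_v$, put $z=u+iv$, $\Lambda=g(P\phi_z,\phi_z)$, $\alpha=p^{-1}p_u$ and $\beta=p^{-1}p_v$. Then $\Lambda\,dz^2$ is a globally defined holomorphic (quadratic) differential on $M$, and the following three conditions are equivalent: (i) $\Lambda\,dz^2=0$ (identically on $M$); (ii) $\alpha\cdot\alpha-\beta\cdot\beta=0$ and $\alpha\cdot\beta=0$ (identically, in such isothermal coordinates around every point of $M$); (iii) $P(TM)\perp TM$, with orthogonality taken with respect to $g$.
   Context: $S^3$ is the group of unit quaternions, and $T_{(p,q)}(S^3\times S^3)$ is identified with $T_pS^3\times T_qS^3$. The almost complex structure $J$ on $S^3\times S^3$ is $J(U,V)=\frac{1}{\sqrt3}\bigl(2pq^{-1}V-U,\,-2qp^{-1}U+V\bigr)$ for $(U,V)\in T_{(p,q)}(S^3\times S^3)$ (quaternion multiplication). The metric is $g(X,Y)=\frac12\bigl(\langle X,Y\rangle+\langle JX,JY\rangle\bigr)$, where $\langle\cdot,\cdot\rangle$ is the standard product metric on $S^3\times S^3$ (product of two unit round metrics). The nearly Kähler $S^3\times S^3$ is $(S^3\times S^3,g,J)$. The almost product structure is $P(U,V)=(pq^{-1}V,\,qp^{-1}U)$ for $(U,V)\in T_{(p,q)}(S^3\times S^3)$. An almost complex surface is a smooth (immersed) surface $M$ whose tangent bundle $TM$, viewed inside the tangent bundle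 of $S^3\times S^3$ via the immersion, is $J$-invariant; $M$ carries the metric induced by $g$ and the complex structure induced by $J$. The maps $\alpha,\beta$ take values in the imaginary quaternions, identified with $\mathbb R^3$ in the usual way, and "$\cdot$" is the standard inner product of $\mathbb R^3$. As usual $\phi_z=\frac12(\phi_u-i\phi_v)$, and $g$ and $P$ are extended complex (bi)linearly. *)

theory Defs
  imports "HOL-Complex_Analysis.Complex_Analysis"
begin

text \<open>Quaternions as pairs of a scalar and a vector of the three-dimensional space of imaginary
  quaternions, \<open>snd\<close> being the imaginary part.  The inner product of the product type is the
  standard one of four-dimensional Euclidean space.\<close>

type_synonym quat = "real \<times> (real ^ 3)"

definition qmult :: "quat \<Rightarrow> quat \<Rightarrow> quat"  (infixl "*\<^sub>q" 70) where
  "x *\<^sub>q y = (fst x * fst y - snd x \<bullet> snd y,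
             fst x *\<^sub>R snd y + fst y *\<^sub>R snd x + cross3 (snd x) (snd y))"

definition qinv :: "quat \<Rightarrow> quat" where
  "qinv x = (1 / (norm x)\<^sup>2) *\<^sub>R (fst x, - snd x)"

definition S3 :: "quat set" where
  "S3 = sphere 0 1"

text \<open>The first argument of the following tensors is the base point \<open>(p, q)\<close>; tangent vectors of
  the submanifold \<open>S3 \<times> S3\<close> are represented as vectors of the ambient space.\<close>

type_synonym quat2 = "quat \<times> quat"

fun nkJ :: "quat2 \<Rightarrow> quat2 \<Rightarrow> quat2" where
  "nkJ (p, q) (U, V) =
     (1 / sqrt 3) *\<^sub>R (2 *\<^sub>R (p *\<^sub>q qinv q *\<^sub>q V) - U, (-2) *\<^sub>R (q *\<^sub>q qinv p *\<^sub>q U) + V)"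

definition nkg :: "quat2 \<Rightarrow> quat2 \<Rightarrow> quat2 \<Rightarrow> real" where
  "nkg x X Y = (X \<bullet> Y + nkJ x X \<bullet> nkJ x Y) / 2"

fun nkP :: "quat2 \<Rightarrow> quat2 \<Rightarrow> quat2" where
  "nkP (p, q) (U, V) = (p *\<^sub>q qinv q *\<^sub>q V, q *\<^sub>q qinv p *\<^sub>q U)"

text \<open>Complexified tangent vectors \<open>X + \<i> Y\<close> are pairs \<open>(X, Y)\<close>.\<close>

type_synonym cquat2 = "quat2 \<times> quat2"

fun nkP_cx :: "quat2 \<Rightarrow> cquat2 \<Rightarrow> cquat2" where
  "nkP_cx x (X, Y) = (nkP x X, nkP x Y)"

fun nkg_cx :: "quat2 \<Rightarrow> cquat2 \<Rightarrow> cquat2 \<Rightarrow> complex" where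
  "nkg_cx x (X, Y) (X', Y') =
     Complex (nkg x X X' - nkg x Y Y') (nkg x X Y' + nkg x Y X')"

text \<open>\<open>C\<^sup>k\<close> and \<open>C\<^sup>\<infinity>\<close> maps, meant for open sets \<open>S\<close>.\<close>

primrec Ck_on :: "nat \<Rightarrow> 'a::euclidean_space set \<Rightarrow> ('a \<Rightarrow> 'b::real_normed_vector) \<Rightarrow> bool" where
  "Ck_on 0 S f \<longleftrightarrow> continuous_on S f"
| "Ck_on (Suc k) S f \<longleftrightarrow>
     (\<forall>x\<in>S. f differentiable (at x)) \<and> (\<forall>h. Ck_on k S (\<lambda>x. frechet_derivative f (at x) h))"

definition smooth_on :: "'a::euclidean_space set \<Rightarrow> ('a \<Rightarrow> 'b::real_normed_vector) \<Rightarrow> bool" where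
  "smooth_on S f \<longleftrightarrow> (\<forall>k. Ck_on k S f)"

text \<open>A surface is a Hausdorff, second countable type \<open>'m\<close> with a smooth atlas.  A chart is given by
  its domain and its coordinate map into the plane, which is written as the complex plane with
  coordinate \<open>u + \<i> v\<close>, so that \<open>1\<close> and \<open>\<i>\<close> are the directions of the coordinates \<open>u\<close> and \<open>v\<close>.\<close>

type_synonym 'm chart = "'m set \<times> ('m \<Rightarrow> complex)"

definition param :: "'m chart \<Rightarrow> complex \<Rightarrow> 'm" where
  "param c = inv_into (fst c) (snd c)"

definition cdom :: "'m chart \<Rightarrow> complex set" where
  "cdom c = snd c ` fst c"

definition overlap :: "'m chart \<Rightarrow> 'm chart \<Rightarrow> complex set" where
  "overlap c d = snd c ` (fst c \<inter> fst d)"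

definition transition :: "'m chart \<Rightarrow> 'm chart \<Rightarrow> complex \<Rightarrow> complex" where
  "transition c d = snd d \<circ> param c"

definition is_chart :: "'m::topological_space chart \<Rightarrow> bool" where
  "is_chart c \<longleftrightarrow> open (fst c) \<and> open (cdom c) \<and> homeomorphism (fst c) (cdom c) (snd c) (param c)"

definition smoothly_compatible :: "'m chart \<Rightarrow> 'm chart \<Rightarrow> bool" where
  "smoothly_compatible c d \<longleftrightarrow>
     smooth_on (overlap c d) (transition c d) \<and> smooth_on (overlap d c) (transition d c)"

definition smooth_atlas :: "'m::topological_space chart set \<Rightarrow> bool" where
  "smooth_atlas A \<longleftrightarrow>
     (\<forall>c\<in>A. is_chart c) \<and> (\<Union>c\<in>A. fst c) = UNIV \<and> (\<forall>c\<in>A. \<forall>d\<in>A. smoothly_compatible c d)"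

text \<open>The charts of the maximal atlas containing \<open>A\<close>.\<close>

definition smooth_charts :: "'m::topological_space chart set \<Rightarrow> 'm chart set" where
  "smooth_charts A = {c. is_chart c \<and> (\<forall>d\<in>A. smoothly_compatible c d)}"

definition differential_in ::
    "('m \<Rightarrow> 'a::real_normed_vector) \<Rightarrow> 'm chart \<Rightarrow> 'm \<Rightarrow> complex \<Rightarrow> 'a" where
  "differential_in \<phi> c x = frechet_derivative (\<phi> \<circ> param c) (at (snd c x))"

definition smooth_immersion ::
    "'m::topological_space chart set \<Rightarrow> ('m \<Rightarrow> 'a::real_normed_vector) \<Rightarrow> bool" where
  "smooth_immersion A \<phi> \<longleftrightarrow>
     (\<forall>c\<in>A. smooth_on (cdom c) (\<phi> \<circ> param c)) \<and> (\<forall>c\<in>A. \<forall>x\<in>fst c. inj (differential_in \<phi> c x))"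

text \<open>The image of the tangent plane of the surface at \<open>x\<close> under the differential of \<open>\<phi>\<close>.\<close>

definition tangent_plane ::
    "'m::topological_space chart set \<Rightarrow> ('m \<Rightarrow> 'a::real_normed_vector) \<Rightarrow> 'm \<Rightarrow> 'a set" where
  "tangent_plane A \<phi> x = {differential_in \<phi> c x h | c h. c \<in> A \<and> x \<in> fst c}"

definition almost_complex_surface ::
    "'m::{t2_space,second_countable_topology} chart set \<Rightarrow> ('m \<Rightarrow> quat2) \<Rightarrow> bool" where
  "almost_complex_surface A \<phi> \<longleftrightarrow>
     smooth_atlas A \<and> range \<phi> \<subseteq> S3 \<times> S3 \<and> smooth_immersion A \<phi> \<and>
     (\<forall>x. nkJ (\<phi> x) ` tangent_plane A \<phi> x \<subseteq> tangent_plane A \<phi> x)"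

text \<open>Partial derivatives of maps defined on a coordinate domain.\<close>

definition du :: "(complex \<Rightarrow> 'a::real_normed_vector) \<Rightarrow> complex \<Rightarrow> 'a" where
  "du f z = frechet_derivative f (at z) 1"

definition dv :: "(complex \<Rightarrow> 'a::real_normed_vector) \<Rightarrow> complex \<Rightarrow> 'a" where
  "dv f z = frechet_derivative f (at z) \<i>"

text \<open>\<open>(f\<^sub>u - \<i> f\<^sub>v) / 2\<close> as a complexified vector.\<close>

definition dz :: "(complex \<Rightarrow> quat2) \<Rightarrow> complex \<Rightarrow> cquat2" where
  "dz f z = ((1/2) *\<^sub>R du f z, (-1/2) *\<^sub>R dv f z)"

definition isothermal_charts ::
    "'m::topological_space chart set \<Rightarrow> ('m \<Rightarrow> quat2) \<Rightarrow> 'm chart set" where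
  "isothermal_charts A \<phi> =
     {c \<in> smooth_charts A. \<forall>z\<in>cdom c. let f = \<phi> \<circ> param c in
        nkg (f z) (du f z) (du f z) = nkg (f z) (dv f z) (dv f z) \<and>
        nkg (f z) (du f z) (dv f z) = 0 \<and>
        nkJ (f z) (du f z) = dv f z}"

definition Lam :: "('m \<Rightarrow> quat2) \<Rightarrow> 'm chart \<Rightarrow> complex \<Rightarrow> complex" where
  "Lam \<phi> c z = (let f = \<phi> \<circ> param c in nkg_cx (f z) (nkP_cx (f z) (dz f z)) (dz f z))"

text \<open>These are imaginary quaternions at the points where \<open>p\<close> takes values in \<open>S3\<close>; they are
  identified with vectors through \<open>snd\<close>.\<close>

definition alpha :: "('m \<Rightarrow> quat2) \<Rightarrow> 'm chart \<Rightarrow> complex \<Rightarrow> quat" where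
  "alpha \<phi> c z = (let p = fst \<circ> \<phi> \<circ> param c in qinv (p z) *\<^sub>q du p z)"

definition beta :: "('m \<Rightarrow> quat2) \<Rightarrow> 'm chart \<Rightarrow> complex \<Rightarrow> quat" where
  "beta \<phi> c z = (let p = fst \<circ> \<phi> \<circ> param c in qinv (p z) *\<^sub>q dv p z)"

definition complex_atlas :: "'m::topological_space chart set \<Rightarrow> bool" where
  "complex_atlas C \<longleftrightarrow>
     (\<forall>c\<in>C. is_chart c) \<and> (\<Union>c\<in>C. fst c) = UNIV \<and>
     (\<forall>c\<in>C. \<forall>d\<in>C. transition c d holomorphic_on overlap c d)"

text \<open>A holomorphic quadratic differential on the Riemann surface with complex atlas \<open>C\<close> is a family
  of local expressions \<open>L c dz\<^sup>2\<close>, one for each chart, that agree on overlaps.\<close>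

definition holomorphic_quadratic_differential ::
    "'m::topological_space chart set \<Rightarrow> ('m chart \<Rightarrow> complex \<Rightarrow> complex) \<Rightarrow> bool" where
  "holomorphic_quadratic_differential C L \<longleftrightarrow>
     complex_atlas C \<and>
     (\<forall>c\<in>C. L c holomorphic_on cdom c) \<and>
     (\<forall>c\<in>C. \<forall>d\<in>C. \<forall>z\<in>overlap c d.
        L c z = L d (transition c d z) * (deriv (transition c d) z)\<^sup>2)"

end

theory Submission
  imports Defs
begin

text \<open>
  In an isothermal chart put \<open>f = (p, q)\<close>, so that \<open>f_v = J f_u\<close>.  Left multiplication of the second
  components by the unit quaternion \<open>p q^-1\<close> is an isometry, and the equation \<open>f_v = J f_u\<close> then
  expresses \<open>p q^-1 q_u\<close> and \<open>p q^-1 q_v\<close> by \<open>p_u\<close> and \<open>p_v\<close> (\<open>nkJ_components\<close>).  Therefore everything can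
  be written in terms of \<open>p\<close> alone, and \<open>Lam_formula\<close> becomes
  \<open>\<Lambda> = (c / 2) ((p_u \<bullet> p_u - p_v \<bullet> p_v) - 2 \<i> (p_u \<bullet> p_v))\<close> with \<open>c = exp (\<i> \<pi> / 3)\<close>.

  As \<open>p_u\<close> and \<open>p_v\<close> are tangent to the sphere, \<open>\<alpha> = p^-1 p_u\<close> and \<open>\<beta> = p^-1 p_v\<close> are imaginary and have
  the same inner products, which gives the equivalence of the first two conditions.  The form
  \<open>g (P X, Y)\<close> is symmetric and changes sign when \<open>J\<close> is applied to both arguments (\<open>nkgP_formula\<close>), so
  \<open>\<Lambda>\<close> contains all of its values on the tangent plane; this gives the equivalence with the third
  condition.  The Cauchy-Riemann equations for \<open>\<Lambda>\<close> say that \<open>p_uu + p_vv\<close> is orthogonal to \<open>p_u\<close> and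
  \<open>p_v\<close>.  This is the integrability condition \<open>q_uv = q_vu\<close>, rewritten in terms of \<open>p\<close>
  (\<open>laplacian_orthogonal\<close>).  Transition maps between isothermal charts are holomorphic because both
  charts carry \<open>J\<close> to multiplication by \<open>\<i>\<close>, and the transformation law of \<open>\<Lambda>\<close> is bilinearity.

  There remains the existence of an isothermal chart around every point (\<open>isothermal_chart_exists\<close>),
  to which the larger part of the work goes.  In local coordinates \<open>J\<close> is a smooth field of complex
  structures on the plane, and a coordinate \<open>w\<close> is isothermal if and only if it satisfies a Beltrami
  equation \<open>w_zbar = \<mu> w_z\<close>, where \<open>\<mu> = 0\<close> at the given point after a linear change of coordinates.
  Composing \<open>\<mu>\<close> with a doubly periodic map that is the identity near the origin, and rescaling, makes
  \<open>\<mu>\<close> doubly periodic with Fourier coefficients of small absolute sum, without changing the germ of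
  the equation.  On the torus the function \<open>h = w_zbar\<close> has to satisfy \<open>h = \<mu> (1 + S h)\<close>, where \<open>S\<close>
  multiplies each Fourier coefficient by a number of absolute value at most one.  The solution is a
  Neumann series in the Wiener algebra of absolutely summable coefficients.  It is smooth
  because for every \<open>N\<close> the series also converges with the weights \<open>(1 + \<delta> |k|)^N\<close>, if \<open>\<delta>\<close> is small
  enough: as \<open>\<delta>\<close> tends to \<open>0\<close>, the weighted norm of \<open>\<mu>\<close> tends to the unweighted one
  (\<open>rapid_neumann_sum\<close>).  The inverse function theorem turns \<open>w\<close> into a chart.
\<close>

section \<open>Calculus of smooth maps\<close>

lemma Ck_on_cong:
  assumes "open S" "\<And>x. x \<in> S \<Longrightarrow> f x = g x" "Ck_on k S f"
  shows "Ck_on k S g"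
  using assms(2,3)
proof (induction k arbitrary: f g)
  case 0
  then show ?case by (simp cong: continuous_on_cong)
next
  case (Suc k)
  have d: "(g has_derivative frechet_derivative f (at x)) (at x)" if "x \<in> S" for x
  proof -
    have "(f has_derivative frechet_derivative f (at x)) (at x)"
      using Suc.prems(2) that frechet_derivative_works by auto
    then show ?thesis
      by (rule has_derivative_transform_within_open[OF _ assms(1) that]) (use Suc.prems in auto)
  qed
  have e: "frechet_derivative f (at x) h = frechet_derivative g (at x) h" if "x \<in> S" for x h
    using frechet_derivative_at[OF d[OF that]] by metis
  have "Ck_on k S (\<lambda>x. frechet_derivative g (at x) h)" for h
    by (rule Suc.IH[of "\<lambda>x. frechet_derivative f (at x) h"]) (use e Suc.prems(2) in auto)
  then show ?case using d by (auto simp: differentiable_def)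
qed

lemma Ck_on_subset: "Ck_on k S f \<Longrightarrow> T \<subseteq> S \<Longrightarrow> Ck_on k T f"
  by (induction k arbitrary: f) (auto intro: continuous_on_subset)

lemma Ck_on_Suc_imp: "Ck_on (Suc k) S f \<Longrightarrow> Ck_on k S f"
proof (induction k arbitrary: f)
  case 0
  then show ?case
    by (auto intro!: continuous_at_imp_continuous_on differentiable_imp_continuous_within)
next
  case (Suc k)
  have d: "\<forall>x\<in>S. f differentiable at x" and "Ck_on (Suc k) S (\<lambda>x. frechet_derivative f (at x) h)" for h
    using Suc.prems unfolding Ck_on.simps(2)[of "Suc k"] by blast+
  then have "Ck_on k S (\<lambda>x. frechet_derivative f (at x) h)" for h by (intro Suc.IH)
  with d show ?case unfolding Ck_on.simps(2) by blast
qed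

lemma Ck_on_local:
  assumes "\<And>x. x \<in> S \<Longrightarrow> \<exists>T. open T \<and> x \<in> T \<and> Ck_on k T f"
  shows "Ck_on k S f"
  using assms
proof (induction k arbitrary: f)
  case 0
  have "isCont f x" if "x \<in> S" for x
    using 0[OF that] by (auto simp: continuous_on_eq_continuous_at)
  then show ?case by (auto intro: continuous_at_imp_continuous_on)
next
  case (Suc k)
  show ?case unfolding Ck_on.simps(2)
  proof (intro conjI ballI allI)
    fix x assume "x \<in> S" then show "f differentiable at x" using Suc.prems by fastforce
  next
    fix h show "Ck_on k S (\<lambda>x. frechet_derivative f (at x) h)"
      by (rule Suc.IH) (use Suc.prems in fastforce)
  qed
qed

lemma Ck_on_SucI:
  assumes "open S" "\<And>x. x \<in> S \<Longrightarrow> (f has_derivative f' x) (at x)" "\<And>h. Ck_on k S (\<lambda>x. f' x h)"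
  shows "Ck_on (Suc k) S f"
  unfolding Ck_on.simps(2)
proof (intro conjI ballI allI)
  fix x assume "x \<in> S" then show "f differentiable at x" using assms(2) differentiable_def by blast
next
  fix h show "Ck_on k S (\<lambda>x. frechet_derivative f (at x) h)"
    by (rule Ck_on_cong[OF assms(1) _ assms(3)[of h]]) (use assms(2) frechet_derivative_at in metis)
qed

lemma Ck_on_has_derivative:
  "Ck_on (Suc k) S f \<Longrightarrow> x \<in> S \<Longrightarrow> (f has_derivative frechet_derivative f (at x)) (at x)"
  using frechet_derivative_works by auto

lemma Ck_on_const: "Ck_on k S (\<lambda>x. c)"
  by (induction k arbitrary: c) auto

lemma Ck_on_linear:
  assumes "open S" "bounded_linear L" "Ck_on k S f"
  shows "Ck_on k S (\<lambda>x. L (f x))"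
  using assms(3)
proof (induction k arbitrary: f)
  case 0
  then show ?case using assms(2) by (auto intro: bounded_linear.continuous_on)
next
  case (Suc k)
  show ?case
  proof (rule Ck_on_SucI[OF assms(1)])
    fix x assume "x \<in> S"
    from Ck_on_has_derivative[OF Suc.prems this]
    show "((\<lambda>x. L (f x)) has_derivative (\<lambda>h. L (frechet_derivative f (at x) h))) (at x)"
      by (rule bounded_linear.has_derivative[OF assms(2)])
  next
    fix h show "Ck_on k S (\<lambda>x. L (frechet_derivative f (at x) h))"
      using Suc by auto
  qed
qed

lemma Ck_on_id: "Ck_on k S (\<lambda>x. x)"
  by (cases k) (auto simp: Ck_on_const)

lemma Ck_on_add:
  assumes "open S" "Ck_on k S f" "Ck_on k S g"
  shows "Ck_on k S (\<lambda>x. f x + g x)"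
  using assms(2,3)
proof (induction k arbitrary: f g)
  case 0
  then show ?case by (auto intro: continuous_intros)
next
  case (Suc k)
  show ?case
    by (rule Ck_on_SucI[OF assms(1), where f' = "\<lambda>x h. frechet_derivative f (at x) h + frechet_derivative g (at x) h"])
      (use Suc in \<open>auto intro!: has_derivative_add Ck_on_has_derivative\<close>)
qed

lemma Ck_on_sum:
  assumes "open S" "\<And>i. i \<in> I \<Longrightarrow> Ck_on k S (f i)"
  shows "Ck_on k S (\<lambda>x. \<Sum>i\<in>I. f i x)"
proof (cases "finite I")
  case True
  then show ?thesis using assms(2)
    by (induction I rule: finite_induct) (auto simp: Ck_on_const intro!: Ck_on_add[OF assms(1)])
qed (simp add: Ck_on_const)

lemma Ck_on_bilinear:
  assumes "open S" "bounded_bilinear B" "Ck_on k S f" "Ck_on k S g"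
  shows "Ck_on k S (\<lambda>x. B (f x) (g x))"
  using assms(3,4)
proof (induction k arbitrary: f g)
  case 0
  then show ?case using assms(2) by (auto intro: bounded_bilinear.continuous_on)
next
  case (Suc k)
  show ?case
  proof (rule Ck_on_SucI[OF assms(1)])
    fix x assume x: "x \<in> S"
    show "((\<lambda>x. B (f x) (g x)) has_derivative
       (\<lambda>h. B (f x) (frechet_derivative g (at x) h) + B (frechet_derivative f (at x) h) (g x))) (at x)"
      by (rule bounded_bilinear.FDERIV[OF assms(2)]) (use x Suc.prems in \<open>auto intro: Ck_on_has_derivative\<close>)
  next
    fix h
    have "Ck_on k S f" "Ck_on k S g" using Suc.prems Ck_on_Suc_imp by blast+
    then show "Ck_on k S (\<lambda>x. B (f x) (frechet_derivative g (at x) h) + B (frechet_derivative f (at x) h) (g x))"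
      using Suc by (auto intro!: Ck_on_add[OF assms(1)])
  qed
qed

text \<open>Expanding the derivative of the outer map in a basis turns the chain rule into a finite sum of
  products of maps of one order less, to which the induction hypothesis applies.\<close>

lemma Ck_on_compose:
  fixes g :: "'a::euclidean_space \<Rightarrow> 'b::euclidean_space" and f :: "'b \<Rightarrow> 'c::real_normed_vector"
  assumes "open S" "g ` S \<subseteq> T" "Ck_on k S g" "Ck_on k T f"
  shows "Ck_on k S (\<lambda>x. f (g x))"
  using assms(3,4)
proof (induction k arbitrary: f)
  case 0
  then show ?case using assms(2) by (auto intro: continuous_on_compose2)
next
  case (Suc k)
  show ?case
  proof (rule Ck_on_SucI[OF assms(1)])
    fix x assume x: "x \<in> S"
    have df: "(f has_derivative frechet_derivative f (at (g x))) (at (g x))"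
      by (rule Ck_on_has_derivative[OF Suc.prems(2)]) (use x assms(2) in auto)
    have "((\<lambda>x. f (g x)) has_derivative (\<lambda>h. frechet_derivative f (at (g x)) (frechet_derivative g (at x) h))) (at x)"
      by (rule has_derivative_compose[OF Ck_on_has_derivative[OF Suc.prems(1) x] df])
    moreover have "frechet_derivative f (at (g x)) v = (\<Sum>b\<in>Basis. (v \<bullet> b) *\<^sub>R frechet_derivative f (at (g x)) b)" for v
    proof -
      interpret bounded_linear "frechet_derivative f (at (g x))" using df has_derivative_bounded_linear by blast
      show ?thesis by (subst euclidean_representation[symmetric, of v]) (simp only: sum scaleR)
    qed
    then have "(\<lambda>h. frechet_derivative f (at (g x)) (frechet_derivative g (at x) h)) =
      (\<lambda>h. \<Sum>b\<in>Basis. (frechet_derivative g (at x) h \<bullet> b) *\<^sub>R frechet_derivative f (at (g x)) b)"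
      by (rule ext)
    ultimately show "((\<lambda>x. f (g x)) has_derivative
      (\<lambda>h. \<Sum>b\<in>Basis. (frechet_derivative g (at x) h \<bullet> b) *\<^sub>R frechet_derivative f (at (g x)) b)) (at x)"
      by (simp only:)
  next
    fix h
    have g: "Ck_on k S g" using Suc.prems Ck_on_Suc_imp by blast
    show "Ck_on k S (\<lambda>x. \<Sum>b\<in>Basis. (frechet_derivative g (at x) h \<bullet> b) *\<^sub>R frechet_derivative f (at (g x)) b)"
    proof (intro Ck_on_sum[OF assms(1)] Ck_on_bilinear[OF assms(1) bounded_bilinear_scaleR]
           Ck_on_linear[OF assms(1) bounded_linear_inner_left] Suc.IH[OF g])
      show "Ck_on k S (\<lambda>x. frechet_derivative g (at x) h)" using Suc.prems(1) by simp
      show "Ck_on k T (\<lambda>x. frechet_derivative f (at x) b)" for b using Suc.prems(2) by simp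
    qed
  qed
qed

lemma Ck_on_vector_derivativeI:
  fixes f :: "real \<Rightarrow> 'b::real_normed_vector"
  assumes "open S" "\<And>x. x \<in> S \<Longrightarrow> (f has_vector_derivative g x) (at x)" "Ck_on k S g"
  shows "Ck_on (Suc k) S f"
  by (rule Ck_on_SucI[OF assms(1) assms(2)[unfolded has_vector_derivative_def]])
    (use assms(3) in \<open>auto intro!: Ck_on_linear[OF assms(1) bounded_linear_scaleR_right]\<close>)

lemma Ck_on_inverse_aux: "Ck_on k (- {0 :: 'a::{real_normed_field,euclidean_space}}) inverse"
proof (induction k)
  case 0
  then show ?case by (auto intro!: continuous_intros)
next
  case (Suc k)
  show ?case
    by (rule Ck_on_SucI[where f' = "\<lambda>x h. - (inverse x * h * inverse x)"])
      (auto intro!: Suc Ck_on_linear[OF _ bounded_linear_minus[OF bounded_linear_ident]]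
         Ck_on_bilinear[OF _ bounded_bilinear_mult] Ck_on_const has_derivative_inverse')
qed

lemma Ck_on_inverse:
  fixes f :: "'a::euclidean_space \<Rightarrow> 'b::{real_normed_field,euclidean_space}"
  assumes "open S" "Ck_on k S f" "\<And>x. x \<in> S \<Longrightarrow> f x \<noteq> 0"
  shows "Ck_on k S (\<lambda>x. inverse (f x))"
  by (rule Ck_on_compose[OF assms(1) _ assms(2) Ck_on_inverse_aux]) (use assms(3) in auto)

lemma Ck_on_sin_cos: "Ck_on k UNIV (sin :: real \<Rightarrow> real) \<and> Ck_on k UNIV (cos :: real \<Rightarrow> real)"
proof (induction k)
  case 0
  then show ?case by (auto intro!: continuous_intros)
next
  case (Suc k)
  show ?case
  proof
    show "Ck_on (Suc k) UNIV (sin :: real \<Rightarrow> real)"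
      by (rule Ck_on_vector_derivativeI[where g = cos])
        (use Suc in \<open>auto intro!: derivative_eq_intros simp: has_real_derivative_iff_has_vector_derivative[symmetric]\<close>)
    show "Ck_on (Suc k) UNIV (cos :: real \<Rightarrow> real)"
      by (rule Ck_on_vector_derivativeI[where g = "\<lambda>x. - sin x"])
        (use Suc in \<open>auto intro!: derivative_eq_intros Ck_on_linear[OF _ bounded_linear_minus[OF bounded_linear_ident]]
            simp: has_real_derivative_iff_has_vector_derivative[symmetric]\<close>)
  qed
qed

lemma smooth_on_cong: "open S \<Longrightarrow> (\<And>x. x \<in> S \<Longrightarrow> f x = g x) \<Longrightarrow> smooth_on S f \<Longrightarrow> smooth_on S g"
  unfolding smooth_on_def using Ck_on_cong by blast

lemma smooth_on_subset: "smooth_on S f \<Longrightarrow> T \<subseteq> S \<Longrightarrow> smooth_on T f"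
  unfolding smooth_on_def using Ck_on_subset by blast

lemma smooth_on_local:
  "(\<And>x. x \<in> S \<Longrightarrow> \<exists>T. open T \<and> x \<in> T \<and> smooth_on T f) \<Longrightarrow> smooth_on S f"
  unfolding smooth_on_def by (meson Ck_on_local)

lemma smooth_on_const: "smooth_on S (\<lambda>x. c)"
  by (simp add: smooth_on_def Ck_on_const)

lemma smooth_on_id: "smooth_on S (\<lambda>x. x)"
  by (simp add: smooth_on_def Ck_on_id)

lemma smooth_on_linear: "open S \<Longrightarrow> bounded_linear L \<Longrightarrow> smooth_on S f \<Longrightarrow> smooth_on S (\<lambda>x. L (f x))"
  by (simp add: smooth_on_def Ck_on_linear)

lemma smooth_on_add: "open S \<Longrightarrow> smooth_on S f \<Longrightarrow> smooth_on S g \<Longrightarrow> smooth_on S (\<lambda>x. f x + g x)"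
  by (simp add: smooth_on_def Ck_on_add)

lemma smooth_on_minus: "open S \<Longrightarrow> smooth_on S f \<Longrightarrow> smooth_on S (\<lambda>x. - f x)"
  by (rule smooth_on_linear[OF _ bounded_linear_minus[OF bounded_linear_ident]])

lemma smooth_on_diff: "open S \<Longrightarrow> smooth_on S f \<Longrightarrow> smooth_on S g \<Longrightarrow> smooth_on S (\<lambda>x. f x - g x)"
  using smooth_on_add[of S f "\<lambda>x. - g x"] smooth_on_minus by fastforce

lemma smooth_on_bilinear:
  "open S \<Longrightarrow> bounded_bilinear B \<Longrightarrow> smooth_on S f \<Longrightarrow> smooth_on S g \<Longrightarrow> smooth_on S (\<lambda>x. B (f x) (g x))"
  by (simp add: smooth_on_def Ck_on_bilinear)

lemmas smooth_on_mult = smooth_on_bilinear[OF _ bounded_bilinear_mult]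
lemmas smooth_on_scaleR = smooth_on_bilinear[OF _ bounded_bilinear_scaleR]
lemmas smooth_on_inner = smooth_on_bilinear[OF _ bounded_bilinear_inner]

lemma smooth_on_compose:
  fixes g :: "'a::euclidean_space \<Rightarrow> 'b::euclidean_space" and f :: "'b \<Rightarrow> 'c::real_normed_vector"
  shows "open S \<Longrightarrow> g ` S \<subseteq> T \<Longrightarrow> smooth_on S g \<Longrightarrow> smooth_on T f \<Longrightarrow> smooth_on S (\<lambda>x. f (g x))"
  unfolding smooth_on_def using Ck_on_compose by blast

lemma smooth_on_inverse:
  fixes f :: "'a::euclidean_space \<Rightarrow> 'b::{real_normed_field,euclidean_space}"
  shows "open S \<Longrightarrow> smooth_on S f \<Longrightarrow> (\<And>x. x \<in> S \<Longrightarrow> f x \<noteq> 0) \<Longrightarrow> smooth_on S (\<lambda>x. inverse (f x))"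
  by (simp add: smooth_on_def Ck_on_inverse)

lemma smooth_on_divide:
  fixes f :: "'a::euclidean_space \<Rightarrow> 'b::{real_normed_field,euclidean_space}"
  shows "open S \<Longrightarrow> smooth_on S f \<Longrightarrow> smooth_on S g \<Longrightarrow> (\<And>x. x \<in> S \<Longrightarrow> g x \<noteq> 0) \<Longrightarrow> smooth_on S (\<lambda>x. f x / g x)"
  by (simp add: divide_inverse smooth_on_mult smooth_on_inverse)

lemma smooth_on_Pair:
  fixes f :: "'a::euclidean_space \<Rightarrow> 'b::real_normed_vector" and g :: "'a \<Rightarrow> 'c::real_normed_vector"
  assumes "open S" "smooth_on S f" "smooth_on S g"
  shows "smooth_on S (\<lambda>x. (f x, g x))"
proof -
  have "smooth_on S (\<lambda>x. (f x, 0 :: 'c))" "smooth_on S (\<lambda>x. (0 :: 'b, g x))"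
    by (intro smooth_on_linear[OF assms(1) _ assms(2)] smooth_on_linear[OF assms(1) _ assms(3)]
          bounded_linear_Pair bounded_linear_ident bounded_linear_zero)+
  from smooth_on_add[OF assms(1) this] show ?thesis by simp
qed

lemma smooth_on_derivative: "smooth_on S f \<Longrightarrow> smooth_on S (\<lambda>x. frechet_derivative f (at x) h)"
  unfolding smooth_on_def using Ck_on.simps(2) by blast

lemma smooth_on_has_derivative:
  "smooth_on S f \<Longrightarrow> x \<in> S \<Longrightarrow> (f has_derivative frechet_derivative f (at x)) (at x)"
  unfolding smooth_on_def using Ck_on_has_derivative by blast

lemma smooth_on_continuous: "smooth_on S f \<Longrightarrow> continuous_on S f"
  unfolding smooth_on_def using Ck_on.simps(1) by blast

section \<open>A smooth periodic function that is the identity near the origin\<close>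

text \<open>The powers of \<open>1/t\<close> are included because the derivatives of \<open>exp (- 1/t)\<close> are combinations of
  these functions; one induction then covers the derivatives of all of them.\<close>

definition flat :: "nat \<Rightarrow> real \<Rightarrow> real" where
  "flat n t = (if t > 0 then inverse t ^ n * exp (- inverse t) else 0)"

text \<open>This is \<open>s^(n+2) / (n+2)! \<le> exp s\<close> at \<open>s = 1/t\<close>.  The square on the right makes \<open>flat n\<close>
  differentiable at \<open>0\<close>, with derivative \<open>0\<close>.\<close>

lemma flat_bound: "t \<ge> 0 \<Longrightarrow> flat n t \<le> fact (n + 2) * t ^ 2"
proof (cases "t > 0")
  case True
  have "inverse t ^ (n + 2) / fact (n + 2) \<le> exp (inverse t)"
  proof -
    have "(\<Sum>i\<in>{n+2}. inverse t ^ i / fact i) \<le> (\<Sum>i. inverse t ^ i / fact i)"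
      using True by (intro sum_le_suminf) (auto intro: summable_exp simp: divide_inverse mult.commute summable_exp)
    then show ?thesis by (simp add: exp_def divide_inverse mult.commute)
  qed
  then have "inverse t ^ (n + 2) * exp (- inverse t) \<le> fact (n + 2)"
  proof -
    have "A / F \<le> E \<Longrightarrow> F > 0 \<Longrightarrow> E > 0 \<Longrightarrow> A * inverse E \<le> F" for A E F :: real
      by (simp add: field_simps)
    then show "inverse t ^ (n + 2) / fact (n + 2) \<le> exp (inverse t) \<Longrightarrow> ?thesis"
      unfolding exp_minus using fact_gt_zero exp_gt_zero by blast
  qed
  then have "inverse t ^ (n + 2) * exp (- inverse t) * t ^ 2 \<le> fact (n + 2) * t ^ 2"
    by (intro mult_right_mono) auto
  then show ?thesis using True by (simp add: flat_def power_add field_simps power2_eq_square)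
qed (simp add: flat_def)

lemma flat_nonneg: "flat n t \<ge> 0" by (simp add: flat_def)

lemma flat_deriv: "(flat n has_real_derivative (flat (n + 2) t - n * flat (n + 1) t)) (at t)"
proof -
  consider "t > 0" | "t = 0" | "t < 0" by linarith
  then show ?thesis
  proof cases
    case 1
    have "((\<lambda>t. inverse t ^ n * exp (- inverse t)) has_real_derivative
       (real n * inverse t ^ (n - 1) * (- (inverse t ^ Suc (Suc 0))) * exp (- inverse t)
        + inverse t ^ n * (exp (- inverse t) * inverse t ^ Suc (Suc 0)))) (at t)"
      using 1 by (auto intro!: derivative_eq_intros)
    moreover have "real n * inverse t ^ (n - 1) * (- (inverse t ^ Suc (Suc 0))) * exp (- inverse t)
        + inverse t ^ n * (exp (- inverse t) * inverse t ^ Suc (Suc 0)) = flat (n + 2) t - n * flat (n + 1) t"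
      using 1 by (cases n) (simp_all add: flat_def algebra_simps)
    ultimately have "((\<lambda>t. inverse t ^ n * exp (- inverse t)) has_real_derivative
        (flat (n + 2) t - n * flat (n + 1) t)) (at t)" by simp
    then show ?thesis
      by (rule DERIV_cong_ev[THEN iffD1, rotated -1])
         (use 1 eventually_nhds_in_open[of "{0<..}" t] in \<open>auto simp: flat_def elim!: eventually_mono\<close>)
  next
    case 2
    have "((\<lambda>h. flat n h / h) \<longlongrightarrow> 0) (at 0)"
    proof (rule Lim_null_comparison)
      show "eventually (\<lambda>h. norm (flat n h / h) \<le> fact (n + 2) * \<bar>h\<bar>) (at 0)"
      proof (rule always_eventually, rule allI)
        fix h :: real
        show "norm (flat n h / h) \<le> fact (n + 2) * \<bar>h\<bar>"
        proof (cases "h > 0")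
          case True
          then show ?thesis using flat_bound[of h n] flat_nonneg[of n h]
            by (simp add: divide_le_eq power2_eq_square mult.assoc)
        next
          case False
          then have "flat n h = 0" by (simp add: flat_def)
          then show ?thesis by (simp only: div_0 norm_zero) simp
        qed
      qed
      show "((\<lambda>h. fact (n + 2) * \<bar>h\<bar>) \<longlongrightarrow> 0) (at (0::real))" by (auto intro!: tendsto_eq_intros)
    qed
    then show ?thesis using 2 by (simp add: DERIV_def flat_def)
  next
    case 3
    have "((\<lambda>t. 0) has_real_derivative (flat (n + 2) t - n * flat (n + 1) t)) (at t)"
      using 3 by (simp add: flat_def)
    then show ?thesis
      by (rule DERIV_cong_ev[THEN iffD1, rotated -1])
         (use 3 eventually_nhds_in_open[of "{..<0}" t] in \<open>auto simp: flat_def elim!: eventually_mono\<close>)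
  qed
qed

lemma smooth_flat: "smooth_on UNIV (flat n)"
  unfolding smooth_on_def
proof
  fix k show "Ck_on k UNIV (flat n)"
  proof (induction k arbitrary: n)
    case 0
    have "isCont (flat n) x" for x using flat_deriv by (rule DERIV_isCont)
    then show ?case by (simp add: continuous_on_eq_continuous_at)
  next
    case (Suc k)
    have "Ck_on k UNIV (\<lambda>x. flat (n + 2) x + (- real n) * flat (n + 1) x)"
      by (intro Ck_on_add Ck_on_bilinear[OF _ bounded_bilinear_mult] Ck_on_const Suc) auto
    then have "Ck_on k UNIV (\<lambda>x. flat (n + 2) x - n * flat (n + 1) x)" by simp
    then show ?case
      by (intro Ck_on_vector_derivativeI) (use flat_deriv in \<open>auto simp: has_real_derivative_iff_has_vector_derivative\<close>)
  qed
qed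

definition step :: "real \<Rightarrow> real" where
  "step c = flat 0 c / (flat 0 c + flat 0 (1/2 - c))"

lemma smooth_step: "smooth_on UNIV step"
proof -
  have r: "smooth_on UNIV (\<lambda>c. flat 0 (1/2 - c))"
    by (rule smooth_on_compose[OF _ _ _ smooth_flat]) (auto intro!: smooth_on_diff smooth_on_const smooth_on_id)
  have "flat 0 c + flat 0 (1/2 - c) \<noteq> 0" for c
    by (auto simp: flat_def add_pos_pos intro!: less_imp_neq[symmetric])
  then have "smooth_on UNIV (\<lambda>c. flat 0 c / (flat 0 c + flat 0 (1/2 - c)))"
    by (intro smooth_on_divide smooth_on_add smooth_flat r) auto
  then show ?thesis unfolding step_def[abs_def] .
qed

lemma step_eq_0: "c \<le> 0 \<Longrightarrow> step c = 0" by (simp add: step_def flat_def)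
lemma step_eq_1: "c \<ge> 1/2 \<Longrightarrow> step c = 1" by (simp add: step_def flat_def)
lemma step_bounds: "0 \<le> step c" "step c \<le> 1"
  using flat_nonneg[of 0 c] flat_nonneg[of 0 "1/2 - c"] by (auto simp: step_def divide_le_eq)

text \<open>\<open>Arg (cis x)\<close> is \<open>x\<close> reduced to \<open>(-\<pi>, \<pi>]\<close>.  It jumps only where \<open>cos x = -1\<close>, and there the cut-off
  factor vanishes.\<close>

definition saw :: "real \<Rightarrow> real" where
  "saw x = Arg (cis x) * step (cos x)"

lemma saw_periodic: "saw (x + 2 * pi) = saw x" by (simp add: saw_def cis_mult[symmetric])

lemma saw_eq: "\<bar>x\<bar> < 1 \<Longrightarrow> saw x = x"
proof -
  assume x: "\<bar>x\<bar> < 1"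
  have "cos (pi/3) \<le> cos \<bar>x\<bar>" using x pi_gt3 by (intro cos_monotone_0_pi_le) auto
  then have "cos x \<ge> 1/2" by (simp add: cos_60)
  moreover have "Arg (cis x) = x" using x pi_gt3 by (intro Arg_cis) auto
  ultimately show ?thesis by (simp add: saw_def step_eq_1)
qed

lemma saw_bound: "\<bar>saw x\<bar> \<le> pi"
proof -
  have "\<bar>Arg (cis x)\<bar> \<le> pi" using mpi_less_Arg[of "cis x"] Arg_le_pi[of "cis x"] by auto
  then have "\<bar>Arg (cis x)\<bar> * step (cos x) \<le> pi * 1" using step_bounds by (intro mult_mono) auto
  then show ?thesis using step_bounds by (simp add: saw_def abs_mult)
qed

lemma smooth_saw: "smooth_on UNIV saw"
proof (rule smooth_on_local)
  fix x :: real
  have op: "open {x::real. cos x > -1}" "open {x::real. cos x < 0}"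
    by - (rule open_Collect_less; intro continuous_intros)+
  have c: "smooth_on UNIV (\<lambda>x::real. step (cos x))"
    by (rule smooth_on_compose[OF _ _ _ smooth_step]) (use Ck_on_sin_cos in \<open>auto simp: smooth_on_def\<close>)
  have A: "smooth_on {x. cos x > -1} (\<lambda>x. Arg (cis x))"
    unfolding smooth_on_def
  proof
    fix k
    have "((\<lambda>x. Arg (cis x)) has_vector_derivative 1) (at x)" if "cos x > -1" for x
    proof -
      have n: "cis x \<notin> \<real>\<^sub>\<le>\<^sub>0"
      proof
        assume "cis x \<in> \<real>\<^sub>\<le>\<^sub>0"
        then have "sin x = 0" "cos x \<le> 0" by (auto simp: complex_nonpos_Reals_iff)
        then show False using that sin_zero_abs_cos_one[of x] by linarith
      qed
      have "(cis has_vector_derivative \<i> * cis x) (at x)"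
        unfolding has_vector_derivative_def
        by (rule has_derivative_eq_rhs[OF has_derivative_cis[OF has_derivative_ident]])
          (simp add: fun_eq_iff scaleR_conv_of_real)
      from field_vector_diff_chain_at[OF this has_field_derivative_Ln[OF n]]
      have "((\<lambda>x. Ln (cis x)) has_vector_derivative \<i>) (at x)"
        by (simp add: o_def divide_inverse mult.assoc cis_mult)
      from bounded_linear.has_vector_derivative[OF bounded_linear_Im this]
      show ?thesis by (simp add: Arg_eq_Im_Ln)
    qed
    then show "Ck_on k {x. cos x > -1} (\<lambda>x. Arg (cis x))"
      by (rule Ck_on_Suc_imp[OF Ck_on_vector_derivativeI[OF op(1) _ Ck_on_const]]) auto
  qed
  show "\<exists>T. open T \<and> x \<in> T \<and> smooth_on T saw"
  proof (cases "cos x < 0")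
    case True
    have "smooth_on {x. cos x < 0} saw"
      by (rule smooth_on_cong[OF op(2) _ smooth_on_const[where c=0]]) (simp add: saw_def step_eq_0)
    then show ?thesis using True op(2) by blast
  next
    case False
    have "smooth_on {x. cos x > -1} saw"
      unfolding saw_def[abs_def] by (intro smooth_on_mult op A smooth_on_subset[OF c]) auto
    then show ?thesis using False op(1) by (intro exI[of _ "{x. cos x > -1}"]) auto
  qed
qed

section \<open>Trigonometric series with rapidly decreasing coefficients\<close>

type_synonym freq = "int \<times> int"

definition pairing :: "freq \<Rightarrow> complex \<Rightarrow> real" where
  "pairing k z = of_int (fst k) * Re z + of_int (snd k) * Im z"

definition wave :: "freq \<Rightarrow> complex \<Rightarrow> complex" where
  "wave k z = cis (pairing k z)"

definition series :: "(freq \<Rightarrow> complex) \<Rightarrow> complex \<Rightarrow> complex" where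
  "series a z = (\<Sum>\<^sub>\<infinity>k. a k * wave k z)"

definition size_of :: "freq \<Rightarrow> real" where
  "size_of k = \<bar>of_int (fst k)\<bar> + \<bar>of_int (snd k)\<bar>"

definition weight :: "nat \<Rightarrow> real \<Rightarrow> freq \<Rightarrow> real" where
  "weight N \<delta> k = (1 + \<delta> * size_of k) ^ N"

definition wnorm :: "(freq \<Rightarrow> real) \<Rightarrow> (freq \<Rightarrow> complex) \<Rightarrow> real" where
  "wnorm w a = (\<Sum>\<^sub>\<infinity>k. w k * norm (a k))"

definition wsummable :: "(freq \<Rightarrow> real) \<Rightarrow> (freq \<Rightarrow> complex) \<Rightarrow> bool" where
  "wsummable w a \<longleftrightarrow> (\<lambda>k. w k * norm (a k)) summable_on UNIV"

definition rapid :: "(freq \<Rightarrow> complex) \<Rightarrow> bool" where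
  "rapid a \<longleftrightarrow> (\<forall>N. wsummable (weight N 1) a)"

text \<open>For such weights the weighted \<open>l^1\<close> norm is submultiplicative under convolution and dominates the
  unweighted one.\<close>

definition submult :: "(freq \<Rightarrow> real) \<Rightarrow> bool" where
  "submult w \<longleftrightarrow> (\<forall>k. 1 \<le> w k) \<and> (\<forall>j k. w (j + k) \<le> w j * w k)"

lemma size_of_nonneg: "0 \<le> size_of k" by (simp add: size_of_def)

lemma size_of_triangle: "size_of (j + k) \<le> size_of j + size_of k"
  by (simp add: size_of_def)

lemma abs_pairing: "\<bar>pairing k z\<bar> \<le> size_of k * norm z"
proof -
  have "\<bar>pairing k z\<bar> \<le> \<bar>of_int (fst k)\<bar> * \<bar>Re z\<bar> + \<bar>of_int (snd k)\<bar> * \<bar>Im z\<bar>"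
    unfolding pairing_def by (metis abs_mult abs_triangle_ineq)
  also have "\<dots> \<le> \<bar>of_int (fst k)\<bar> * norm z + \<bar>of_int (snd k)\<bar> * norm z"
    by (intro add_mono mult_left_mono abs_Re_le_cmod abs_Im_le_cmod) auto
  finally show ?thesis by (simp add: size_of_def distrib_right)
qed

lemma pairing_linear: "pairing k (y + z) = pairing k y + pairing k z"
  "pairing k (r *\<^sub>R z) = r * pairing k z" "pairing k (y - z) = pairing k y - pairing k z"
  by (simp_all add: pairing_def algebra_simps)

lemma pairing_add_freq: "pairing (j + k) z = pairing j z + pairing k z"
  by (simp add: pairing_def algebra_simps)

lemma wave_add_freq: "wave (j + k) z = wave j z * wave k z"
  by (simp add: wave_def pairing_add_freq cis_mult)

lemma norm_wave [simp]: "norm (wave k z) = 1" by (simp add: wave_def)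

lemma submult_weight: "0 \<le> \<delta> \<Longrightarrow> submult (weight N \<delta>)"
proof -
  assume d: "0 \<le> \<delta>"
  have "(1 + \<delta> * size_of (j + k)) ^ N \<le> (1 + \<delta> * size_of j) ^ N * (1 + \<delta> * size_of k) ^ N" for j k
  proof -
    have "\<delta> * size_of (j + k) \<le> \<delta> * size_of j + \<delta> * size_of k"
      using mult_left_mono[OF size_of_triangle d] by (simp add: distrib_left)
    then have "1 + \<delta> * size_of (j + k) \<le> (1 + \<delta> * size_of j) * (1 + \<delta> * size_of k)"
      using mult_nonneg_nonneg[OF mult_nonneg_nonneg[OF d size_of_nonneg] mult_nonneg_nonneg[OF d size_of_nonneg], of j k]
      by (simp add: algebra_simps)
    then show ?thesis unfolding power_mult_distrib[symmetric]
      by (rule power_mono) (use d size_of_nonneg in auto)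
  qed
  then show ?thesis using d size_of_nonneg by (auto simp: submult_def weight_def intro!: one_le_power)
qed

lemma submult_one: "submult (\<lambda>k. 1)" by (simp add: submult_def)

lemma submultD: "submult w \<Longrightarrow> 1 \<le> w k" "submult w \<Longrightarrow> 0 \<le> w k" "submult w \<Longrightarrow> w (j + k) \<le> w j * w k"
  unfolding submult_def by (blast, meson order_trans zero_le_one, blast)

lemma wsummable_mono:
  assumes "wsummable w a" "\<And>k. 0 \<le> v k" "\<And>k. v k * norm (b k) \<le> C * (w k * norm (a k))"
  shows "wsummable v b"
proof -
  have "(\<lambda>k. norm (v k * norm (b k))) summable_on UNIV"
    by (rule Infinite_Sum.abs_summable_on_comparison_test'[where g = "\<lambda>k. C * (w k * norm (a k))"])
      (use assms in \<open>auto simp: wsummable_def abs_mult intro: summable_on_cmult_right\<close>)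
  then show ?thesis using assms(2) by (simp add: wsummable_def abs_mult)
qed

lemma rapid_summable: "rapid a \<Longrightarrow> wsummable (\<lambda>k. 1) a"
  unfolding rapid_def using wsummable_mono[of "weight 0 1" a "\<lambda>k. 1" a 1] by (auto simp: weight_def)

lemma rapid_poly:
  assumes "rapid a" "\<And>k. norm (b k) \<le> C * (1 + size_of k) ^ M * norm (a k)"
  shows "rapid b"
  unfolding rapid_def
proof
  fix N show "wsummable (weight N 1) b"
  proof (rule wsummable_mono)
    show "wsummable (weight (N + M) 1) a" using assms(1) by (simp add: rapid_def)
    show "0 \<le> weight N 1 k" for k using size_of_nonneg by (simp add: weight_def)
    show "weight N 1 k * norm (b k) \<le> C * (weight (N + M) 1 k * norm (a k))" for k
      using mult_left_mono[OF assms(2)[of k], of "weight N 1 k"] size_of_nonneg[of k]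
      by (simp add: weight_def power_add mult_ac)
  qed
qed

lemma series_abs_summable:
  assumes "wsummable (\<lambda>k. 1) a"
  shows "(\<lambda>k. norm (a k * wave k z)) summable_on UNIV" "(\<lambda>k. a k * wave k z) summable_on UNIV"
proof -
  show "(\<lambda>k. norm (a k * wave k z)) summable_on UNIV" using assms by (simp add: wsummable_def norm_mult)
  then show "(\<lambda>k. a k * wave k z) summable_on UNIV" by (rule abs_summable_summable)
qed

lemma norm_series_le: "wsummable (\<lambda>k. 1) a \<Longrightarrow> norm (series a z) \<le> wnorm (\<lambda>k. 1) a"
  using norm_infsum_bound[OF series_abs_summable(1)[of a z]] by (simp add: series_def wnorm_def norm_mult)

lemma infsum_diff_banach:
  fixes f g :: "'a \<Rightarrow> 'b::banach"
  assumes "f summable_on A" "g summable_on A"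
  shows "(\<lambda>x. f x - g x) summable_on A" "(\<Sum>\<^sub>\<infinity>x\<in>A. f x - g x) = infsum f A - infsum g A"
  using summable_on_add[of f A "\<lambda>x. - g x"] infsum_add[of f A "\<lambda>x. - g x"] assms
  by (simp_all add: infsum_uminus summable_on_uminus)

lemma series_add:
  "wsummable (\<lambda>k. 1) a \<Longrightarrow> wsummable (\<lambda>k. 1) b \<Longrightarrow> series (\<lambda>k. a k + b k) z = series a z + series b z"
  unfolding series_def by (subst infsum_add[symmetric]) (auto simp: series_abs_summable distrib_right)

lemma series_cmult: "series (\<lambda>k. c * a k) z = c * series a z"
  unfolding series_def by (simp add: infsum_cmult_right' mult.assoc)

text \<open>The second order Taylor estimate behind the termwise differentiation of \<open>series\<close>.\<close>

lemma norm_cis_remainder: "norm (cis t - 1 - \<i> * of_real t) \<le> t\<^sup>2"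
proof -
  have c: "\<bar>cos t - 1\<bar> \<le> t\<^sup>2 / 2"
  proof -
    have "cos t = 1 - 2 * (sin (t/2))\<^sup>2" using cos_double_sin[of "t/2"] by simp
    moreover have "(sin (t/2))\<^sup>2 \<le> (t/2)\<^sup>2"
      using abs_sin_x_le_abs_x[of "t/2"] by (simp only: abs_le_square_iff)
    ultimately show ?thesis by (simp add: power_divide)
  qed
  have s: "\<bar>sin t - t\<bar> \<le> t\<^sup>2 / 2"
    using Maclaurin_sin_bound[of t 2] by (simp add: numeral_2_eq_2 sin_coeff_def)
  have "norm (cis t - 1 - \<i> * of_real t) \<le> \<bar>Re (cis t - 1 - \<i> * of_real t)\<bar> + \<bar>Im (cis t - 1 - \<i> * of_real t)\<bar>"
    by (rule cmod_le)
  also have "\<dots> \<le> t\<^sup>2" using c s by simp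
  finally show ?thesis .
qed

definition diff_coeff :: "(freq \<Rightarrow> complex) \<Rightarrow> complex \<Rightarrow> freq \<Rightarrow> complex" where
  "diff_coeff a h k = \<i> * of_real (pairing k h) * a k"

lemma rapid_diff_coeff:
  assumes "rapid a" shows "rapid (diff_coeff a h)"
proof (rule rapid_poly[OF assms, where C = "norm h" and M = 1])
  fix k
  have "\<bar>pairing k h\<bar> \<le> norm h * (1 + size_of k)"
    using abs_pairing[of k h] norm_ge_zero[of h] unfolding distrib_left mult.commute[of "size_of k"] by linarith
  then show "norm (diff_coeff a h k) \<le> norm h * (1 + size_of k) ^ 1 * norm (a k)"
    by (simp add: diff_coeff_def norm_mult mult_right_mono)
qed

text \<open>The Taylor remainder of the term with frequency \<open>k\<close> is at most \<open>|k|^2 |h|^2 |a_k|\<close>, and the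
  coefficients decrease fast enough for these bounds to be summed.\<close>

lemma series_has_derivative:
  assumes "rapid a"
  shows "(series a has_derivative (\<lambda>h. series (diff_coeff a h) z)) (at z)"
proof -
  have sum2: "wsummable (\<lambda>k. (size_of k)\<^sup>2) a"
    by (rule wsummable_mono[where w = "weight 2 1" and a = a and C = 1])
      (use assms size_of_nonneg in \<open>auto simp: rapid_def weight_def power_mono intro!: mult_right_mono\<close>)
  define C where "C = wnorm (\<lambda>k. (size_of k)\<^sup>2) a"
  note sa = series_abs_summable[OF rapid_summable[OF assms]]
    and sd = series_abs_summable[OF rapid_summable[OF rapid_diff_coeff[OF assms]]]
  have lin: "bounded_linear (\<lambda>h. series (diff_coeff a h) z)"
  proof (rule bounded_linear_intro[where K = "wnorm size_of a"])
    have s1: "wsummable size_of a"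
      by (rule wsummable_mono[where w = "weight 1 1" and a = a and C = 1])
        (use assms size_of_nonneg in \<open>auto simp: rapid_def weight_def intro!: mult_right_mono\<close>)
    fix x y :: complex and r :: real
    have "diff_coeff a (x + y) = (\<lambda>k. diff_coeff a x k + diff_coeff a y k)"
      by (simp add: fun_eq_iff diff_coeff_def pairing_linear algebra_simps)
    then show "series (diff_coeff a (x + y)) z = series (diff_coeff a x) z + series (diff_coeff a y) z"
      by (simp add: series_add rapid_summable rapid_diff_coeff assms)
    have "diff_coeff a (r *\<^sub>R x) = (\<lambda>k. of_real r * diff_coeff a x k)"
      by (simp add: fun_eq_iff diff_coeff_def pairing_linear algebra_simps)
    then show "series (diff_coeff a (r *\<^sub>R x)) z = r *\<^sub>R series (diff_coeff a x) z"
      by (simp add: series_cmult scaleR_conv_of_real)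
    have "norm (series (diff_coeff a x) z) \<le> wnorm (\<lambda>k. 1) (diff_coeff a x)"
      by (intro norm_series_le rapid_summable rapid_diff_coeff assms)
    also have "\<dots> \<le> (\<Sum>\<^sub>\<infinity>k. norm x * (size_of k * norm (a k)))"
      unfolding wnorm_def
    proof (rule infsum_mono)
      show "(\<lambda>k. 1 * norm (diff_coeff a x k)) summable_on UNIV"
        using rapid_summable[OF rapid_diff_coeff[OF assms]] by (simp add: wsummable_def)
      show "(\<lambda>k. norm x * (size_of k * norm (a k))) summable_on UNIV"
        using s1 by (intro summable_on_cmult_right) (simp add: wsummable_def)
      show "1 * norm (diff_coeff a x k) \<le> norm x * (size_of k * norm (a k))" for k
        using mult_right_mono[OF abs_pairing[of k x], of "norm (a k)"] by (simp add: diff_coeff_def norm_mult mult_ac)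
    qed
    also have "\<dots> = norm x * wnorm size_of a" by (simp add: infsum_cmult_right' wnorm_def)
    finally show "norm (series (diff_coeff a x) z) \<le> norm x * wnorm size_of a" .
  qed
  show ?thesis
  proof (rule has_derivativeI_sandwich[where e = 1 and H = "\<lambda>y. C * norm (y - z)"])
    fix y assume "y \<noteq> z"
    define h where "h = y - z"
    have "series a y - series a z - series (diff_coeff a h) z
      = (\<Sum>\<^sub>\<infinity>k. a k * wave k y - a k * wave k z - diff_coeff a h k * wave k z)"
      unfolding series_def by (simp add: infsum_diff_banach sa sd)
    also have "norm \<dots> \<le> (\<Sum>\<^sub>\<infinity>k. (norm h)\<^sup>2 * ((size_of k)\<^sup>2 * norm (a k)))"
    proof (rule norm_infsum_le)
      show "((\<lambda>k. a k * wave k y - a k * wave k z - diff_coeff a h k * wave k z) has_sum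
        (\<Sum>\<^sub>\<infinity>k. a k * wave k y - a k * wave k z - diff_coeff a h k * wave k z)) UNIV"
        by (intro has_sum_infsum infsum_diff_banach(1) sa sd)
      show "((\<lambda>k. (norm h)\<^sup>2 * ((size_of k)\<^sup>2 * norm (a k))) has_sum
        (\<Sum>\<^sub>\<infinity>k. (norm h)\<^sup>2 * ((size_of k)\<^sup>2 * norm (a k)))) UNIV"
        using sum2 by (intro has_sum_infsum summable_on_cmult_right) (simp add: wsummable_def)
      fix k
      have "y = z + h" by (simp add: h_def)
      then have "wave k y = wave k z * cis (pairing k h)" by (simp add: wave_def pairing_linear cis_mult)
      then have "a k * wave k y - a k * wave k z - diff_coeff a h k * wave k z
          = a k * wave k z * (cis (pairing k h) - 1 - \<i> * of_real (pairing k h))"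
        by (simp add: diff_coeff_def algebra_simps)
      then have "norm (a k * wave k y - a k * wave k z - diff_coeff a h k * wave k z)
          = norm (a k) * norm (cis (pairing k h) - 1 - \<i> * of_real (pairing k h))"
        by (simp add: norm_mult)
      also have "\<dots> \<le> norm (a k) * (size_of k * norm h)\<^sup>2"
      proof (intro mult_left_mono)
        have "(pairing k h)\<^sup>2 \<le> (size_of k * norm h)\<^sup>2"
          using abs_pairing[of k h] by (metis abs_ge_zero power2_abs power_mono)
        then show "norm (cis (pairing k h) - 1 - \<i> * of_real (pairing k h)) \<le> (size_of k * norm h)\<^sup>2"
          using norm_cis_remainder order_trans by blast
      qed auto
      finally show "norm (a k * wave k y - a k * wave k z - diff_coeff a h k * wave k z)
          \<le> (norm h)\<^sup>2 * ((size_of k)\<^sup>2 * norm (a k))" by (simp add: power_mult_distrib mult_ac)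
    qed
    also have "\<dots> = C * (norm h)\<^sup>2" by (simp add: infsum_cmult_right' C_def wnorm_def)
    finally show "norm (series a y - series a z - series (diff_coeff a (y - z)) z) / norm (y - z) \<le> C * norm (y - z)"
      using \<open>y \<noteq> z\<close> by (simp add: h_def divide_simps power2_eq_square mult_ac)
  next
    show "((\<lambda>y. C * norm (y - z)) \<longlongrightarrow> 0) (at z)" by (auto intro!: tendsto_eq_intros)
  qed (auto simp: lin)
qed

lemma smooth_series: "rapid a \<Longrightarrow> smooth_on UNIV (series a)"
  unfolding smooth_on_def
proof
  fix k assume "rapid a" then show "Ck_on k UNIV (series a)"
  proof (induction k arbitrary: a)
    case 0
    have "isCont (series a) z" for z
      using series_has_derivative[OF 0] has_derivative_continuous by blast
    then show ?case by (simp add: continuous_on_eq_continuous_at)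
  next
    case (Suc k)
    show ?case
      by (rule Ck_on_SucI[OF open_UNIV series_has_derivative[OF Suc.prems]])
        (use Suc.IH rapid_diff_coeff[OF Suc.prems] in blast)
  qed
qed

subsection \<open>Convolution\<close>

definition conv :: "(freq \<Rightarrow> complex) \<Rightarrow> (freq \<Rightarrow> complex) \<Rightarrow> freq \<Rightarrow> complex" where
  "conv a b k = (\<Sum>\<^sub>\<infinity>j. a (k - j) * b j)"

lemma product_summable:
  fixes f :: "'a \<Rightarrow> 'c::{real_normed_field,banach}" and g :: "'b \<Rightarrow> 'c"
  assumes "(\<lambda>x. norm (f x)) summable_on UNIV" "(\<lambda>x. norm (g x)) summable_on UNIV"
  shows "(\<lambda>p. norm (f (fst p) * g (snd p))) summable_on UNIV"
    and "(\<Sum>\<^sub>\<infinity>p. f (fst p) * g (snd p)) = (\<Sum>\<^sub>\<infinity>x. f x) * (\<Sum>\<^sub>\<infinity>y. g y)"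
proof -
  have "(\<lambda>p. norm (f (fst p) * g (snd p))) summable_on Sigma UNIV (\<lambda>_. UNIV)"
    unfolding Infinite_Sum.abs_summable_on_Sigma_iff
    using assms by (auto simp: norm_mult infsum_cmult_right' abs_mult infsum_nonneg
        intro!: summable_on_cmult_right summable_on_cmult_left)
  then show *: "(\<lambda>p. norm (f (fst p) * g (snd p))) summable_on UNIV" by simp
  have "(\<lambda>p. f (fst p) * g (snd p)) summable_on Sigma UNIV (\<lambda>_. UNIV)"
    using abs_summable_summable[OF *] by simp
  from infsum_Sigma_banach[OF this]
  show "(\<Sum>\<^sub>\<infinity>p. f (fst p) * g (snd p)) = (\<Sum>\<^sub>\<infinity>x. f x) * (\<Sum>\<^sub>\<infinity>y. g y)"
    by (simp add: infsum_cmult_right' infsum_cmult_left')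
qed

lemma shear_bij: "bij_betw (\<lambda>p :: freq \<times> freq. (fst p - snd p, snd p)) UNIV UNIV"
  by (rule bij_betwI[where g = "\<lambda>p. (fst p + snd p, snd p)"]) auto

text \<open>The shear \<open>(k, j) \<mapsto> (k - j, j)\<close> transforms the double series of a product into the double series
  of the convolution.  It is used once for the weighted norms and once for the values.\<close>

lemma conv_facts:
  assumes w: "submult w" and a: "wsummable w a" and b: "wsummable w b"
  shows wsummable_conv: "wsummable w (conv a b)"
    and wnorm_conv: "wnorm w (conv a b) \<le> wnorm w a * wnorm w b"
    and series_conv: "series (conv a b) z = series a z * series b z"
proof -
  have w0: "0 \<le> w k" for k using submultD[OF w] by blast
  define A where "A k = w k * norm (a k)" for k
  define B where "B k = w k * norm (b k)" for k
  have AB: "(\<lambda>k. norm (A k)) summable_on UNIV" "(\<lambda>k. norm (B k)) summable_on UNIV"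
    using a b w0 by (simp_all add: wsummable_def A_def B_def abs_mult)
  have nn: "0 \<le> A k" "0 \<le> B k" for k using w0 by (simp_all add: A_def B_def)
  define G where "G p = A (fst p) * B (snd p)" for p
  define G' where "G' p = A (fst p - snd p) * B (snd p)" for p :: "freq \<times> freq"
  have "(\<lambda>p. norm (G p)) summable_on UNIV" unfolding G_def by (rule product_summable(1)[OF AB])
  then have Gs: "G summable_on UNIV" by (rule abs_summable_summable)
  have G'G: "G' p = G (fst p - snd p, snd p)" for p by (simp add: G_def G'_def)
  have G's: "G' summable_on UNIV \<times> UNIV"
    using summable_on_reindex_bij_betw[OF shear_bij, of G] Gs unfolding G'G by simp
  have G'sum: "(\<Sum>\<^sub>\<infinity>p. G' p) = wnorm w a * wnorm w b"
    using infsum_reindex_bij_betw[OF shear_bij, of G] product_summable(2)[OF AB]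
    unfolding G'G wnorm_def A_def[symmetric] B_def[symmetric] by (simp add: G_def[abs_def])
  have iter: "(\<lambda>k. \<Sum>\<^sub>\<infinity>j. G' (k, j)) summable_on UNIV"
    "(\<Sum>\<^sub>\<infinity>k. \<Sum>\<^sub>\<infinity>j. G' (k, j)) = wnorm w a * wnorm w b"
    using summable_on_Sigma_banach[of "\<lambda>x y. G' (x, y)" UNIV "\<lambda>_. UNIV"] infsum_Sigma_banach[OF G's] G's G'sum
    by (auto simp: split_def)
  have inner: "(\<lambda>j. G' (k, j)) summable_on UNIV" for k
    using summable_on_SigmaD1[of "\<lambda>x y. G' (x, y)" UNIV "\<lambda>_. UNIV" k] G's nn by (simp add: split_def G'_def[abs_def])
  have le: "w k * norm (a (k - j) * b j) \<le> G' (k, j)" for k j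
  proof -
    have "w k \<le> w (k - j) * w j" using submultD(3)[OF w, of "k - j" j] by simp
    then have "w k * (norm (a (k - j)) * norm (b j)) \<le> (w (k - j) * w j) * (norm (a (k - j)) * norm (b j))"
      by (intro mult_right_mono) auto
    then show ?thesis by (simp add: G'_def A_def B_def norm_mult mult_ac)
  qed
  have le1: "norm (a (k - j) * b j) \<le> G' (k, j)" for k j
    using le[of k j] mult_right_mono[OF submultD(1)[OF w, of k], of "norm (a (k - j) * b j)"] by simp
  have absin: "(\<lambda>j. norm (a (k - j) * b j)) summable_on UNIV" for k
    by (rule Infinite_Sum.abs_summable_on_comparison_test'[OF inner[of k]]) (use le1 in auto)
  have cb: "w k * norm (conv a b k) \<le> (\<Sum>\<^sub>\<infinity>j. G' (k, j))" for k
  proof -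
    have "w k * norm (conv a b k) \<le> w k * (\<Sum>\<^sub>\<infinity>j. norm (a (k - j) * b j))"
      unfolding conv_def by (intro mult_left_mono norm_infsum_bound absin w0)
    also have "\<dots> = (\<Sum>\<^sub>\<infinity>j. w k * norm (a (k - j) * b j))" by (simp add: infsum_cmult_right')
    also have "\<dots> \<le> (\<Sum>\<^sub>\<infinity>j. G' (k, j))"
      by (rule infsum_mono[OF summable_on_cmult_right[OF absin] inner le])
    finally show ?thesis .
  qed
  have "(\<lambda>k. norm (w k * norm (conv a b k))) summable_on UNIV"
    by (rule Infinite_Sum.abs_summable_on_comparison_test'[OF iter(1)]) (use cb w0 in \<open>auto simp: abs_mult\<close>)
  then show ws: "wsummable w (conv a b)" using w0 by (simp add: wsummable_def abs_mult)
  show "wnorm w (conv a b) \<le> wnorm w a * wnorm w b"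
    unfolding iter(2)[symmetric] wnorm_def[of w "conv a b"]
    by (rule infsum_mono) (use cb iter(1) ws in \<open>auto simp: wsummable_def\<close>)
  have a1: "(\<lambda>k. norm (a k * wave k z)) summable_on UNIV" and b1: "(\<lambda>k. norm (b k * wave k z)) summable_on UNIV"
  proof -
    have "wsummable (\<lambda>k. 1) c" if "wsummable w c" for c
      by (rule wsummable_mono[OF that, where C = 1]) (auto intro: mult_right_mono[OF submultD(1)[OF w], of "norm _", simplified])
    then show "(\<lambda>k. norm (a k * wave k z)) summable_on UNIV" "(\<lambda>k. norm (b k * wave k z)) summable_on UNIV"
      using series_abs_summable a b by blast+
  qed
  define H where "H p = (a (fst p) * wave (fst p) z) * (b (snd p) * wave (snd p) z)" for p
  define H' where "H' p = a (fst p - snd p) * b (snd p) * wave (fst p) z" for p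
  have H'H: "H' p = H (fst p - snd p, snd p)" for p
  proof -
    have "wave (fst p) z = wave (fst p - snd p) z * wave (snd p) z"
      using wave_add_freq[of "fst p - snd p" "snd p" z] by simp
    then show ?thesis by (simp add: H_def H'_def)
  qed
  have Hs: "H summable_on UNIV"
    using abs_summable_summable[OF product_summable(1)[OF a1 b1]] by (simp add: H_def[abs_def])
  have H's: "H' summable_on UNIV \<times> UNIV"
    using summable_on_reindex_bij_betw[OF shear_bij, of H] Hs unfolding H'H by simp
  have "series (conv a b) z = (\<Sum>\<^sub>\<infinity>k. \<Sum>\<^sub>\<infinity>j. H' (k, j))"
    unfolding series_def conv_def H'_def fst_conv snd_conv by (simp only: infsum_cmult_left')
  also have "\<dots> = (\<Sum>\<^sub>\<infinity>p. H' p)" using infsum_Sigma_banach[OF H's] by simp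
  also have "\<dots> = (\<Sum>\<^sub>\<infinity>p. H p)"
    using infsum_reindex_bij_betw[OF shear_bij, of H] unfolding H'H by simp
  also have "\<dots> = series a z * series b z"
    unfolding H_def series_def by (rule product_summable(2)[OF a1 b1])
  finally show "series (conv a b) z = series a z * series b z" .
qed

section \<open>A Neumann series in weighted Wiener algebras\<close>

lemma wnorm_nonneg: "submult w \<Longrightarrow> 0 \<le> wnorm w a"
  unfolding wnorm_def by (intro infsum_nonneg) (simp add: submultD(2))

lemma multiplier_bound:
  assumes "submult w" "wsummable w a" "\<And>k. norm (s k) \<le> (1::real)"
  shows "wsummable w (\<lambda>k. s k * a k)" "wnorm w (\<lambda>k. s k * a k) \<le> wnorm w a"
proof -
  have le: "w k * norm (s k * a k) \<le> w k * norm (a k)" for k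
    by (intro mult_left_mono) (use assms in \<open>auto simp: norm_mult mult_left_le_one_le submultD\<close>)
  show ws: "wsummable w (\<lambda>k. s k * a k)"
    by (rule wsummable_mono[OF assms(2), where C = 1]) (use le assms(1) in \<open>auto simp: submultD\<close>)
  show "wnorm w (\<lambda>k. s k * a k) \<le> wnorm w a"
    unfolding wnorm_def by (rule infsum_mono) (use ws assms(2) le in \<open>auto simp: wsummable_def\<close>)
qed

text \<open>The terms of the Neumann series for the equation \<open>h = m + conv m (s h)\<close>.\<close>

fun neumann :: "(freq \<Rightarrow> complex) \<Rightarrow> (freq \<Rightarrow> complex) \<Rightarrow> nat \<Rightarrow> freq \<Rightarrow> complex" where
  "neumann m s 0 = m"
| "neumann m s (Suc n) = conv m (\<lambda>k. s k * neumann m s n k)"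

definition neumann_sum :: "(freq \<Rightarrow> complex) \<Rightarrow> (freq \<Rightarrow> complex) \<Rightarrow> freq \<Rightarrow> complex" where
  "neumann_sum m s k = (\<Sum>\<^sub>\<infinity>n. neumann m s n k)"

lemma neumann_bound:
  assumes "submult w" "wsummable w m" "\<And>k. norm (s k) \<le> (1::real)"
  shows "wsummable w (neumann m s n) \<and> wnorm w (neumann m s n) \<le> wnorm w m ^ Suc n"
proof (induction n)
  case 0
  then show ?case using assms by simp
next
  case (Suc n)
  note mb = multiplier_bound[where s = s, OF assms(1) conjunct1[OF Suc] assms(3)]
  have "wnorm w (neumann m s (Suc n)) \<le> wnorm w m * wnorm w (\<lambda>k. s k * neumann m s n k)"
    using wnorm_conv[OF assms(1,2) mb(1)] by simp
  also have "\<dots> \<le> wnorm w m * wnorm w m ^ Suc n"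
    using mb(2) Suc by (intro mult_left_mono wnorm_nonneg assms) auto
  finally show ?case using wsummable_conv[OF assms(1,2) mb(1)] by simp
qed

lemma neumann_double_summable:
  assumes "submult w" "wsummable w m" "\<And>k. norm (s k) \<le> (1::real)" "wnorm w m < 1"
  shows "(\<lambda>p. norm (w (snd p) * norm (neumann m s (fst p) (snd p)))) summable_on UNIV"
proof -
  note nb = neumann_bound[where s = s, OF assms(1-3)]
  have w0: "0 \<le> w k" for k using submultD[OF assms(1)] by blast
  have "(\<lambda>n. wnorm w m ^ Suc n) summable_on UNIV"
    using assms(4) wnorm_nonneg[OF assms(1)]
    by (intro summable_nonneg_imp_summable_on) (auto intro!: summable_mult simp: summable_geometric)
  then have "(\<lambda>n. norm (wnorm w (neumann m s n))) summable_on UNIV"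
    by (rule Infinite_Sum.abs_summable_on_comparison_test')
      (use nb wnorm_nonneg[OF assms(1)] in auto)
  then have "(\<lambda>p. norm (w (snd p) * norm (neumann m s (fst p) (snd p)))) summable_on Sigma UNIV (\<lambda>_. UNIV)"
    unfolding Infinite_Sum.abs_summable_on_Sigma_iff
    using nb w0 by (auto simp: wnorm_def wsummable_def abs_mult)
  then show ?thesis by simp
qed

lemma neumann_sum_wsummable:
  assumes "submult w" "wsummable w m" "\<And>k. norm (s k) \<le> (1::real)" "wnorm w m < 1"
  shows "wsummable w (neumann_sum m s)"
proof -
  have w0: "0 \<le> w k" for k using submultD[OF assms(1)] by blast
  have "(\<lambda>p. w (fst p) * norm (neumann m s (snd p) (fst p))) summable_on UNIV \<times> UNIV"
    using neumann_double_summable[where s = s, OF assms] w0 summable_on_swap[of "\<lambda>p. w (snd p) * norm (neumann m s (fst p) (snd p))" UNIV UNIV]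
    by (simp add: abs_mult split_def)
  note D = this
  have n1: "(\<lambda>n. w k * norm (neumann m s n k)) summable_on UNIV" for k
    using summable_on_SigmaD1[of "\<lambda>k n. w k * norm (neumann m s n k)" UNIV "\<lambda>_. UNIV" k] D w0
    by (simp add: split_def)
  have "(\<lambda>k. \<Sum>\<^sub>\<infinity>n. w k * norm (neumann m s n k)) summable_on UNIV"
    using summable_on_Sigma_banach[of "\<lambda>k n. w k * norm (neumann m s n k)" UNIV "\<lambda>_. UNIV"] D
    by (simp add: split_def)
  then have "(\<lambda>k. norm (w k * norm (neumann_sum m s k))) summable_on UNIV"
  proof (rule Infinite_Sum.abs_summable_on_comparison_test')
    fix k
    have "w k \<noteq> 0" using submultD(1)[OF assms(1), of k] by auto
    then have "(\<lambda>n. norm (neumann m s n k)) summable_on UNIV"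
      using n1[of k] summable_on_cmult_right' by blast
    then have "w k * norm (neumann_sum m s k) \<le> w k * (\<Sum>\<^sub>\<infinity>n. norm (neumann m s n k))"
      unfolding neumann_sum_def by (intro mult_left_mono norm_infsum_bound w0)
    then show "norm (w k * norm (neumann_sum m s k)) \<le> (\<Sum>\<^sub>\<infinity>n. w k * norm (neumann m s n k))"
      using w0[of k] by (simp add: infsum_cmult_right' abs_mult)
  qed
  then show ?thesis using w0 by (simp add: wsummable_def abs_mult)
qed

lemma neumann_sum_eq:
  assumes m: "wsummable (\<lambda>k. 1) m" and s: "\<And>k. norm (s k) \<le> (1::real)" and lt: "wnorm (\<lambda>k. 1) m < 1"
  shows "neumann_sum m s k = m k + conv m (\<lambda>k. s k * neumann_sum m s k) k"
proof -
  have D: "(\<lambda>p. norm (neumann m s (fst p) (snd p))) summable_on UNIV"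
    using neumann_double_summable[where s = s, OF submult_one m s lt] by simp
  have Ds: "(\<lambda>p. neumann m s (fst p) (snd p)) summable_on UNIV \<times> UNIV"
    using abs_summable_summable[OF D] by simp
  have n1: "(\<lambda>n. neumann m s n k) summable_on UNIV" for k
    using summable_on_SigmaD1[of "\<lambda>k n. neumann m s n k" UNIV "\<lambda>_. UNIV" k] 
      summable_on_swap[of "\<lambda>p. neumann m s (fst p) (snd p)" UNIV UNIV] Ds
    by (simp add: split_def)
  have bound: "norm (m j) \<le> wnorm (\<lambda>k. 1) m" for j
    using finite_sum_le_infsum[of "\<lambda>k. norm (m k)" UNIV "{j}"] m by (simp add: wsummable_def wnorm_def)
  have "(\<lambda>p. wnorm (\<lambda>k. 1) m * norm (neumann m s (fst p) (snd p))) summable_on UNIV"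
    by (rule summable_on_cmult_right[OF D])
  then have "(\<lambda>p. norm (m (k - snd p) * (s (snd p) * neumann m s (fst p) (snd p)))) summable_on UNIV"
  proof (rule Infinite_Sum.abs_summable_on_comparison_test')
    fix p :: "nat \<times> freq"
    have "norm (s (snd p) * neumann m s (fst p) (snd p)) \<le> norm (neumann m s (fst p) (snd p))"
      using s by (simp add: norm_mult mult_left_le_one_le)
    then show "norm (m (k - snd p) * (s (snd p) * neumann m s (fst p) (snd p)))
      \<le> wnorm (\<lambda>k. 1) m * norm (neumann m s (fst p) (snd p))"
      unfolding norm_mult[of "m _"] by (intro mult_mono bound wnorm_nonneg submult_one) auto
  qed
  then have E: "(\<lambda>(n, j). m (k - j) * (s j * neumann m s n j)) summable_on UNIV \<times> UNIV"
    using abs_summable_summable by (fastforce simp: split_def)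
  have "neumann_sum m s k = (\<Sum>\<^sub>\<infinity>n\<in>insert 0 (range Suc). neumann m s n k)"
    unfolding neumann_sum_def UNIV_nat_eq[symmetric] ..
  also have "\<dots> = m k + (\<Sum>\<^sub>\<infinity>n\<in>range Suc. neumann m s n k)"
    by (subst infsum_insert) (auto intro: summable_on_subset_banach[OF n1])
  also have "(\<Sum>\<^sub>\<infinity>n\<in>range Suc. neumann m s n k) = (\<Sum>\<^sub>\<infinity>n. neumann m s (Suc n) k)"
    by (subst infsum_reindex) (auto simp: o_def)
  also have "\<dots> = (\<Sum>\<^sub>\<infinity>n. \<Sum>\<^sub>\<infinity>j. m (k - j) * (s j * neumann m s n j))" by (simp add: conv_def)
  also have "\<dots> = (\<Sum>\<^sub>\<infinity>j. \<Sum>\<^sub>\<infinity>n. m (k - j) * (s j * neumann m s n j))"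
    by (rule infsum_swap_banach[OF E])
  also have "\<dots> = conv m (\<lambda>k. s k * neumann_sum m s k) k"
    by (simp add: conv_def neumann_sum_def infsum_cmult_right')
  finally show ?thesis .
qed

text \<open>As \<open>\<delta>\<close> tends to \<open>0\<close> the weights tend to \<open>1\<close>, while they stay below \<open>weight N 1\<close>, for which the norm
  is finite: a finite part of the sum converges and the tail is small uniformly in \<open>\<delta>\<close>.\<close>

lemma weighted_norm_small:
  assumes "rapid m" "wnorm (\<lambda>k. 1) m < 1/2"
  obtains \<delta> where "0 < \<delta>" "\<delta> \<le> 1" "wnorm (weight N \<delta>) m < 1"
proof -
  have S: "(\<lambda>k. weight N 1 k * norm (m k)) summable_on UNIV" using assms(1) by (simp add: rapid_def wsummable_def)
  have S1: "(\<lambda>k. norm (m k)) summable_on UNIV" using rapid_summable[OF assms(1)] by (simp add: wsummable_def)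
  obtain F where F: "finite F" "dist (\<Sum>k\<in>F. weight N 1 k * norm (m k)) (\<Sum>\<^sub>\<infinity>k. weight N 1 k * norm (m k)) \<le> 1/4"
    using infsum_finite_approximation[OF S, of "1/4"] by auto
  have tail: "(\<Sum>\<^sub>\<infinity>k\<in>-F. weight N 1 k * norm (m k)) \<le> 1/4"
  proof -
    have "(\<Sum>\<^sub>\<infinity>k. weight N 1 k * norm (m k)) = (\<Sum>\<^sub>\<infinity>k\<in>F \<union> -F. weight N 1 k * norm (m k))" by simp
    also have "\<dots> = (\<Sum>k\<in>F. weight N 1 k * norm (m k)) + (\<Sum>\<^sub>\<infinity>k\<in>-F. weight N 1 k * norm (m k))"
      using F(1) by (subst infsum_Un_disjoint) (auto intro: summable_on_subset_banach[OF S])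
    finally show ?thesis using F(2) by (simp add: dist_real_def)
  qed
  have "((\<lambda>\<delta>. \<Sum>k\<in>F. weight N \<delta> k * norm (m k)) \<longlongrightarrow> (\<Sum>k\<in>F. weight N 0 k * norm (m k))) (at_right 0)"
    unfolding weight_def by (intro tendsto_intros)
  moreover have "(\<Sum>k\<in>F. weight N 0 k * norm (m k)) < 1/2"
    using finite_sum_le_infsum[OF S1 F(1)] assms(2) by (simp add: weight_def wnorm_def)
  ultimately have "eventually (\<lambda>\<delta>. (\<Sum>k\<in>F. weight N \<delta> k * norm (m k)) < 1/2) (at_right 0)"
    by (rule order_tendstoD)
  then obtain b where b: "b > 0" "\<And>\<delta>. 0 < \<delta> \<Longrightarrow> \<delta> < b \<Longrightarrow> (\<Sum>k\<in>F. weight N \<delta> k * norm (m k)) < 1/2"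
    unfolding eventually_at_right_field by auto
  define \<delta> where "\<delta> = min 1 (b/2)"
  have d: "0 < \<delta>" "\<delta> \<le> 1" "\<delta> < b" using b(1) by (auto simp: \<delta>_def)
  have wle: "weight N \<delta> k \<le> weight N 1 k" for k
    unfolding weight_def using d size_of_nonneg[of k] by (intro power_mono) (auto simp: mult_left_le_one_le)
  have w0: "0 \<le> weight N \<delta> k" for k using d size_of_nonneg[of k] by (simp add: weight_def)
  have Sd: "(\<lambda>k. weight N \<delta> k * norm (m k)) summable_on UNIV"
    using wsummable_mono[of "weight N 1" m "weight N \<delta>" m 1] assms(1) w0 wle
    by (simp add: rapid_def wsummable_def mult_right_mono)
  have "wnorm (weight N \<delta>) m = (\<Sum>\<^sub>\<infinity>k\<in>F \<union> -F. weight N \<delta> k * norm (m k))" by (simp add: wnorm_def)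
  also have "\<dots> = (\<Sum>k\<in>F. weight N \<delta> k * norm (m k)) + (\<Sum>\<^sub>\<infinity>k\<in>-F. weight N \<delta> k * norm (m k))"
    using F(1) by (subst infsum_Un_disjoint) (auto intro: summable_on_subset_banach[OF Sd])
  also have "(\<Sum>\<^sub>\<infinity>k\<in>-F. weight N \<delta> k * norm (m k)) \<le> (\<Sum>\<^sub>\<infinity>k\<in>-F. weight N 1 k * norm (m k))"
    by (intro infsum_mono mult_right_mono wle) (auto intro: summable_on_subset_banach[OF Sd] summable_on_subset_banach[OF S])
  finally have "wnorm (weight N \<delta>) m < 1" using tail b(2)[OF d(1) d(3)] by linarith
  with d that show ?thesis by blast
qed

text \<open>The sum of the series is the same for all norms.  For each \<open>N\<close> there is a weight of order \<open>N\<close> for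
  which the norm of \<open>m\<close> is below \<open>1\<close>, and for a fixed order the weights with different \<open>\<delta> > 0\<close> are
  comparable.\<close>

lemma rapid_neumann_sum:
  assumes "rapid m" "wnorm (\<lambda>k. 1) m < 1/2" "\<And>k. norm (s k) \<le> (1::real)"
  shows "rapid (neumann_sum m s)"
  unfolding rapid_def
proof
  fix N
  obtain \<delta> where d: "0 < \<delta>" "\<delta> \<le> 1" "wnorm (weight N \<delta>) m < 1" using weighted_norm_small[OF assms(1,2)] .
  have wle: "weight N \<delta> k \<le> weight N 1 k" "weight N 1 k \<le> (1/\<delta>) ^ N * weight N \<delta> k" for k
  proof -
    show "weight N \<delta> k \<le> weight N 1 k"
      unfolding weight_def using d size_of_nonneg[of k] by (intro power_mono) (auto simp: mult_left_le_one_le)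
    have "1 + size_of k \<le> (1/\<delta>) * (1 + \<delta> * size_of k)"
      using d by (simp add: field_simps)
    then show "weight N 1 k \<le> (1/\<delta>) ^ N * weight N \<delta> k"
      unfolding weight_def power_mult_distrib[symmetric] using size_of_nonneg[of k] by (intro power_mono) auto
  qed
  have w0: "0 \<le> weight N \<delta> k" "0 \<le> weight N 1 k" for k using d size_of_nonneg[of k] by (simp_all add: weight_def)
  have "wsummable (weight N \<delta>) m"
    using wsummable_mono[of "weight N 1" m "weight N \<delta>" m 1] assms(1) w0 wle by (simp add: rapid_def mult_right_mono)
  from neumann_sum_wsummable[where s = s, OF submult_weight this assms(3) d(3)] d
  have "wsummable (weight N \<delta>) (neumann_sum m s)" by simp
  then show "wsummable (weight N 1) (neumann_sum m s)"
    by (rule wsummable_mono[where C = "(1/\<delta>) ^ N"]) (use w0 mult_right_mono[OF wle(2)] in \<open>auto simp: mult.assoc\<close>)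
qed

text \<open>This bound is what keeps \<open>w_z = 1 + S h\<close> away from zero.\<close>

lemma neumann_sum_norm:
  assumes "rapid m" "wnorm (\<lambda>k. 1) m < 1/2" "\<And>k. norm (s k) \<le> (1::real)"
  shows "wnorm (\<lambda>k. 1) (neumann_sum m s) < 1"
proof -
  let ?h = "neumann_sum m s" and ?N = "wnorm (\<lambda>k. 1)"
  have m: "wsummable (\<lambda>k. 1) m" and h: "wsummable (\<lambda>k. 1) ?h"
    using rapid_summable rapid_neumann_sum assms by blast+
  note mb = multiplier_bound[where s = s, OF submult_one h assms(3)]
  note cv = wsummable_conv[OF submult_one m mb(1)]
  have eq: "?h k = m k + conv m (\<lambda>k. s k * ?h k) k" for k
    by (rule neumann_sum_eq) (use assms m in auto)
  have "?N ?h \<le> (\<Sum>\<^sub>\<infinity>k. norm (m k) + norm (conv m (\<lambda>k. s k * ?h k) k))"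
    unfolding wnorm_def
  proof (rule infsum_mono)
    show "1 * norm (?h k) \<le> norm (m k) + norm (conv m (\<lambda>k. s k * ?h k) k)" for k
      by (subst eq) (simp add: norm_triangle_ineq)
  qed (use h m cv in \<open>auto simp: wsummable_def intro!: summable_on_add\<close>)
  also have "\<dots> = ?N m + ?N (conv m (\<lambda>k. s k * ?h k))"
    using m cv by (simp add: wnorm_def wsummable_def infsum_add)
  also have "\<dots> \<le> ?N m + ?N m * ?N ?h"
    using wnorm_conv[OF submult_one m mb(1)] mult_left_mono[OF mb(2) wnorm_nonneg[OF submult_one, of m]] by linarith
  finally have "?N ?h \<le> ?N m + ?N m * ?N ?h" .
  moreover have "?N m * ?N ?h \<le> (1/2) * ?N ?h"
    by (intro mult_right_mono wnorm_nonneg submult_one) (use assms(2) in auto)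
  ultimately show ?thesis using assms(2) by linarith
qed

lemma series_neumann_sum:
  assumes "rapid m" "wnorm (\<lambda>k. 1) m < 1/2" "\<And>k. norm (s k) \<le> (1::real)"
  shows "series (neumann_sum m s) z = series m z * (1 + series (\<lambda>k. s k * neumann_sum m s k) z)"
proof -
  let ?h = "neumann_sum m s"
  have m: "wsummable (\<lambda>k. 1) m" and h: "wsummable (\<lambda>k. 1) ?h"
    using rapid_summable rapid_neumann_sum assms by blast+
  note mb = multiplier_bound[where s = s, OF submult_one h assms(3)]
  have "?h = (\<lambda>k. m k + conv m (\<lambda>k. s k * ?h k) k)"
    by (rule ext, rule neumann_sum_eq[OF m assms(3)]) (use assms(2) in simp)
  then have "series ?h z = series (\<lambda>k. m k + conv m (\<lambda>k. s k * ?h k) k) z"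
    by (rule arg_cong[where f = "\<lambda>a. series a z"])
  also have "\<dots> = series m z + series m z * series (\<lambda>k. s k * ?h k) z"
    by (simp add: series_add m wsummable_conv[OF submult_one m mb(1)] series_conv[OF submult_one m mb(1)])
  finally show ?thesis by (simp add: distrib_left)
qed

section \<open>The Beltrami equation on the torus\<close>

text \<open>The Fourier multiplier of the Beurling transform, which maps \<open>f_zbar\<close> to \<open>f_z\<close> for doubly periodic \<open>f\<close>.\<close>

definition beurling :: "freq \<Rightarrow> complex" where
  "beurling k = (if k = 0 then 0 else Complex (of_int (fst k)) (- of_int (snd k)) / Complex (of_int (fst k)) (of_int (snd k)))"

lemma norm_beurling: "norm (beurling k) \<le> 1"
proof (cases "k = 0")
  case False
  have "Complex (of_int (fst k)) (- of_int (snd k)) = cnj (Complex (of_int (fst k)) (of_int (snd k)))"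
    by (simp add: complex_eq_iff)
  then have "norm (beurling k) = norm (Complex (of_int (fst k)) (of_int (snd k))) / norm (Complex (of_int (fst k)) (of_int (snd k)))"
    unfolding beurling_def using False by (simp only: if_False norm_divide complex_mod_cnj)
  then show ?thesis by (simp add: divide_le_eq_1)
qed (simp add: beurling_def)

text \<open>The solution is sought in the form \<open>w = z + b zbar + f\<close> with \<open>b\<close> constant and \<open>f\<close> doubly periodic.
  The constant \<open>b\<close> is the mean value of \<open>h = w_zbar\<close>, to which the derivative of the periodic function \<open>f\<close>
  does not contribute.  Then \<open>w_z = 1 + S h\<close>, and the equation \<open>h = \<mu> (1 + S h)\<close> is solved by the Neumann series.\<close>

lemma beltrami_torus:
  assumes "rapid m" "wnorm (\<lambda>k. 1) m < 1/2"
  obtains w where "smooth_on UNIV w"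
    "\<And>z. du w z + \<i> * dv w z = series m z * (du w z - \<i> * dv w z)"
    "\<And>z. du w z - \<i> * dv w z \<noteq> 0"
proof -
  define h where "h = neumann_sum m beurling"
  define f where "f k = (if k = 0 then 0 else h k / (\<i> / 2 * Complex (of_int (fst k)) (of_int (snd k))))" for k :: freq
  define w where "w z = z + h 0 * cnj z + series f z" for z
  have rh: "rapid h" unfolding h_def by (rule rapid_neumann_sum[where s = beurling, OF assms norm_beurling])
  have kap: "1 \<le> norm (Complex (of_int (fst k)) (of_int (snd k)))" if "k \<noteq> 0" for k :: freq
  proof -
    let ?c = "Complex (of_int (fst k)) (of_int (snd k))"
    have "fst k \<noteq> 0 \<or> snd k \<noteq> 0" using that by (simp add: prod_eq_iff)
    then show ?thesis
    proof
      assume "fst k \<noteq> 0"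
      then have "1 \<le> \<bar>real_of_int (fst k)\<bar>" by linarith
      also have "\<dots> \<le> norm ?c" using abs_Re_le_cmod[of ?c] by simp
      finally show ?thesis .
    next
      assume "snd k \<noteq> 0"
      then have "1 \<le> \<bar>real_of_int (snd k)\<bar>" by linarith
      also have "\<dots> \<le> norm ?c" using abs_Im_le_cmod[of ?c] by simp
      finally show ?thesis .
    qed
  qed
  have rf: "rapid f"
  proof (rule rapid_poly[OF rh, where C = 2 and M = 0])
    fix k show "norm (f k) \<le> 2 * (1 + size_of k) ^ 0 * norm (h k)"
    proof (cases "k = 0")
      case False
      let ?c = "norm (Complex (of_int (fst k)) (of_int (snd k)))"
      have "norm (h k) \<le> ?c * norm (h k)" using mult_right_mono[OF kap[OF False], of "norm (h k)"] by simp
      moreover have "?c > 0" using kap[OF False] by linarith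
      ultimately have "norm (h k) / (?c / 2) \<le> 2 * norm (h k)" by (simp add: divide_le_eq mult.commute)
      then show ?thesis using False by (simp add: f_def norm_divide norm_mult)
    qed (simp add: f_def)
  qed
  have dw: "(w has_derivative (\<lambda>x. x + h 0 * cnj x + series (diff_coeff f x) z)) (at z)" for z
    unfolding w_def[abs_def]
    by (intro has_derivative_add has_derivative_ident series_has_derivative rf
        has_derivative_mult_right bounded_linear_imp_has_derivative bounded_linear_cnj)
  have fd: "frechet_derivative w (at z) = (\<lambda>x. x + h 0 * cnj x + series (diff_coeff f x) z)" for z
    by (rule frechet_derivative_at[OF dw, symmetric])
  note sf = rapid_summable[OF rapid_diff_coeff[OF rf]] 
  note sh = rapid_summable[OF rh]
  note sb = multiplier_bound(1)[where s = beurling, OF submult_one sh norm_beurling]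
  have delta: "series (\<lambda>k. if k = 0 then - c else 0) z = - c" "wsummable (\<lambda>k. 1) (\<lambda>k. if k = 0 then - c else 0)" for c z
  proof -
    have *: "(\<Sum>\<^sub>\<infinity>k. (if k = 0 then - c else 0) * wave k z) = (\<Sum>\<^sub>\<infinity>k\<in>{0::freq}. (if k = 0 then - c else 0) * wave k z)"
      by (rule infsum_cong_neutral) auto
    show "series (\<lambda>k. if k = 0 then - c else 0) z = - c"
      unfolding series_def * by (simp add: wave_def pairing_def)
    show "wsummable (\<lambda>k. 1) (\<lambda>k. if k = 0 then - c else 0)"
      unfolding wsummable_def
      by (rule finite_nonzero_values_imp_summable_on) (auto intro: finite_subset[of _ "{0}"])
  qed
  have A: "du w z + \<i> * dv w z = 2 * series h z" for z
  proof -
    have "(\<lambda>k. diff_coeff f 1 k + \<i> * diff_coeff f \<i> k) = (\<lambda>k. 2 * (h k + (if k = 0 then - h 0 else 0)))"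
    proof
      fix k :: freq
      show "diff_coeff f 1 k + \<i> * diff_coeff f \<i> k = 2 * (h k + (if k = 0 then - h 0 else 0))"
      proof (cases "k = 0")
        case False
        have c: "Complex (of_int (fst k)) (of_int (snd k)) = of_int (fst k) + \<i> * of_int (snd k)"
          by (simp add: complex_eq_iff)
        have e: "diff_coeff f 1 k + \<i> * diff_coeff f \<i> k = \<i> * Complex (of_int (fst k)) (of_int (snd k)) * f k"
          unfolding c by (simp add: diff_coeff_def pairing_def algebra_simps)
        show ?thesis unfolding e using False kap[OF False] by (auto simp: f_def)
      qed (simp add: f_def diff_coeff_def)
    qed
    then have "series (\<lambda>k. diff_coeff f 1 k + \<i> * diff_coeff f \<i> k) z = 2 * (series h z - h 0)"
      by (simp only: series_cmult series_add[OF sh delta(2)] delta(1) diff_conv_add_uminus)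
    moreover have "series (\<lambda>k. diff_coeff f 1 k + \<i> * diff_coeff f \<i> k) z = series (diff_coeff f 1) z + \<i> * series (diff_coeff f \<i>) z"
      using multiplier_bound(1)[OF submult_one sf, of "\<lambda>_. \<i>"] by (simp add: series_add series_cmult sf)
    ultimately show ?thesis by (simp add: du_def dv_def fd algebra_simps)
  qed
  have B: "du w z - \<i> * dv w z = 2 * (1 + series (\<lambda>k. beurling k * h k) z)" for z
  proof -
    have "(\<lambda>k. diff_coeff f 1 k + (-\<i>) * diff_coeff f \<i> k) = (\<lambda>k. 2 * (beurling k * h k))"
    proof
      fix k :: freq
      show "diff_coeff f 1 k + (-\<i>) * diff_coeff f \<i> k = 2 * (beurling k * h k)"
      proof (cases "k = 0")
        case False
        have c: "Complex (of_int (fst k)) (- of_int (snd k)) = of_int (fst k) - \<i> * of_int (snd k)"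
          by (simp add: complex_eq_iff)
        have e: "diff_coeff f 1 k + (-\<i>) * diff_coeff f \<i> k = \<i> * Complex (of_int (fst k)) (- of_int (snd k)) * f k"
          unfolding c by (simp add: diff_coeff_def pairing_def algebra_simps)
        show ?thesis unfolding e using False kap[OF False] by (auto simp: f_def beurling_def)
      qed (simp add: f_def diff_coeff_def beurling_def)
    qed
    then have "series (\<lambda>k. diff_coeff f 1 k + (-\<i>) * diff_coeff f \<i> k) z = 2 * series (\<lambda>k. beurling k * h k) z"
      by (simp only: series_cmult)
    moreover have "series (\<lambda>k. diff_coeff f 1 k + (-\<i>) * diff_coeff f \<i> k) z = series (diff_coeff f 1) z + (-\<i>) * series (diff_coeff f \<i>) z"
      using multiplier_bound(1)[OF submult_one sf, of "\<lambda>_. -\<i>"] by (subst series_add) (simp_all only: series_cmult sf norm_minus_cancel norm_ii order_refl)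
    ultimately show ?thesis by (simp add: du_def dv_def fd algebra_simps)
  qed
  show ?thesis
  proof (rule that)
    have "smooth_on UNIV (\<lambda>z. h 0 * cnj z)"
      by (intro smooth_on_mult smooth_on_const smooth_on_linear[OF _ bounded_linear_cnj] smooth_on_id) auto
    then show "smooth_on UNIV w" unfolding w_def[abs_def]
      by (intro smooth_on_add smooth_on_id smooth_series rf) auto
    fix z
    show "du w z + \<i> * dv w z = series m z * (du w z - \<i> * dv w z)"
      unfolding A B h_def using series_neumann_sum[where s = beurling, OF assms norm_beurling] by simp
    have "norm (series (\<lambda>k. beurling k * h k) z) \<le> wnorm (\<lambda>k. 1) (\<lambda>k. beurling k * h k)"
      by (rule norm_series_le[OF sb])
    also have "\<dots> \<le> wnorm (\<lambda>k. 1) h" by (rule multiplier_bound(2)[where s = beurling, OF submult_one sh norm_beurling])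
    also have "\<dots> < 1" unfolding h_def by (rule neumann_sum_norm[where s = beurling, OF assms norm_beurling])
    finally have "series (\<lambda>k. beurling k * h k) z \<noteq> -1" by auto
    then show "du w z - \<i> * dv w z \<noteq> 0" unfolding B by (simp add: add_eq_0_iff)
  qed
qed

section \<open>Fourier coefficients of periodic functions of one variable\<close>

definition fcoeff :: "(real \<Rightarrow> complex) \<Rightarrow> int \<Rightarrow> complex" where
  "fcoeff f n = integral {0..2 * pi} (\<lambda>x. f x * cis (- (of_int n * x))) / of_real (2 * pi)"

lemma fcoeff_integrable:
  assumes "continuous_on UNIV f"
  shows "(\<lambda>x. f x * cis (- (of_int n * x))) integrable_on {0..2 * pi}"
  by (intro integrable_continuous_real continuous_intros continuous_on_subset[OF assms]) auto

lemma fcoeff_bound: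
  assumes "continuous_on UNIV f" "\<And>x. x \<in> {0..2 * pi} \<Longrightarrow> norm (f x) \<le> B"
  shows "norm (fcoeff f n) \<le> B"
proof -
  have "norm (integral {0..2 * pi} (\<lambda>x. f x * cis (- (of_int n * x)))) \<le> B * (2 * pi - 0)"
    by (rule integral_bound) (use assms in \<open>auto simp: norm_mult intro!: continuous_intros continuous_on_subset[OF assms(1)]\<close>)
  then show ?thesis by (simp add: fcoeff_def norm_divide divide_le_eq norm_mult)
qed

lemma fcoeff_add:
  "continuous_on UNIV f \<Longrightarrow> continuous_on UNIV g \<Longrightarrow> fcoeff (\<lambda>x. f x + g x) n = fcoeff f n + fcoeff g n"
  using Henstock_Kurzweil_Integration.integral_add[OF fcoeff_integrable[of f n] fcoeff_integrable[of g n]]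
  by (simp add: fcoeff_def distrib_right add_divide_distrib)

lemma fcoeff_cmult: "fcoeff (\<lambda>x. c * f x) n = c * fcoeff f n"
  by (simp add: fcoeff_def mult.assoc)

lemma fcoeff_shift: "fcoeff (\<lambda>x. cis (of_int m * x) * f x) n = fcoeff f (n - m)"
proof -
  have "(\<lambda>x. cis (of_int m * x) * f x * cis (- (of_int n * x))) = (\<lambda>x. f x * cis (- (of_int (n - m) * x)))"
  proof
    fix x
    have "cis (- (of_int (n - m) * x)) = cis (of_int m * x) * cis (- (of_int n * x))"
      unfolding cis_mult by (simp add: algebra_simps)
    then show "cis (of_int m * x) * f x * cis (- (of_int n * x)) = f x * cis (- (of_int (n - m) * x))" by simp
  qed
  then show ?thesis by (simp add: fcoeff_def)
qed

lemma fcoeff_derivative: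
  assumes "\<And>x. (f has_vector_derivative f' x) (at x)" "continuous_on UNIV f'" "f (2 * pi) = f 0"
  shows "fcoeff f' n = \<i> * of_int n * fcoeff f n"
proof -
  have cf: "continuous_on UNIV f"
    using assms(1) by (auto intro!: continuous_at_imp_continuous_on has_vector_derivative_continuous)
  have "((\<lambda>x. f x * cis (- (of_int n * x))) has_vector_derivative
      (f' x * cis (- (of_int n * x)) + (- (\<i> * of_int n)) * (f x * cis (- (of_int n * x))))) (at x within {0..2 * pi})" for x
  proof -
    have "((\<lambda>x. cis (- (of_int n * x))) has_vector_derivative (- (\<i> * of_int n)) * cis (- (of_int n * x))) (at x within {0..2 * pi})"
    proof -
      have "((\<lambda>x. - (of_int n * x)) has_derivative (\<lambda>h. - (of_int n * h))) (at x within {0..2 * pi})"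
        by (auto intro!: derivative_eq_intros)
      from has_derivative_cis[OF this] show ?thesis
        unfolding has_vector_derivative_def
        by (rule has_derivative_eq_rhs) (simp add: fun_eq_iff scaleR_conv_of_real)
    qed
    from has_vector_derivative_mult[OF has_vector_derivative_at_within[OF assms(1)] this]
    show ?thesis by (simp add: algebra_simps)
  qed
  from fundamental_theorem_of_calculus[OF _ this]
  have "((\<lambda>x. f' x * cis (- (of_int n * x)) + (- (\<i> * of_int n)) * (f x * cis (- (of_int n * x)))) has_integral
    f (2 * pi) * cis (- (of_int n * (2 * pi))) - f 0 * cis (- (of_int n * 0))) {0..2 * pi}" by simp
  moreover have "cis (- (of_int n * (2 * pi))) = 1"
    using cis_multiple_2pi[of "- of_int n"] by (simp add: mult_ac)
  ultimately have "integral {0..2 * pi} (\<lambda>x. f' x * cis (- (of_int n * x)) + (- (\<i> * of_int n)) * (f x * cis (- (of_int n * x)))) = 0"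
    using assms(3) by (simp add: integral_unique)
  then have "integral {0..2 * pi} (\<lambda>x. f' x * cis (- (of_int n * x)))
      + (- (\<i> * of_int n)) * integral {0..2 * pi} (\<lambda>x. f x * cis (- (of_int n * x))) = 0"
    using Henstock_Kurzweil_Integration.integral_add[OF fcoeff_integrable[OF assms(2), of n]
      integrable_on_mult_right[OF fcoeff_integrable[OF cf, of n], of "- (\<i> * of_int n)"]] by simp
  then show ?thesis by (simp add: fcoeff_def add_eq_0_iff)
qed

lemma fcoeff_const: "fcoeff (\<lambda>x. c) n = (if n = 0 then c else 0)"
proof (cases "n = 0")
  case True
  then show ?thesis by (simp add: fcoeff_def scaleR_conv_of_real)
next
  case False
  have "fcoeff (\<lambda>x. 0) n = \<i> * of_int n * fcoeff (\<lambda>x. c) n"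
    by (rule fcoeff_derivative) auto
  then show ?thesis using False by (simp add: fcoeff_def)
qed

lemma fcoeff_trig: "fcoeff (\<lambda>x. cis (of_int m * x)) n = (if n = m then 1 else 0)"
  using fcoeff_shift[of m "\<lambda>x. 1" n] by (simp add: fcoeff_const)

lemma fcoeff_sum:
  "finite F \<Longrightarrow> (\<And>m. m \<in> F \<Longrightarrow> continuous_on UNIV (f m)) \<Longrightarrow>
    fcoeff (\<lambda>x. \<Sum>m\<in>F. f m x) n = (\<Sum>m\<in>F. fcoeff (f m) n)"
proof (induction F rule: finite_induct)
  case empty
  then show ?case by (simp add: fcoeff_const)
next
  case (insert m F)
  then show ?case by (simp add: fcoeff_add continuous_on_sum)
qed

text \<open>The integral of \<open>|g - p|^2\<close> is nonnegative, where \<open>p\<close> is the partial sum of the Fourier series over \<open>F\<close>.\<close>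

lemma bessel_inequality:
  assumes g: "continuous_on UNIV g" and B: "\<And>x. x \<in> {0..2 * pi} \<Longrightarrow> norm (g x) \<le> B" and F: "finite F"
  shows "(\<Sum>n\<in>F. (norm (fcoeff g n))\<^sup>2) \<le> B\<^sup>2"
proof -
  define I where "I f = integral {0..2 * pi} f / of_real (2 * pi)" for f :: "real \<Rightarrow> complex"
  define p where "p x = (\<Sum>n\<in>F. fcoeff g n * cis (of_int n * x))" for x
  have cp: "continuous_on UNIV p" unfolding p_def by (intro continuous_intros)
  have Iadd: "I (\<lambda>x. f x + h x) = I f + I h" if "continuous_on UNIV f" "continuous_on UNIV h" for f h
    unfolding I_def using Henstock_Kurzweil_Integration.integral_add[of f "{0..2 * pi}" h] that
    by (simp add: integrable_continuous_real continuous_on_subset add_divide_distrib)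
  have Ip: "I (\<lambda>x. h x * cnj (p x)) = (\<Sum>n\<in>F. cnj (fcoeff g n) * fcoeff h n)" if "continuous_on UNIV h" for h
  proof -
    have e: "(\<lambda>x. h x * cnj (p x)) = (\<lambda>x. \<Sum>n\<in>F. cnj (fcoeff g n) * (cis (of_int (- n) * x) * h x))"
      by (simp add: p_def fun_eq_iff sum_distrib_left mult_ac cis_cnj)
    have "I (\<lambda>x. h x * cnj (p x)) = fcoeff (\<lambda>x. \<Sum>n\<in>F. cnj (fcoeff g n) * (cis (of_int (- n) * x) * h x)) 0"
      unfolding e by (simp add: I_def fcoeff_def)
    also have "\<dots> = (\<Sum>n\<in>F. fcoeff (\<lambda>x. cnj (fcoeff g n) * (cis (of_int (- n) * x) * h x)) 0)"
      using F that by (intro fcoeff_sum) (auto intro!: continuous_intros)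
    also have "\<dots> = (\<Sum>n\<in>F. cnj (fcoeff g n) * fcoeff h n)"
      unfolding fcoeff_cmult fcoeff_shift by simp
    finally show ?thesis .
  qed
  have cpn: "fcoeff p n = fcoeff g n" if "n \<in> F" for n
  proof -
    have "fcoeff p n = (\<Sum>m\<in>F. fcoeff (\<lambda>x. fcoeff g m * cis (of_int m * x)) n)"
      unfolding p_def[abs_def] by (rule fcoeff_sum[OF F]) (intro continuous_intros)
    also have "\<dots> = (\<Sum>m\<in>F. if n = m then fcoeff g m else 0)"
      unfolding fcoeff_cmult fcoeff_trig by (intro sum.cong) auto
    finally show ?thesis using that F by simp
  qed
  define S where "S = (\<Sum>n\<in>F. (norm (fcoeff g n))\<^sup>2)"
  have gp: "I (\<lambda>x. g x * cnj (p x)) = of_real S"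
    unfolding Ip[OF g] S_def by (simp only: of_real_sum complex_norm_square mult.commute)
  have pp: "I (\<lambda>x. p x * cnj (p x)) = of_real S"
    unfolding Ip[OF cp] S_def of_real_sum complex_norm_square
    by (rule sum.cong) (simp_all add: cpn mult.commute)
  have pg: "I (\<lambda>x. p x * cnj (g x)) = of_real S"
  proof -
    have "I (\<lambda>x. p x * cnj (g x)) = cnj (I (\<lambda>x. g x * cnj (p x)))"
      by (simp add: I_def Henstock_Kurzweil_Integration.integral_cnj mult.commute)
    then show ?thesis using gp by simp
  qed
  have "I (\<lambda>x. g x * cnj (g x)) = I (\<lambda>x. (g x - p x) * cnj (g x - p x)
      + ((g x * cnj (p x) + p x * cnj (g x)) + (-1) * (p x * cnj (p x))))"
    by (rule arg_cong[where f = I]) (simp add: fun_eq_iff algebra_simps)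
  also have "\<dots> = I (\<lambda>x. (g x - p x) * cnj (g x - p x)) + ((of_real S + of_real S) + (-1) * of_real S)"
  proof -
    have "I (\<lambda>x. (-1) * (p x * cnj (p x))) = (-1) * of_real S" unfolding pp[symmetric] by (simp add: I_def)
    moreover have c: "continuous_on UNIV (\<lambda>x. a x * cnj (b x))"
      if "continuous_on UNIV a" "continuous_on UNIV b" for a b :: "real \<Rightarrow> complex"
      by (intro continuous_intros that)
    have cm: "continuous_on UNIV (\<lambda>x. (-1) * (p x * cnj (p x)))" by (intro continuous_intros cp)
    note cs = continuous_on_add[OF c[OF g cp] c[OF cp g]]
    have cd: "continuous_on UNIV (\<lambda>x. g x - p x)" by (intro continuous_intros g cp)
    ultimately show ?thesis
      by (simp only: Iadd[OF c[OF cd cd] continuous_on_add[OF cs cm]] Iadd[OF cs cm] Iadd[OF c[OF g cp] c[OF cp g]] gp pg)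
  qed
  finally have eq: "I (\<lambda>x. g x * cnj (g x)) = I (\<lambda>x. (g x - p x) * cnj (g x - p x)) + of_real S" by simp
  have sq: "Re (I (\<lambda>x. f x * cnj (f x))) = integral {0..2 * pi} (\<lambda>x. (norm (f x))\<^sup>2) / (2 * pi)" if "continuous_on UNIV f" for f
  proof -
    have "((\<lambda>x. (norm (f x))\<^sup>2) has_integral integral {0..2 * pi} (\<lambda>x. (norm (f x))\<^sup>2)) {0..2 * pi}"
      by (intro integrable_integral integrable_continuous_real continuous_intros continuous_on_subset[OF that]) auto
    from has_integral_of_real[OF this, where 'b = complex]
    have "integral {0..2 * pi} (\<lambda>x. f x * cnj (f x)) = of_real (integral {0..2 * pi} (\<lambda>x. (norm (f x))\<^sup>2))"
      unfolding complex_norm_square by (rule integral_unique)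
    then show ?thesis by (simp add: I_def flip: of_real_divide)
  qed
  have "S = integral {0..2 * pi} (\<lambda>x. (norm (g x))\<^sup>2) / (2 * pi) - integral {0..2 * pi} (\<lambda>x. (norm (g x - p x))\<^sup>2) / (2 * pi)"
    using arg_cong[OF eq, of Re] sq[OF g] sq[of "\<lambda>x. g x - p x"] g cp by (simp add: continuous_on_diff)
  also have "\<dots> \<le> integral {0..2 * pi} (\<lambda>x. (norm (g x))\<^sup>2) / (2 * pi)"
  proof -
    have "0 \<le> integral {0..2 * pi} (\<lambda>x. (norm (g x - p x))\<^sup>2)"
      by (rule Henstock_Kurzweil_Integration.integral_nonneg)
        (auto intro!: integrable_continuous_real continuous_intros continuous_on_subset[OF g] continuous_on_subset[OF cp])
    then show ?thesis by simp
  qed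
  also have "\<dots> \<le> B\<^sup>2"
  proof -
    have "norm (integral {0..2 * pi} (\<lambda>x. (norm (g x))\<^sup>2)) \<le> B\<^sup>2 * (2 * pi - 0)"
      by (rule integral_bound) (use B in \<open>auto intro!: power_mono continuous_intros continuous_on_subset[OF g]\<close>)
    then show ?thesis by (simp add: divide_le_eq)
  qed
  finally show ?thesis by (simp add: S_def)
qed

lemma fcoeff_tendsto_0:
  assumes g: "continuous_on UNIV g" and s: "inj (s :: nat \<Rightarrow> int)"
  shows "(\<lambda>N. fcoeff g (s N)) \<longlonglongrightarrow> 0"
proof -
  have "bounded (g ` {0..2 * pi})"
    by (intro compact_imp_bounded compact_continuous_image continuous_on_subset[OF g]) auto
  then obtain B where "\<And>x. x \<in> {0..2 * pi} \<Longrightarrow> norm (g x) \<le> B" unfolding bounded_iff by blast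
  note bes = bessel_inequality[OF g this]
  have "(\<lambda>n. (norm (fcoeff g n))\<^sup>2) summable_on UNIV"
    by (rule nonneg_bdd_above_summable_on) (use bes in \<open>auto simp: bdd_above_def\<close>)
  then have "(\<lambda>n. (norm (fcoeff g n))\<^sup>2) summable_on range s" by (rule summable_on_subset_banach) auto
  then have "(\<lambda>N. (norm (fcoeff g (s N)))\<^sup>2) summable_on UNIV"
    using summable_on_reindex[OF s, of "\<lambda>n. (norm (fcoeff g n))\<^sup>2"] by (simp add: o_def)
  then have "(\<lambda>N. (norm (fcoeff g (s N)))\<^sup>2) \<longlonglongrightarrow> 0"
    by (intro summable_LIMSEQ_zero summable_on_imp_summable)
  then have "(\<lambda>N. norm (fcoeff g (s N))) \<longlonglongrightarrow> 0"
    using tendsto_real_sqrt by fastforce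
  then show ?thesis by (rule tendsto_norm_zero_cancel)
qed

lemma has_vector_derivative_slope:
  assumes "(f has_vector_derivative D) (at y)"
  shows "((\<lambda>x. (f x - f y) /\<^sub>R (x - y)) \<longlongrightarrow> D) (at y)"
proof -
  have "((\<lambda>x. norm (f x - f y - (x - y) *\<^sub>R D) / norm (x - y)) \<longlongrightarrow> 0) (at y)"
    using assms by (simp add: has_vector_derivative_def has_derivative_iff_norm)
  moreover have "eventually (\<lambda>x. norm (f x - f y - (x - y) *\<^sub>R D) / norm (x - y) = norm ((f x - f y) /\<^sub>R (x - y) - D)) (at y)"
    using eventually_neq_at_within
  proof (rule eventually_mono)
    fix x :: real assume "x \<noteq> y"
    then have "f x - f y - (x - y) *\<^sub>R D = (x - y) *\<^sub>R ((f x - f y) /\<^sub>R (x - y) - D)"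
      by (simp add: scaleR_diff_right)
    with \<open>x \<noteq> y\<close> show "norm (f x - f y - (x - y) *\<^sub>R D) / norm (x - y) = norm ((f x - f y) /\<^sub>R (x - y) - D)"
      by simp
  qed
  ultimately have "((\<lambda>x. norm ((f x - f y) /\<^sub>R (x - y) - D)) \<longlongrightarrow> 0) (at y)" by (rule Lim_transform_eventually)
  then show ?thesis by (rule LIM_zero_cancel[OF tendsto_norm_zero_cancel])
qed

text \<open>Chernoff's proof.  The quotient \<open>g x = (f x - f x0) / (cis x - cis x0)\<close> extends continuously to its
  singularities.  The product \<open>(cis x - cis x0) * g x\<close> shifts the Fourier coefficients of \<open>g\<close>, so that the
  symmetric partial sums for \<open>f\<close> telescope, and the two boundary terms tend to zero by Bessel's
  inequality.\<close>

lemma fourier_inversion_line: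
  assumes der: "\<And>x. (f has_vector_derivative f' x) (at x)" and per: "\<And>x. f (x + 2 * pi) = f x"
    and sm: "(\<lambda>n. norm (fcoeff f n)) summable_on UNIV"
  shows "f x0 = (\<Sum>\<^sub>\<infinity>n. fcoeff f n * cis (of_int n * x0))"
proof -
  have cf: "continuous_on UNIV f"
    using der by (auto intro!: continuous_at_imp_continuous_on has_vector_derivative_continuous)
  have pern: "f (x + 2 * pi * real k) = f x" for x k
    by (induction k) (use per in \<open>auto simp: algebra_simps, metis add.assoc add.commute\<close>)
  have peri: "f (x + 2 * pi * of_int k) = f x" for x k
  proof (cases "k \<ge> 0")
    case True
    then show ?thesis using pern[of x "nat k"] by simp
  next
    case False
    then show ?thesis using pern[of "x + 2 * pi * of_int k" "nat (- k)"] by simp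
  qed
  have eq0: "f y = f x0" if "cis y = cis x0" for y
  proof -
    have "sin y = sin x0 \<and> cos y = cos x0" using that by (simp add: complex_eq_iff)
    then obtain k where "y = x0 + 2 * pi * of_int k" using sin_cos_eq_iff[of y x0] by (auto simp: mult_ac elim!: Ints_cases)
    then show ?thesis using peri by simp
  qed
  define g where "g x = (if cis x = cis x0 then f' x / (\<i> * cis x) else (f x - f x0) / (cis x - cis x0))" for x
  have cisder: "(cis has_vector_derivative \<i> * cis y) (at y)" for y
    unfolding has_vector_derivative_def
    by (rule has_derivative_eq_rhs[OF has_derivative_cis[OF has_derivative_ident]]) (simp add: fun_eq_iff scaleR_conv_of_real)
  have ccis: "isCont cis y" for y using has_vector_derivative_continuous[OF cisder] .
  have cg: "continuous_on UNIV g"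
  proof (rule continuous_at_imp_continuous_on, rule ballI)
    fix y
    show "isCont g y"
    proof (cases "cis y = cis x0")
      case False
      have "isCont (\<lambda>x. (f x - f x0) / (cis x - cis x0)) y"
        using False cf ccis by (intro continuous_intros) (auto simp: continuous_on_eq_continuous_at)
      moreover have "eventually (\<lambda>x. cis x \<noteq> cis x0) (nhds y)"
        by (rule tendsto_imp_eventually_ne[OF _ False, of cis "nhds y"]) 
          (use continuous_on_cis[of UNIV "\<lambda>x. x"] in \<open>auto simp: continuous_on_eq_continuous_at isCont_def tendsto_at_iff_tendsto_nhds\<close>)
      then have "eventually (\<lambda>x. g x = (f x - f x0) / (cis x - cis x0)) (nhds y)"
        by (rule eventually_mono) (simp add: g_def)
      ultimately show ?thesis by (simp add: isCont_cong)
    next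
      case True
      note a = has_vector_derivative_slope[OF der[of y]] and b = has_vector_derivative_slope[OF cisder[of y]]
      have "((\<lambda>x. ((f x - f y) /\<^sub>R (x - y)) / ((cis x - cis y) /\<^sub>R (x - y))) \<longlongrightarrow> f' y / (\<i> * cis y)) (at y)"
        by (rule tendsto_divide[OF a b]) simp
      moreover have "eventually (\<lambda>x. ((f x - f y) /\<^sub>R (x - y)) / ((cis x - cis y) /\<^sub>R (x - y)) = g x) (at y)"
      proof -
        have "eventually (\<lambda>x. x \<in> {y - pi<..<y + pi} \<and> x \<noteq> y) (at y)"
          by (intro eventually_conj eventually_at_in_open' eventually_neq_at_within) auto
        then show ?thesis
        proof (rule eventually_mono)
          fix x assume x: "x \<in> {y - pi<..<y + pi} \<and> x \<noteq> y"
          have "cis x \<noteq> cis x0"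
          proof
            assume "cis x = cis x0"
            then have "sin x = sin y \<and> cos x = cos y" using True by (simp add: complex_eq_iff)
            then obtain k where k: "x = y + 2 * pi * of_int k" using sin_cos_eq_iff[of x y] by (auto simp: mult_ac elim!: Ints_cases)
            then have "pi * (2 * of_int k) < pi * 1" "pi * (- 1) < pi * (2 * of_int k)" using x by auto
            then have "2 * real_of_int k < 1" "-1 < 2 * real_of_int k"
              unfolding mult_less_cancel_left_pos[OF pi_gt_zero] by auto
            then have "k = 0" by linarith
            then show False using k x by auto
          qed
          then show "((f x - f y) /\<^sub>R (x - y)) / ((cis x - cis y) /\<^sub>R (x - y)) = g x"
            using x True eq0[OF True] by (simp add: g_def scaleR_conv_of_real)
        qed
      qed
      ultimately have "(g \<longlongrightarrow> f' y / (\<i> * cis y)) (at y)" by (rule Lim_transform_eventually)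
      then show ?thesis using True by (simp add: isCont_def g_def)
    qed
  qed
  have fg: "f = (\<lambda>x. f x0 + (cis (of_int 1 * x) * g x + (- cis x0) * g x))"
  proof
    fix x
    show "f x = f x0 + (cis (of_int 1 * x) * g x + (- cis x0) * g x)"
    proof (cases "cis x = cis x0")
      case True
      then show ?thesis using eq0[OF True] by simp
    next
      case False
      then have "(cis x - cis x0) * g x = f x - f x0" by (simp add: g_def)
      then show ?thesis by (simp add: left_diff_distrib)
    qed
  qed
  define u where "u n = fcoeff f n * cis (of_int n * x0)" for n
  define v where "v n = fcoeff g n * cis (of_int (n + 1) * x0)" for n
  have uv: "u n = (if n = 0 then f x0 else 0) + v (n - 1) - v n" for n
  proof -
    have "fcoeff f n = fcoeff (\<lambda>x. f x0 + (cis (of_int 1 * x) * g x + (- cis x0) * g x)) n"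
      by (rule arg_cong[OF fg, of "\<lambda>f. fcoeff f n"])
    also have "\<dots> = (if n = 0 then f x0 else 0) + (fcoeff g (n - 1) - cis x0 * fcoeff g n)"
    proof -
      have c: "continuous_on UNIV (\<lambda>x. cis (of_int 1 * x) * g x)" "continuous_on UNIV (\<lambda>x. (- cis x0) * g x)"
        by (intro continuous_intros cg)+
      show ?thesis
        by (simp only: fcoeff_add[OF continuous_on_const continuous_on_add[OF c]] fcoeff_add[OF c] fcoeff_shift
            fcoeff_cmult fcoeff_const) simp
    qed
    finally have "u n = ((if n = 0 then f x0 else 0) + (fcoeff g (n - 1) - cis x0 * fcoeff g n)) * cis (of_int n * x0)"
      by (simp add: u_def)
    also have "\<dots> = (if n = 0 then f x0 else 0) + v (n - 1) - v n"
      by (simp add: v_def algebra_simps flip: cis_mult)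
    finally show ?thesis .
  qed
  have us: "(\<lambda>n. norm (u n)) summable_on UNIV" using sm by (simp add: u_def norm_mult)
  have S: "sum u {- int N..int N} = f x0 + v (- int N - 1) - v (int N)" for N
  proof (induction N)
    case 0
    then show ?case by (simp add: uv)
  next
    case (Suc N)
    have "{- int (Suc N)..int (Suc N)} = insert (int (Suc N)) (insert (- int (Suc N)) {- int N..int N})" by auto
    then have "sum u {- int (Suc N)..int (Suc N)} = u (int (Suc N)) + (u (- int (Suc N)) + sum u {- int N..int N})"
      by (simp add: sum.insert_if)
    moreover have "u (int (Suc N)) = v (int N) - v (int (Suc N))"
      using uv[of "int (Suc N)"] by simp
    moreover have "u (- int (Suc N)) = v (- int (Suc N) - 1) - v (- int N - 1)"
    proof -
      have "v (- int (Suc N)) = v (- int N - 1)" by (rule arg_cong[where f = v]) simp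
      then show ?thesis using uv[of "- int (Suc N)"] by (simp del: of_nat_Suc)
    qed
    moreover have "(a - b) + ((c - d) + (e + d - a)) = e + c - b" for a b c d e :: complex by simp
    ultimately show ?case by (simp only: Suc)
  qed
  have "(\<lambda>N. sum u {- int N..int N}) \<longlonglongrightarrow> infsum u UNIV"
  proof -
    have "(sum u \<longlongrightarrow> infsum u UNIV) (finite_subsets_at_top UNIV)"
      using has_sum_infsum[OF abs_summable_summable[OF us]] by (simp add: has_sum_def)
    moreover have "filterlim (\<lambda>N. {- int N..int N}) (finite_subsets_at_top UNIV) sequentially"
      unfolding filterlim_finite_subsets_at_top
    proof (intro allI impI)
      fix X :: "int set" assume X: "finite X \<and> X \<subseteq> UNIV"
      obtain M where M: "\<And>x. x \<in> X \<Longrightarrow> \<bar>x\<bar> \<le> M"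
        using X finite_imp_bounded[of "(\<lambda>x. real_of_int \<bar>x\<bar>) ` X"] Max_ge[of "abs ` X"] by (metis finite_imageI imageI)
      show "eventually (\<lambda>N. finite {- int N..int N} \<and> X \<subseteq> {- int N..int N} \<and> {- int N..int N} \<subseteq> UNIV) sequentially"
        using eventually_ge_at_top[of "nat M"]
      proof (rule eventually_mono)
        fix N assume "nat M \<le> N"
        then have "x \<in> {- int N..int N}" if "x \<in> X" for x using M[OF that] by auto
        then show "finite {- int N..int N} \<and> X \<subseteq> {- int N..int N} \<and> {- int N..int N} \<subseteq> UNIV" by auto
      qed
    qed
    ultimately show ?thesis by (rule filterlim_compose)
  qed
  moreover have "(\<lambda>N. sum u {- int N..int N}) \<longlonglongrightarrow> f x0 + 0 - 0"
    unfolding S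
  proof (intro tendsto_intros)
    have n: "norm (v n) = norm (fcoeff g n)" for n by (simp add: v_def norm_mult)
    have "inj (\<lambda>N. - int N - 1)" "inj int" by (auto simp: inj_on_def)
    from this[THEN fcoeff_tendsto_0[OF cg], THEN tendsto_norm]
    show "(\<lambda>N. v (- int N - 1)) \<longlonglongrightarrow> 0" "(\<lambda>N. v (int N)) \<longlonglongrightarrow> 0"
      by (auto intro!: tendsto_norm_zero_cancel[of "\<lambda>N. v (_ N)"] simp: n tendsto_norm_zero_iff[of v] elim!: tendsto_norm_zero_cancel)
  qed
  ultimately have "infsum u UNIV = f x0" using LIMSEQ_unique by fastforce
  then show ?thesis by (simp add: u_def[abs_def])
qed

section \<open>Fourier coefficients of doubly periodic functions\<close>

definition periodic2 :: "(complex \<Rightarrow> complex) \<Rightarrow> bool" where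
  "periodic2 F \<longleftrightarrow> (\<forall>z. F (z + of_real (2 * pi)) = F z \<and> F (z + \<i> * of_real (2 * pi)) = F z)"

definition fcoeff2 :: "(complex \<Rightarrow> complex) \<Rightarrow> freq \<Rightarrow> complex" where
  "fcoeff2 F k = fcoeff (\<lambda>y. fcoeff (\<lambda>x. F (Complex x y)) (fst k)) (snd k)"

lemma smooth_continuous_Complex:
  assumes "smooth_on UNIV F"
  shows "continuous_on UNIV (\<lambda>p. F (Complex (snd p) (fst p)))" "continuous_on UNIV (\<lambda>x. F (Complex x y))"
  unfolding Complex_eq
  by (intro continuous_on_compose2[OF smooth_on_continuous[OF assms]] continuous_intros; simp)+

lemma slice_derivatives_at:
  fixes F :: "complex \<Rightarrow> 'a::real_normed_vector"
  assumes "(F has_derivative frechet_derivative F (at (Complex x y))) (at (Complex x y))"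
  shows "((\<lambda>x. F (Complex x y)) has_vector_derivative du F (Complex x y)) (at x)"
    and "((\<lambda>y. F (Complex x y)) has_vector_derivative dv F (Complex x y)) (at y)"
proof -
  have 1: "((\<lambda>x. Complex x y) has_derivative (\<lambda>h. h *\<^sub>R 1)) (at x)"
    and 2: "((\<lambda>y. Complex x y) has_derivative (\<lambda>h. h *\<^sub>R \<i>)) (at y)"
    unfolding Complex_eq by (auto intro!: derivative_eq_intros simp: fun_eq_iff scaleR_conv_of_real)
  note lin = linear_scale[OF has_derivative_linear[OF assms]]
  show "((\<lambda>x. F (Complex x y)) has_vector_derivative du F (Complex x y)) (at x)"
    using has_derivative_compose[OF 1 assms] by (simp only: has_vector_derivative_def du_def lin)
  show "((\<lambda>y. F (Complex x y)) has_vector_derivative dv F (Complex x y)) (at y)"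
    using has_derivative_compose[OF 2 assms] by (simp only: has_vector_derivative_def dv_def lin)
qed

lemma slice_derivatives:
  assumes "smooth_on UNIV F"
  shows "((\<lambda>x. F (Complex x y)) has_vector_derivative du F (Complex x y)) (at x)"
    and "((\<lambda>y. F (Complex x y)) has_vector_derivative dv F (Complex x y)) (at y)"
  using slice_derivatives_at smooth_on_has_derivative[OF assms] by blast+

lemma smooth_du: "smooth_on S F \<Longrightarrow> smooth_on S (du F)" and smooth_dv: "smooth_on S F \<Longrightarrow> smooth_on S (dv F)"
  unfolding du_def[abs_def] dv_def[abs_def] by (auto intro: smooth_on_derivative)

lemma periodic2_derivatives:
  assumes "smooth_on UNIV F" "periodic2 F"
  shows "periodic2 (du F)" "periodic2 (dv F)"
proof -
  have "frechet_derivative F (at (z + c)) = frechet_derivative F (at z)" if "\<And>z. F (z + c) = F z" for z c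
  proof -
    have "((\<lambda>z. z + c) has_derivative (\<lambda>h. h)) (at z)" by (auto intro!: derivative_eq_intros)
    from has_derivative_compose[OF this, of F] smooth_on_has_derivative[OF assms(1)]
    have "((\<lambda>z. F (z + c)) has_derivative frechet_derivative F (at (z + c))) (at z)" by simp
    then have "(F has_derivative frechet_derivative F (at (z + c))) (at z)" using that by simp
    then show ?thesis by (rule frechet_derivative_at)
  qed
  then show "periodic2 (du F)" "periodic2 (dv F)"
    using assms(2) unfolding periodic2_def du_def dv_def by metis+
qed

text \<open>Differentiation under the integral sign.\<close>

lemma fcoeff_param_derivative:
  assumes "smooth_on UNIV F"
  shows "((\<lambda>y. fcoeff (\<lambda>x. F (Complex x y)) j) has_vector_derivative fcoeff (\<lambda>x. dv F (Complex x y)) j) (at y)"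
proof -
  have "((\<lambda>y. integral (cbox 0 (2 * pi)) (\<lambda>x. F (Complex x y) * cis (- (of_int j * x)))) has_vector_derivative
      integral (cbox 0 (2 * pi)) (\<lambda>x. dv F (Complex x y) * cis (- (of_int j * x)))) (at y within UNIV)"
  proof (rule leibniz_rule_vector_derivative)
    fix y x
    show "((\<lambda>y. F (Complex x y) * cis (- (of_int j * x))) has_vector_derivative dv F (Complex x y) * cis (- (of_int j * x))) (at y within UNIV)"
      using has_vector_derivative_mult_left[OF slice_derivatives(2)[OF assms]] by simp
    show "(\<lambda>x. F (Complex x y) * cis (- (of_int j * x))) integrable_on cbox 0 (2 * pi)"
      using fcoeff_integrable[OF smooth_continuous_Complex(2)[OF assms]] by simp
    have c: "continuous_on UNIV (\<lambda>p. dv F (Complex (snd p) (fst p)))"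
      by (rule smooth_continuous_Complex(1)[OF smooth_dv[OF assms]])
    show "continuous_on (UNIV \<times> cbox 0 (2 * pi)) (\<lambda>(y, x). dv F (Complex x y) * cis (- (of_int j * x)))"
      unfolding split_def by (intro continuous_intros continuous_on_subset[OF c]) auto
  qed auto
  from has_vector_derivative_divide[OF this, of "of_real (2 * pi)"]
  show ?thesis by (simp add: fcoeff_def)
qed

lemma fcoeff_param_continuous:
  "smooth_on UNIV F \<Longrightarrow> continuous_on UNIV (\<lambda>y. fcoeff (\<lambda>x. F (Complex x y)) j)"
  using fcoeff_param_derivative[of F j]
  by (auto intro!: continuous_at_imp_continuous_on has_vector_derivative_continuous)

lemma Complex_shift: "Complex (x + 2 * pi) y = Complex x y + of_real (2 * pi)"
  "Complex x (y + 2 * pi) = Complex x y + \<i> * of_real (2 * pi)"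
  by (simp_all add: complex_eq_iff)

lemma fcoeff2_derivatives:
  assumes "smooth_on UNIV F" "periodic2 F"
  shows "fcoeff2 (du F) k = \<i> * of_int (fst k) * fcoeff2 F k"
    and "fcoeff2 (dv F) k = \<i> * of_int (snd k) * fcoeff2 F k"
proof -
  have "fcoeff (\<lambda>x. du F (Complex x y)) j = \<i> * of_int j * fcoeff (\<lambda>x. F (Complex x y)) j" for y j
  proof (rule fcoeff_derivative[OF slice_derivatives(1)[OF assms(1)] smooth_continuous_Complex(2)[OF smooth_du[OF assms(1)]]])
    show "F (Complex (2 * pi) y) = F (Complex 0 y)"
      using assms(2) Complex_shift(1)[of 0 y] by (simp add: periodic2_def)
  qed
  then show "fcoeff2 (du F) k = \<i> * of_int (fst k) * fcoeff2 F k"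
    unfolding fcoeff2_def by (simp only: fcoeff_cmult)
  show "fcoeff2 (dv F) k = \<i> * of_int (snd k) * fcoeff2 F k"
    unfolding fcoeff2_def
  proof (rule fcoeff_derivative[OF fcoeff_param_derivative[OF assms(1)] fcoeff_param_continuous[OF smooth_dv[OF assms(1)]]])
    have "F (Complex x (2 * pi)) = F (Complex x 0)" for x
      using assms(2) Complex_shift(2)[of x 0] by (simp add: periodic2_def)
    then show "fcoeff (\<lambda>x. F (Complex x (2 * pi))) (fst k) = fcoeff (\<lambda>x. F (Complex x 0)) (fst k)" by simp
  qed
qed

lemma iterated_derivatives:
  assumes "smooth_on UNIV F" "periodic2 F"
  shows "smooth_on UNIV ((du ^^ m) F) \<and> periodic2 ((du ^^ m) F) \<and> fcoeff2 ((du ^^ m) F) k = (\<i> * of_int (fst k)) ^ m * fcoeff2 F k"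
    and "smooth_on UNIV ((dv ^^ m) F) \<and> periodic2 ((dv ^^ m) F) \<and> fcoeff2 ((dv ^^ m) F) k = (\<i> * of_int (snd k)) ^ m * fcoeff2 F k"
  by (induction m) (use assms fcoeff2_derivatives smooth_du smooth_dv periodic2_derivatives in auto)

lemma fcoeff2_bound:
  assumes "smooth_on UNIV F" "\<And>x y. x \<in> {0..2 * pi} \<Longrightarrow> y \<in> {0..2 * pi} \<Longrightarrow> norm (F (Complex x y)) \<le> B"
  shows "norm (fcoeff2 F k) \<le> B"
  unfolding fcoeff2_def
  by (intro fcoeff_bound fcoeff_param_continuous smooth_continuous_Complex(2) assms)

text \<open>Differentiating \<open>M\<close> times in a variable multiplies the coefficient by the \<open>M\<close>-th power of the
  frequency, up to a factor of absolute value one.  The left-hand side is the sum of the four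
  quantities estimated in this way.\<close>

lemma fcoeff2_decay:
  assumes F: "smooth_on UNIV F" "periodic2 F"
    and B: "\<And>m n x y. m \<in> {0, M} \<Longrightarrow> n \<in> {0, M} \<Longrightarrow> x \<in> {0..2 * pi} \<Longrightarrow> y \<in> {0..2 * pi} \<Longrightarrow>
      norm ((du ^^ m) ((dv ^^ n) F) (Complex x y)) \<le> B"
  shows "(1 + \<bar>of_int (fst k)\<bar> ^ M) * (1 + \<bar>of_int (snd k)\<bar> ^ M) * norm (fcoeff2 F k) \<le> 4 * B"
proof -
  have *: "\<bar>of_int (fst k)\<bar> ^ m * \<bar>of_int (snd k)\<bar> ^ n * norm (fcoeff2 F k) \<le> B"
    if "m \<in> {0, M}" "n \<in> {0, M}" for m n
  proof -
    have dv: "smooth_on UNIV ((dv ^^ n) F)" "periodic2 ((dv ^^ n) F)" using iterated_derivatives(2)[OF F] by blast+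
    have "fcoeff2 ((du ^^ m) ((dv ^^ n) F)) k = (\<i> * of_int (fst k)) ^ m * ((\<i> * of_int (snd k)) ^ n * fcoeff2 F k)"
      using iterated_derivatives(1)[OF dv] iterated_derivatives(2)[OF F] by simp
    moreover have "norm (fcoeff2 ((du ^^ m) ((dv ^^ n) F)) k) \<le> B"
      using iterated_derivatives(1)[OF dv] B[OF that] by (intro fcoeff2_bound) auto
    ultimately show ?thesis by (simp add: norm_mult norm_power mult.assoc)
  qed
  have "(1 + \<bar>of_int (fst k)\<bar> ^ M) * (1 + \<bar>of_int (snd k)\<bar> ^ M) * norm (fcoeff2 F k)
    = \<bar>of_int (fst k)\<bar> ^ 0 * \<bar>of_int (snd k)\<bar> ^ 0 * norm (fcoeff2 F k) + \<bar>of_int (fst k)\<bar> ^ M * \<bar>of_int (snd k)\<bar> ^ 0 * norm (fcoeff2 F k)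
     + \<bar>of_int (fst k)\<bar> ^ 0 * \<bar>of_int (snd k)\<bar> ^ M * norm (fcoeff2 F k) + \<bar>of_int (fst k)\<bar> ^ M * \<bar>of_int (snd k)\<bar> ^ M * norm (fcoeff2 F k)"
    by (simp add: algebra_simps)
  also have "\<dots> \<le> B + B + B + B" by (intro add_mono *) auto
  finally show ?thesis by simp
qed

definition decay :: "freq \<Rightarrow> real" where
  "decay k = inverse (1 + (of_int (fst k))\<^sup>2) * inverse (1 + (of_int (snd k))\<^sup>2)"

lemma decay_summable: "decay summable_on UNIV"
proof -
  define f where "f n = inverse (1 + (real_of_int n)\<^sup>2)" for n
  have pos: "0 \<le> f n" for n by (simp add: f_def)
  have N: "(\<lambda>n::nat. f (int n)) summable_on UNIV"
  proof -
    have "summable (\<lambda>n. inverse (real (Suc n) ^ 2))"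
      using inverse_power_summable[of 2, where 'a = real] by (subst summable_Suc_iff[of "\<lambda>n. inverse (real n ^ 2)"]) auto
    then have "summable (\<lambda>n. 2 * inverse (real (Suc n) ^ 2))" by (rule summable_mult)
    then have "summable (\<lambda>n. f (int n))"
    proof (rule summable_comparison_test'[where N = 0])
      fix n :: nat
      have "(real (Suc n))\<^sup>2 \<le> 2 * (1 + (real n)\<^sup>2)"
        using zero_le_power2[of "real n - 1"] by (simp add: power2_eq_square algebra_simps)
      then have "inverse (1 + (real n)\<^sup>2) \<le> 2 * inverse ((real (Suc n))\<^sup>2)"
        by (simp add: field_simps add_pos_nonneg)
      then show "norm (f (int n)) \<le> 2 * inverse (real (Suc n) ^ 2)" by (simp add: f_def)
    qed
    then show ?thesis using pos by (subst summable_on_UNIV_nonneg_real_iff) auto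
  qed
  have "f summable_on range int"
    using N by (subst summable_on_reindex) (auto simp: o_def inj_on_def)
  moreover have "f summable_on range (\<lambda>n. - int n)"
  proof (subst summable_on_reindex)
    show "f \<circ> (\<lambda>n. - int n) summable_on UNIV" using N by (simp add: o_def f_def)
  qed (auto simp: inj_on_def)
  ultimately have "f summable_on (range int \<union> range (\<lambda>n. - int n))" by (rule summable_on_union)
  moreover have "range int \<union> range (\<lambda>n. - int n) = UNIV"
  proof (intro equalityI subsetI UNIV_I)
    fix n :: int show "n \<in> range int \<union> range (\<lambda>n. - int n)"
      by (cases n rule: int_cases2) auto
  qed
  ultimately have "(\<lambda>n. norm (f n)) summable_on UNIV" using pos by simp
  from product_summable(1)[OF this this]
  show ?thesis using pos by (simp add: decay_def[abs_def] f_def abs_mult)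
qed

lemma periodic_bounded_on_square:
  assumes "smooth_on UNIV F"
  obtains B where "\<And>x y. x \<in> {0..2 * pi} \<Longrightarrow> y \<in> {0..2 * pi} \<Longrightarrow> norm (F (Complex x y)) \<le> B"
proof -
  have "bounded ((\<lambda>p. F (Complex (snd p) (fst p))) ` ({0..2 * pi} \<times> {0..2 * pi}))"
    by (intro compact_imp_bounded compact_continuous_image continuous_on_subset[OF smooth_continuous_Complex(1)[OF assms]] compact_Times) auto
  then obtain B where "\<forall>v\<in>(\<lambda>p. F (Complex (snd p) (fst p))) ` ({0..2 * pi} \<times> {0..2 * pi}). norm v \<le> B"
    unfolding bounded_iff by blast
  then show ?thesis by (intro that[of B]) force
qed

lemma rapid_fcoeff2:
  assumes "smooth_on UNIV F" "periodic2 F"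
  shows "rapid (fcoeff2 F)"
  unfolding rapid_def
proof
  fix N :: nat
  define M where "M = N + 2"
  have "\<exists>B. \<forall>x\<in>{0..2 * pi}. \<forall>y\<in>{0..2 * pi}. norm ((du ^^ m) ((dv ^^ n) F) (Complex x y)) \<le> B" for m n
    using periodic_bounded_on_square[of "(du ^^ m) ((dv ^^ n) F)"] iterated_derivatives assms by metis
  then obtain b where b: "\<And>m n x y. x \<in> {0..2 * pi} \<Longrightarrow> y \<in> {0..2 * pi} \<Longrightarrow> norm ((du ^^ m) ((dv ^^ n) F) (Complex x y)) \<le> b m n"
    by metis
  define B where "B = \<bar>b 0 0\<bar> + \<bar>b 0 M\<bar> + \<bar>b M 0\<bar> + \<bar>b M M\<bar>"
  have bB: "b m n \<le> B" if "m \<in> {0, M}" "n \<in> {0, M}" for m n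
    using that by (auto simp: B_def)
  have B: "norm ((du ^^ m) ((dv ^^ n) F) (Complex x y)) \<le> B"
    if "m \<in> {0, M}" "n \<in> {0, M}" "x \<in> {0..2 * pi}" "y \<in> {0..2 * pi}" for m n x y
    using order_trans[OF b[OF that(3,4)] bB[OF that(1,2)]] .
  have one: "(1 + t) ^ N * (1 + t\<^sup>2) \<le> 2 ^ Suc N * (1 + t ^ M)" if "0 \<le> t" for t :: real
  proof (cases "t \<le> 1")
    case True
    have "(1 + t) ^ N * (1 + t\<^sup>2) \<le> 2 ^ N * 2"
      using True that by (intro mult_mono power_mono) (auto intro: power_le_one)
    also have "\<dots> \<le> 2 ^ Suc N * (1 + t ^ M)" using that by simp
    finally show ?thesis .
  next
    case False
    have "(1 + t) ^ N * (1 + t\<^sup>2) \<le> (2 * t) ^ N * (2 * t\<^sup>2)"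
      using False by (intro mult_mono power_mono) (auto intro: one_le_power)
    also have "\<dots> = 2 ^ Suc N * t ^ M" by (simp add: M_def power_add power_mult_distrib power2_eq_square)
    also have "\<dots> \<le> 2 ^ Suc N * (1 + t ^ M)" by simp
    finally show ?thesis .
  qed
  have key: "weight N 1 k * norm (fcoeff2 F k) \<le> (2 ^ Suc N * 2 ^ Suc N * (4 * B)) * decay k" for k
  proof -
    define s t where "s = \<bar>real_of_int (fst k)\<bar>" and "t = \<bar>real_of_int (snd k)\<bar>"
    have st: "0 \<le> s" "0 \<le> t" by (simp_all add: s_def t_def)
    have w: "weight N 1 k \<le> (1 + s) ^ N * (1 + t) ^ N"
      unfolding power_mult_distrib[symmetric] weight_def size_of_def s_def[symmetric] t_def[symmetric]
      using st by (intro power_mono) (auto simp: algebra_simps)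
    have q: "0 < 1 + s\<^sup>2" "0 < 1 + t\<^sup>2" by (simp_all add: add_pos_nonneg)
    have "weight N 1 k * norm (fcoeff2 F k) * ((1 + s\<^sup>2) * (1 + t\<^sup>2))
       \<le> ((1 + s) ^ N * (1 + t) ^ N) * norm (fcoeff2 F k) * ((1 + s\<^sup>2) * (1 + t\<^sup>2))"
      using w q by (intro mult_right_mono) auto
    also have "\<dots> = ((1 + s) ^ N * (1 + s\<^sup>2)) * ((1 + t) ^ N * (1 + t\<^sup>2)) * norm (fcoeff2 F k)" by (simp add: mult_ac)
    also have "\<dots> \<le> (2 ^ Suc N * (1 + s ^ M)) * (2 ^ Suc N * (1 + t ^ M)) * norm (fcoeff2 F k)"
      using st q by (intro mult_right_mono mult_mono one) auto
    also have "\<dots> = 2 ^ Suc N * 2 ^ Suc N * ((1 + s ^ M) * (1 + t ^ M) * norm (fcoeff2 F k))" by (simp add: mult_ac)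
    also have "\<dots> \<le> 2 ^ Suc N * 2 ^ Suc N * (4 * B)"
      unfolding s_def t_def by (intro mult_left_mono fcoeff2_decay[OF assms B]) auto
    finally have "weight N 1 k * norm (fcoeff2 F k) * ((1 + s\<^sup>2) * (1 + t\<^sup>2)) \<le> 2 ^ Suc N * 2 ^ Suc N * (4 * B)" .
    moreover have "decay k = inverse ((1 + s\<^sup>2) * (1 + t\<^sup>2))" by (simp add: decay_def s_def t_def)
    ultimately show ?thesis using q by (simp only: divide_inverse[symmetric] pos_le_divide_eq mult_pos_pos)
  qed
  have "(\<lambda>k. norm (weight N 1 k * norm (fcoeff2 F k))) summable_on UNIV"
    by (rule Infinite_Sum.abs_summable_on_comparison_test'[OF summable_on_cmult_right[OF decay_summable]])
      (use key size_of_nonneg in \<open>auto simp: abs_mult weight_def\<close>)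
  then show "wsummable (weight N 1) (fcoeff2 F)"
    using size_of_nonneg by (simp add: wsummable_def abs_mult weight_def)
qed

text \<open>One-variable inversion is applied in \<open>y\<close> to the coefficients with respect to \<open>x\<close>, and then in \<open>x\<close>.\<close>

lemma series_fcoeff2:
  assumes F: "smooth_on UNIV F" "periodic2 F"
  shows "series (fcoeff2 F) z = F z"
proof -
  have S: "(\<lambda>k. norm (fcoeff2 F k)) summable_on UNIV \<times> UNIV"
    using rapid_summable[OF rapid_fcoeff2[OF F]] by (simp add: wsummable_def)
  define a where "a j y = fcoeff (\<lambda>x. F (Complex x y)) j" for j y
  have ca: "fcoeff (a j) k = fcoeff2 F (j, k)" for j k by (simp add: fcoeff2_def a_def[abs_def])
  have S1: "(\<lambda>k. norm (fcoeff2 F (j, k))) summable_on UNIV" for j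
    using summable_on_SigmaD1[of "\<lambda>j k. norm (fcoeff2 F (j, k))" UNIV "\<lambda>_. UNIV" j] S by (simp add: split_def)
  have a: "a j y = (\<Sum>\<^sub>\<infinity>k. fcoeff2 F (j, k) * cis (of_int k * y))" for j y
    unfolding ca[symmetric]
  proof (rule fourier_inversion_line)
    show "(a j has_vector_derivative fcoeff (\<lambda>x. dv F (Complex x y)) j) (at y)" for y
      unfolding a_def by (rule fcoeff_param_derivative[OF F(1)])
    show "a j (y + 2 * pi) = a j y" for y
      unfolding a_def Complex_shift(2) using F(2) by (simp add: periodic2_def)
    show "(\<lambda>n. norm (fcoeff (a j) n)) summable_on UNIV" using S1 by (simp add: ca)
  qed
  have na: "(\<lambda>j. norm (a j y)) summable_on UNIV" for y
  proof (rule Infinite_Sum.abs_summable_on_comparison_test')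
    show "(\<lambda>j. \<Sum>\<^sub>\<infinity>k. norm (fcoeff2 F (j, k))) summable_on UNIV"
      using summable_on_Sigma_banach[of "\<lambda>j k. norm (fcoeff2 F (j, k))" UNIV "\<lambda>_. UNIV"] S by (simp add: split_def)
    fix j show "norm (a j y) \<le> (\<Sum>\<^sub>\<infinity>k. norm (fcoeff2 F (j, k)))"
      unfolding a using norm_infsum_bound[of "\<lambda>k. fcoeff2 F (j, k) * cis (of_int k * y)" UNIV] S1 by (simp add: norm_mult)
  qed
  define x y where "x = Re z" and "y = Im z"
  have zxy: "z = Complex x y" by (simp add: x_def y_def)
  have "F z = (\<Sum>\<^sub>\<infinity>j. a j y * cis (of_int j * x))"
    unfolding zxy a_def
  proof (rule fourier_inversion_line[OF slice_derivatives(1)[OF F(1)]])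
    show "F (Complex (x + 2 * pi) y) = F (Complex x y)" for x
      unfolding Complex_shift(1) using F(2) by (simp add: periodic2_def)
    show "(\<lambda>n. norm (fcoeff (\<lambda>x. F (Complex x y)) n)) summable_on UNIV" using na[of y] by (simp add: a_def)
  qed
  also have "\<dots> = (\<Sum>\<^sub>\<infinity>j. \<Sum>\<^sub>\<infinity>k. fcoeff2 F (j, k) * wave (j, k) z)"
    unfolding a infsum_cmult_left'[symmetric]
    by (simp add: wave_def pairing_def x_def y_def mult.assoc cis_mult add.commute)
  also have "\<dots> = series (fcoeff2 F) z"
    unfolding series_def
    using infsum_Sigma_banach[of "\<lambda>k. fcoeff2 F k * wave k z" UNIV "\<lambda>_. UNIV"]
      series_abs_summable(2)[OF rapid_summable[OF rapid_fcoeff2[OF F]], of z] by simp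
  finally show ?thesis by simp
qed

section \<open>Local solutions of the Beltrami equation\<close>

text \<open>A bounded doubly periodic map of the plane that is the identity near the origin.  Composition with
  it makes a function periodic without changing its germ at the origin.\<close>

definition bend :: "complex \<Rightarrow> complex" where
  "bend z = Complex (saw (Re z)) (saw (Im z))"

lemma smooth_bend: "smooth_on UNIV bend"
proof -
  have "smooth_on UNIV (\<lambda>z. saw (Re z))" "smooth_on UNIV (\<lambda>z. saw (Im z))"
    by (rule smooth_on_compose[OF open_UNIV _ _ smooth_saw],
        simp, intro smooth_on_linear[OF _ bounded_linear_Re] smooth_on_linear[OF _ bounded_linear_Im] smooth_on_id, simp)+
  then show ?thesis unfolding bend_def[abs_def] Complex_eq
    by (intro smooth_on_add smooth_on_mult smooth_on_const smooth_on_linear[OF _ bounded_linear_of_real]) auto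
qed

lemma norm_bend: "norm (bend z) < 8"
proof -
  have "norm (bend z) \<le> \<bar>saw (Re z)\<bar> + \<bar>saw (Im z)\<bar>"
    using cmod_le[of "bend z"] by (simp add: bend_def)
  also have "\<dots> \<le> pi + pi" by (intro add_mono saw_bound)
  finally show ?thesis using pi_less_4 by linarith
qed

lemma bend_eq: "norm z < 1 \<Longrightarrow> bend z = z"
  using abs_Re_le_cmod[of z] abs_Im_le_cmod[of z] by (simp add: bend_def saw_eq)

lemma bend_periodic: "bend (z + of_real (2 * pi)) = bend z" "bend (z + \<i> * of_real (2 * pi)) = bend z"
  using saw_periodic by (simp_all add: bend_def)

text \<open>The derivatives of the functions \<open>H (t, _)\<close> are restrictions of functions that are continuous in
  both variables; on compact sets they are therefore bounded uniformly in \<open>t\<close>.\<close>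

lemma parameter_derivatives:
  fixes H :: "real \<times> complex \<Rightarrow> complex"
  assumes "smooth_on (T \<times> UNIV) H" "open T"
  defines "DX \<equiv> \<lambda>H p. frechet_derivative H (at p) (0, 1)" and "DY \<equiv> \<lambda>H p. frechet_derivative H (at p) (0, \<i>)"
  shows "smooth_on (T \<times> UNIV) ((DX ^^ m) H) \<and> (\<forall>t\<in>T. (du ^^ m) (\<lambda>z. H (t, z)) = (\<lambda>z. (DX ^^ m) H (t, z)))"
    and "smooth_on (T \<times> UNIV) ((DY ^^ m) H) \<and> (\<forall>t\<in>T. (dv ^^ m) (\<lambda>z. H (t, z)) = (\<lambda>z. (DY ^^ m) H (t, z)))"
proof -
  have slice: "frechet_derivative (\<lambda>z. K (t, z)) (at z) h = frechet_derivative K (at (t, z)) (0, h)"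
    if "smooth_on (T \<times> UNIV) K" "t \<in> T" for K :: "real \<times> complex \<Rightarrow> complex" and t z h
  proof -
    have 1: "((\<lambda>z. (t, z)) has_derivative (\<lambda>h. (0, h))) (at z)" by (auto intro!: derivative_eq_intros)
    have 2: "(K has_derivative frechet_derivative K (at (t, z))) (at (t, z))"
      using smooth_on_has_derivative[OF that(1)] that(2) by simp
    from frechet_derivative_at[OF has_derivative_compose[OF 1 2]] show ?thesis by metis
  qed
  show "smooth_on (T \<times> UNIV) ((DX ^^ m) H) \<and> (\<forall>t\<in>T. (du ^^ m) (\<lambda>z. H (t, z)) = (\<lambda>z. (DX ^^ m) H (t, z)))"
  proof (induction m)
    case (Suc m)
    then have sm: "smooth_on (T \<times> UNIV) ((DX ^^ m) H)" by blast
    have "(du ^^ Suc m) (\<lambda>z. H (t, z)) = (\<lambda>z. (DX ^^ Suc m) H (t, z))" if "t \<in> T" for t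
      using Suc that slice[OF sm that] by (simp add: du_def[abs_def] DX_def)
    then show ?case using smooth_on_derivative[OF sm, of "(0, 1)"] by (simp add: DX_def)
  qed (simp add: assms)
  show "smooth_on (T \<times> UNIV) ((DY ^^ m) H) \<and> (\<forall>t\<in>T. (dv ^^ m) (\<lambda>z. H (t, z)) = (\<lambda>z. (DY ^^ m) H (t, z)))"
  proof (induction m)
    case (Suc m)
    then have sm: "smooth_on (T \<times> UNIV) ((DY ^^ m) H)" by blast
    have "(dv ^^ Suc m) (\<lambda>z. H (t, z)) = (\<lambda>z. (DY ^^ Suc m) H (t, z))" if "t \<in> T" for t
      using Suc that slice[OF sm that] by (simp add: dv_def[abs_def] DY_def)
    then show ?case using smooth_on_derivative[OF sm, of "(0, \<i>)"] by (simp add: DY_def)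
  qed (simp add: assms)
qed

text \<open>For \<open>t\<close> in \<open>[0, 1]\<close> the coefficients have a common summable bound, since the derivatives up to order
  two in each variable are bounded uniformly in \<open>t\<close>.  Each single coefficient is at most the supremum of
  the function, which tends to zero with \<open>t\<close> because \<open>\<mu> 0 = 0\<close>.  So the sum of the absolute values tends
  to zero as well.\<close>

lemma bent_coefficients_small:
  assumes mu: "smooth_on (ball 0 16) \<mu>" and mu0: "\<mu> 0 = (0 :: complex)"
  obtains t where "0 < t" "t \<le> 1" "smooth_on UNIV (\<lambda>z. \<mu> (t *\<^sub>R bend z))" "periodic2 (\<lambda>z. \<mu> (t *\<^sub>R bend z))"
    "wnorm (\<lambda>k. 1) (fcoeff2 (\<lambda>z. \<mu> (t *\<^sub>R bend z))) < 1/2"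
proof -
  \<comment> \<open>an open interval around \<open>[0, 1]\<close>; as \<open>norm (bend z) < 8\<close>, the radius 16 suffices for it\<close>
  define T where "T = {-2<..<2::real}"
  define H where "H p = \<mu> (fst p *\<^sub>R bend (snd p))" for p
  have oT: "open T" "open (T \<times> (UNIV :: complex set))" by (auto simp: T_def intro!: open_Times)
  have sH: "smooth_on (T \<times> UNIV) H"
    unfolding H_def
  proof (rule smooth_on_compose[OF oT(2) _ _ mu])
    have "norm (t *\<^sub>R bend z) < 16" if "t \<in> T" for t z
    proof -
      have "\<bar>t\<bar> * norm (bend z) \<le> 2 * norm (bend z)" using that by (intro mult_right_mono) (auto simp: T_def)
      then show ?thesis using norm_bend[of z] by simp
    qed
    then show "(\<lambda>p. fst p *\<^sub>R bend (snd p)) ` (T \<times> UNIV) \<subseteq> ball 0 16" by auto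
    have "smooth_on (T \<times> UNIV) (\<lambda>p :: real \<times> complex. bend (snd p))"
      by (rule smooth_on_compose[OF oT(2) _ _ smooth_bend])
        (auto intro!: smooth_on_linear[OF oT(2) bounded_linear_snd] smooth_on_id)
    then show "smooth_on (T \<times> UNIV) (\<lambda>p. fst p *\<^sub>R bend (snd p))"
      by (intro smooth_on_scaleR oT smooth_on_linear[OF oT(2) bounded_linear_fst] smooth_on_id)
  qed
  define F where "F t z = H (t, z)" for t z
  have sF: "smooth_on UNIV (F t)" and pF: "periodic2 (F t)" if "t \<in> T" for t
  proof -
    have "smooth_on UNIV (\<lambda>z::complex. (t, z))" by (intro smooth_on_Pair smooth_on_const smooth_on_id) auto
    then show "smooth_on UNIV (F t)" unfolding F_def
      by (rule smooth_on_compose[OF open_UNIV _ _ sH, rotated]) (use that in auto)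
    show "periodic2 (F t)" unfolding periodic2_def F_def H_def by (simp add: bend_periodic[simplified])
  qed
  have "\<exists>B. \<forall>t\<in>{0..1}. \<forall>x\<in>{0..2 * pi}. \<forall>y\<in>{0..2 * pi}. norm ((du ^^ m) ((dv ^^ n) (F t)) (Complex x y)) \<le> B" for m n
  proof -
    define K where "K = ((\<lambda>H p. frechet_derivative H (at p) (0, \<i>)) ^^ n) H"
    have K: "smooth_on (T \<times> UNIV) K" "\<And>t. t \<in> T \<Longrightarrow> (dv ^^ n) (\<lambda>z. H (t, z)) = (\<lambda>z. K (t, z))"
      using parameter_derivatives(2)[OF sH oT(1), of n] by (auto simp: K_def)
    define L where "L = ((\<lambda>H p. frechet_derivative H (at p) (0, 1)) ^^ m) K"
    have L: "smooth_on (T \<times> UNIV) L" "\<And>t. t \<in> T \<Longrightarrow> (du ^^ m) (\<lambda>z. K (t, z)) = (\<lambda>z. L (t, z))"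
      using parameter_derivatives(1)[OF K(1) oT(1), of m] by (auto simp: L_def)
    have "continuous_on ({0..1} \<times> ({0..2 * pi} \<times> {0..2 * pi})) (\<lambda>q. L (fst q, Complex (fst (snd q)) (snd (snd q))))"
      unfolding Complex_eq
      by (intro continuous_on_compose2[OF smooth_on_continuous[OF L(1)]] continuous_intros) (auto simp: T_def)
    then have "bounded ((\<lambda>q. L (fst q, Complex (fst (snd q)) (snd (snd q)))) ` ({0..1} \<times> ({0..2 * pi} \<times> {0..2 * pi})))"
      by (intro compact_imp_bounded compact_continuous_image compact_Times) auto
    then obtain B where B: "\<And>v. v \<in> (\<lambda>q. L (fst q, Complex (fst (snd q)) (snd (snd q)))) ` ({0..1} \<times> ({0..2 * pi} \<times> {0..2 * pi})) \<Longrightarrow> norm v \<le> B"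
      unfolding bounded_iff by blast
    have "norm ((du ^^ m) ((dv ^^ n) (F t)) (Complex x y)) \<le> B"
      if "t \<in> {0..1}" "x \<in> {0..2 * pi}" "y \<in> {0..2 * pi}" for t x y
    proof -
      have tT: "t \<in> T" using that by (auto simp: T_def)
      have "(du ^^ m) ((dv ^^ n) (F t)) (Complex x y) = L (t, Complex x y)"
        unfolding F_def[abs_def] by (simp add: K(2)[OF tT] L(2)[OF tT])
      moreover have "norm (L (t, Complex x y)) \<le> B"
        by (rule B, rule image_eqI[where x = "(t, x, y)"]) (use that in auto)
      ultimately show ?thesis by simp
    qed
    then show ?thesis by blast
  qed
  then obtain b where b: "\<And>m n t x y. t \<in> {0..1} \<Longrightarrow> x \<in> {0..2 * pi} \<Longrightarrow> y \<in> {0..2 * pi} \<Longrightarrow>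
      norm ((du ^^ m) ((dv ^^ n) (F t)) (Complex x y)) \<le> b m n"
    by metis
  define B where "B = \<bar>b 0 0\<bar> + \<bar>b 0 2\<bar> + \<bar>b 2 0\<bar> + \<bar>b 2 2\<bar>"
  have bB: "b m n \<le> B" if "m \<in> {0, 2}" "n \<in> {0, 2}" for m n
    using that by (auto simp: B_def)
  have B0: "0 \<le> B" by (simp add: B_def)
  define C where "C = 4 * B + 1"
  have C: "0 < C" using B0 by (simp add: C_def)
  have dec: "norm (fcoeff2 (F t) k) \<le> C * decay k" if t: "t \<in> {0..1}" for t k
  proof -
    have tT: "t \<in> T" using t by (auto simp: T_def)
    have "(1 + \<bar>of_int (fst k)\<bar> ^ 2) * (1 + \<bar>of_int (snd k)\<bar> ^ 2) * norm (fcoeff2 (F t) k) \<le> 4 * B"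
      by (rule fcoeff2_decay[OF sF[OF tT] pF[OF tT]]) (use order_trans[OF b bB] t in blast)
    then have "norm (fcoeff2 (F t) k) * ((1 + (of_int (fst k))\<^sup>2) * (1 + (of_int (snd k))\<^sup>2)) \<le> C"
      by (simp add: C_def mult_ac)
    moreover have "0 < (1 + (real_of_int (fst k))\<^sup>2) * (1 + (of_int (snd k))\<^sup>2)" by (simp add: add_pos_nonneg)
    moreover have "decay k = inverse ((1 + (of_int (fst k))\<^sup>2) * (1 + (of_int (snd k))\<^sup>2))" by (simp add: decay_def)
    ultimately show ?thesis by (simp only: divide_inverse[symmetric] pos_le_divide_eq)
  qed
  have cd: "(\<lambda>k. C * decay k) summable_on UNIV" by (intro summable_on_cmult_right decay_summable)
  obtain K where K: "finite K" "dist (\<Sum>k\<in>K. C * decay k) (\<Sum>\<^sub>\<infinity>k. C * decay k) \<le> 1/8"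
    using infsum_finite_approximation[OF cd, of "1/8"] by auto
  have tail: "(\<Sum>\<^sub>\<infinity>k\<in>-K. C * decay k) \<le> 1/8"
  proof -
    have "(\<Sum>\<^sub>\<infinity>k. C * decay k) = (\<Sum>\<^sub>\<infinity>k\<in>K \<union> -K. C * decay k)" by simp
    also have "\<dots> = (\<Sum>k\<in>K. C * decay k) + (\<Sum>\<^sub>\<infinity>k\<in>-K. C * decay k)"
      using K(1) by (subst infsum_Un_disjoint) (auto intro: summable_on_subset_banach[OF cd])
    finally show ?thesis using K(2) by (simp add: dist_real_def)
  qed
  define \<eta> where "\<eta> = 1 / (8 * (real (card K) + 1))"
  have eta: "0 < \<eta>" "real (card K) * \<eta> \<le> 1/8" by (auto simp: \<eta>_def field_simps)
  have "isCont \<mu> 0" using smooth_on_continuous[OF mu] by (simp add: continuous_on_eq_continuous_at)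
  then obtain \<delta> where d: "0 < \<delta>" "\<And>w. norm w < \<delta> \<Longrightarrow> norm (\<mu> w) < \<eta>"
    using eta(1) mu0 unfolding continuous_at_eps_delta by (auto simp: dist_norm)
  define t where "t = min 1 (\<delta> / 8)"
  have t: "0 < t" "t \<le> 1" "8 * t \<le> \<delta>" using d(1) by (auto simp: t_def)
  have t01: "t \<in> {0..1}" and tT: "t \<in> T" using t by (auto simp: T_def)
  have small: "norm (fcoeff2 (F t) k) \<le> \<eta>" for k
  proof (rule fcoeff2_bound[OF sF[OF tT]])
    fix x y :: real
    have "t * norm (bend (Complex x y)) < t * 8" using t norm_bend by (intro mult_strict_left_mono) auto
    then have "t * norm (bend (Complex x y)) < \<delta>" using t(3) by linarith
    then have "norm (t *\<^sub>R bend (Complex x y)) < \<delta>" using t(1) by simp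
    from d(2)[OF this] show "norm (F t (Complex x y)) \<le> \<eta>" by (simp add: F_def H_def)
  qed
  have S: "(\<lambda>k. norm (fcoeff2 (F t) k)) summable_on UNIV"
    using rapid_summable[OF rapid_fcoeff2[OF sF[OF tT] pF[OF tT]]] by (simp add: wsummable_def)
  have "wnorm (\<lambda>k. 1) (fcoeff2 (F t)) = (\<Sum>\<^sub>\<infinity>k\<in>K \<union> -K. norm (fcoeff2 (F t) k))" by (simp add: wnorm_def)
  also have "\<dots> = (\<Sum>k\<in>K. norm (fcoeff2 (F t) k)) + (\<Sum>\<^sub>\<infinity>k\<in>-K. norm (fcoeff2 (F t) k))"
    using K(1) by (subst infsum_Un_disjoint) (auto intro: summable_on_subset_banach[OF S])
  also have "\<dots> \<le> real (card K) * \<eta> + (\<Sum>\<^sub>\<infinity>k\<in>-K. C * decay k)"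
    by (intro add_mono sum_bounded_above small infsum_mono dec[OF t01])
      (auto intro: summable_on_subset_banach[OF S] summable_on_subset_banach[OF cd])
  finally have "wnorm (\<lambda>k. 1) (fcoeff2 (F t)) < 1/2" using tail eta(2) by linarith
  moreover have "F t = (\<lambda>z. \<mu> (t *\<^sub>R bend z))" by (simp add: fun_eq_iff F_def H_def)
  ultimately show ?thesis using that t(1,2) sF[OF tT] pF[OF tT] by simp
qed

theorem beltrami_local:
  assumes R: "0 < R" and mu: "smooth_on (ball 0 R) \<mu>" and mu0: "\<mu> 0 = (0 :: complex)"
  obtains r w where "0 < r" "r \<le> R" "smooth_on UNIV w"
    "\<And>z. norm z < r \<Longrightarrow> du w z + \<i> * dv w z = \<mu> z * (du w z - \<i> * dv w z)"
    "\<And>z. du w z - \<i> * dv w z \<noteq> 0"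
proof -
  define s where "s = R / 16"
  have s: "0 < s" using R by (simp add: s_def)
  have "smooth_on (ball 0 16) (\<lambda>z. \<mu> (s *\<^sub>R z))"
  proof (rule smooth_on_compose[where g = "\<lambda>z. s *\<^sub>R z", OF open_ball _ _ mu])
    show "(\<lambda>z. s *\<^sub>R z) ` ball 0 16 \<subseteq> ball (0 :: complex) R"
    proof clarify
      fix z :: complex assume "z \<in> ball 0 16"
      then have "s * norm z < s * 16" using s by (intro mult_strict_left_mono) auto
      then show "s *\<^sub>R z \<in> ball 0 R" using s by (simp add: s_def)
    qed
    show "smooth_on (ball 0 16) (\<lambda>z::complex. s *\<^sub>R z)"
      by (intro smooth_on_linear[OF _ bounded_linear_scaleR_right] smooth_on_id) auto
  qed
  from bent_coefficients_small[OF this] mu0 obtain t where t: "0 < t" "t \<le> 1"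
    and M: "smooth_on UNIV (\<lambda>z. \<mu> (s *\<^sub>R (t *\<^sub>R bend z)))" "periodic2 (\<lambda>z. \<mu> (s *\<^sub>R (t *\<^sub>R bend z)))"
    and small: "wnorm (\<lambda>k. 1) (fcoeff2 (\<lambda>z. \<mu> (s *\<^sub>R (t *\<^sub>R bend z)))) < 1/2"
    by auto
  from beltrami_torus[OF rapid_fcoeff2[OF M] small]
  obtain W where W: "smooth_on UNIV W"
    "\<And>z. du W z + \<i> * dv W z = \<mu> (s *\<^sub>R (t *\<^sub>R bend z)) * (du W z - \<i> * dv W z)"
    "\<And>z. du W z - \<i> * dv W z \<noteq> 0"
    unfolding series_fcoeff2[OF M] by blast
  define r where "r = s * t"
  have r: "0 < r" "r \<le> R"
  proof -
    have "s * t \<le> s * 1" using s t by (intro mult_left_mono) auto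
    then show "0 < r" "r \<le> R" using s t R by (auto simp: r_def s_def)
  qed
  define w where "w z = W (inverse r *\<^sub>R z)" for z
  have fd: "frechet_derivative w (at z) h = inverse r *\<^sub>R frechet_derivative W (at (inverse r *\<^sub>R z)) h" for z h
  proof -
    have 1: "((\<lambda>z. inverse r *\<^sub>R z) has_derivative (\<lambda>h. inverse r *\<^sub>R h)) (at z)"
      by (auto intro!: derivative_eq_intros)
    have 2: "(W has_derivative frechet_derivative W (at (inverse r *\<^sub>R z))) (at (inverse r *\<^sub>R z))"
      using smooth_on_has_derivative[OF W(1)] by simp
    have "frechet_derivative w (at z) = (\<lambda>h. frechet_derivative W (at (inverse r *\<^sub>R z)) (inverse r *\<^sub>R h))"
      unfolding w_def[abs_def] by (rule frechet_derivative_at[OF has_derivative_compose[OF 1 2], symmetric])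
    then show ?thesis using linear_scale[OF has_derivative_linear[OF 2]] by simp
  qed
  have d: "du w z = inverse r *\<^sub>R du W (inverse r *\<^sub>R z)" "dv w z = inverse r *\<^sub>R dv W (inverse r *\<^sub>R z)" for z
    by (simp_all add: du_def dv_def fd)
  have d2: "du w z + \<i> * dv w z = inverse r *\<^sub>R (du W (inverse r *\<^sub>R z) + \<i> * dv W (inverse r *\<^sub>R z))"
    "du w z - \<i> * dv w z = inverse r *\<^sub>R (du W (inverse r *\<^sub>R z) - \<i> * dv W (inverse r *\<^sub>R z))" for z
    by (simp_all add: d scaleR_add_right scaleR_diff_right)
  show ?thesis
  proof (rule that[OF r])
    show "smooth_on UNIV w" unfolding w_def[abs_def]
      by (rule smooth_on_compose[OF open_UNIV _ _ W(1)])
        (auto intro!: smooth_on_linear[OF _ bounded_linear_scaleR_right] smooth_on_id)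
    show "du w z - \<i> * dv w z \<noteq> 0" for z unfolding d2 using W(3) r(1) by simp
    fix z :: complex assume z: "norm z < r"
    have "norm (inverse r *\<^sub>R z) < 1" using z r(1) by (simp add: field_simps)
    moreover have "s * (t * inverse r) = 1" using s t(1) by (simp add: r_def field_simps)
    ultimately have "s *\<^sub>R (t *\<^sub>R bend (inverse r *\<^sub>R z)) = z" by (simp add: bend_eq)
    then show "du w z + \<i> * dv w z = \<mu> z * (du w z - \<i> * dv w z)"
      unfolding d2 W(2) by simp
  qed
qed

section \<open>Unit quaternions and the almost complex structure\<close>

definition qconj :: "quat \<Rightarrow> quat" where
  "qconj x = (fst x, - snd x)"

lemma qmult_assoc: "x *\<^sub>q y *\<^sub>q z = x *\<^sub>q (y *\<^sub>q z)"
  by (simp add: qmult_def prod_eq_iff vec_eq_iff forall_3 cross3_simps inner_vec_def sum_3 algebra_simps)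

lemma bounded_bilinear_qmult: "bounded_bilinear qmult"
proof -
  have "bilinear qmult"
    unfolding bilinear_def
    by (auto intro!: linearI simp: qmult_def prod_eq_iff algebra_simps cross_add_left cross_add_right
        cross_mult_left cross_mult_right inner_add_left inner_add_right)
  then show ?thesis by (simp add: bilinear_conv_bounded_bilinear)
qed

interpretation qm: bounded_bilinear qmult by (rule bounded_bilinear_qmult)

lemma bounded_linear_qconj: "bounded_linear qconj"
  unfolding qconj_def[abs_def]
  by (intro bounded_linear_Pair bounded_linear_fst bounded_linear_minus bounded_linear_snd)

lemma qinv_unit: "x \<in> S3 \<Longrightarrow> qinv x = qconj x"
  by (simp add: S3_def qinv_def qconj_def)

lemma qmult_one [simp]: "(1, 0) *\<^sub>q x = x" "x *\<^sub>q (1, 0) = x"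
  by (simp_all add: qmult_def)

lemma S3_norm: "x \<in> S3 \<Longrightarrow> (fst x)\<^sup>2 + snd x \<bullet> snd x = 1"
  by (simp add: S3_def norm_eq_1 inner_prod_def power2_eq_square)

lemma qmult_qconj: "x \<in> S3 \<Longrightarrow> x *\<^sub>q qconj x = (1, 0)" "x \<in> S3 \<Longrightarrow> qconj x *\<^sub>q x = (1, 0)"
  using S3_norm[of x] by (simp_all add: qmult_def qconj_def prod_eq_iff power2_eq_square)

lemma nkJ_eq: "nkJ x X = (1 / sqrt 3) *\<^sub>R (2 *\<^sub>R (fst x *\<^sub>q qinv (snd x) *\<^sub>q snd X) - fst X,
    (-2) *\<^sub>R (snd x *\<^sub>q qinv (fst x) *\<^sub>q fst X) + snd X)"
  by (metis nkJ.simps prod.collapse)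

lemma nkJ_unit:
  assumes "x \<in> S3 \<times> S3"
  shows "nkJ x X = (1 / sqrt 3) *\<^sub>R (2 *\<^sub>R (fst x *\<^sub>q qconj (snd x) *\<^sub>q snd X) - fst X,
    (-2) *\<^sub>R (snd x *\<^sub>q qconj (fst x) *\<^sub>q fst X) + snd X)"
  using assms by (simp add: nkJ_eq qinv_unit mem_Times_iff)

lemma linear_nkJ: "linear (nkJ x)"
  unfolding nkJ_eq[abs_def]
  by (intro linear_compose_scale_right linearI) (simp_all only: fst_add snd_add fst_scaleR snd_scaleR qm.add_right qm.scaleR_right
      scaleR_Pair add_Pair scaleR_add_right scaleR_diff_right, simp_all add: algebra_simps)

lemmas nkJ_linear = linear_add[OF linear_nkJ] linear_scale[OF linear_nkJ]

lemma nkJ_nkJ: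
  assumes "x \<in> S3 \<times> S3" shows "nkJ x (nkJ x X) = - X"
proof -
  obtain p q U V where e: "x = (p, q)" "X = (U, V)" by (metis surj_pair)
  have S: "p \<in> S3" "q \<in> S3" using assms e by auto
  define a b where "a = p *\<^sub>q qconj q" and "b = q *\<^sub>q qconj p"
  have ab: "a *\<^sub>q (b *\<^sub>q y) = y" "b *\<^sub>q (a *\<^sub>q y) = y" for y
  proof -
    have "a *\<^sub>q b = p *\<^sub>q ((qconj q *\<^sub>q q) *\<^sub>q qconj p)" "b *\<^sub>q a = q *\<^sub>q ((qconj p *\<^sub>q p) *\<^sub>q qconj q)"
      by (simp_all only: a_def b_def qmult_assoc)
    then have "a *\<^sub>q b = (1, 0)" "b *\<^sub>q a = (1, 0)" using S by (simp_all add: qmult_qconj)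
    then show "a *\<^sub>q (b *\<^sub>q y) = y" "b *\<^sub>q (a *\<^sub>q y) = y" by (simp_all flip: qmult_assoc)
  qed
  define r where "r = 1 / sqrt 3"
  have rr: "r * r = 1/3" by (simp add: r_def)
  have J: "nkJ x (U, V) = (r *\<^sub>R (2 *\<^sub>R (a *\<^sub>q V) - U), r *\<^sub>R ((-2) *\<^sub>R (b *\<^sub>q U) + V))" for U V
    using nkJ_unit[OF assms, of "(U, V)"] by (simp add: e(1) a_def b_def r_def)
  have "nkJ x (nkJ x X) = ((r * r) *\<^sub>R (- 3 *\<^sub>R U), (r * r) *\<^sub>R (- 3 *\<^sub>R V))"
    unfolding e(2) J
    by (simp add: qm.scaleR_right qm.diff_right qm.add_right ab prod_eq_iff algebra_simps flip: scaleR_left_distrib)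
  then show ?thesis unfolding rr by (simp add: e(2))
qed

lemma smooth_nkJ:
  fixes f X :: "'a::euclidean_space \<Rightarrow> quat2"
  assumes "open S" "smooth_on S f" "smooth_on S X" "\<And>z. z \<in> S \<Longrightarrow> f z \<in> S3 \<times> S3"
  shows "smooth_on S (\<lambda>z. nkJ (f z) (X z))"
proof (rule smooth_on_cong[OF assms(1)])
  show "(1 / sqrt 3) *\<^sub>R (2 *\<^sub>R (fst (f z) *\<^sub>q qconj (snd (f z)) *\<^sub>q snd (X z)) - fst (X z),
    (-2) *\<^sub>R (snd (f z) *\<^sub>q qconj (fst (f z)) *\<^sub>q fst (X z)) + snd (X z)) = nkJ (f z) (X z)" if "z \<in> S" for z
    using nkJ_unit[OF assms(4)[OF that]] by simp
  note q = smooth_on_bilinear[OF assms(1) bounded_bilinear_qmult] and fs = smooth_on_linear[OF assms(1) bounded_linear_fst]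
    and sn = smooth_on_linear[OF assms(1) bounded_linear_snd] and cj = smooth_on_linear[OF assms(1) bounded_linear_qconj]
    and sc = smooth_on_linear[OF assms(1) bounded_linear_scaleR_right]
  show "smooth_on S (\<lambda>z. (1 / sqrt 3) *\<^sub>R (2 *\<^sub>R (fst (f z) *\<^sub>q qconj (snd (f z)) *\<^sub>q snd (X z)) - fst (X z),
    (-2) *\<^sub>R (snd (f z) *\<^sub>q qconj (fst (f z)) *\<^sub>q fst (X z)) + snd (X z)))"
    by (intro sc smooth_on_Pair assms(1) smooth_on_diff smooth_on_add q)
      (intro fs sn cj assms(2,3))+
qed

section \<open>Smooth local inverses in the plane\<close>

text \<open>Bootstrapping: the derivative of \<open>g\<close> is a smooth function of \<open>g\<close>, hence as often differentiable as \<open>g\<close>.\<close>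

lemma smooth_on_inverse_map:
  fixes g :: "'a::euclidean_space \<Rightarrow> 'b::euclidean_space"
  assumes "open V" "\<And>y. y \<in> V \<Longrightarrow> (g has_derivative (\<lambda>k. G k (g y))) (at y)"
    "\<And>k. smooth_on T (G k)" "g ` V \<subseteq> T"
  shows "smooth_on V g"
  unfolding smooth_on_def
proof
  fix n show "Ck_on n V g"
  proof (induction n)
    case 0
    have "isCont g y" if "y \<in> V" for y using assms(2)[OF that] by (rule has_derivative_continuous)
    then show ?case by (auto intro: continuous_at_imp_continuous_on)
  next
    case (Suc n)
    show ?case
    proof (rule Ck_on_SucI[OF assms(1,2)])
      fix k show "Ck_on n V (\<lambda>y. G k (g y))"
        by (rule Ck_on_compose[OF assms(1,4) Suc]) (use assms(3) in \<open>simp add: smooth_on_def\<close>)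
    qed
  qed
qed

lemma derivative_eq_du_dv:
  fixes f :: "complex \<Rightarrow> 'a::real_normed_vector"
  assumes "(f has_derivative frechet_derivative f (at z)) (at z)"
  shows "frechet_derivative f (at z) h = Re h *\<^sub>R du f z + Im h *\<^sub>R dv f z"
proof -
  have l: "linear (frechet_derivative f (at z))" using has_derivative_linear[OF assms] .
  have "h = Re h *\<^sub>R 1 + Im h *\<^sub>R \<i>" by (simp add: complex_eq_iff)
  then have "frechet_derivative f (at z) h = frechet_derivative f (at z) (Re h *\<^sub>R 1 + Im h *\<^sub>R \<i>)" by simp
  then show ?thesis by (simp only: linear_add[OF l] linear_scale[OF l] du_def dv_def)
qed

text \<open>The hypothesis on the derivatives says that the differential of \<open>w\<close> at the origin is multiplication
  by the nonzero complex number \<open>du w 0\<close>.\<close>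

lemma smooth_local_inverse:
  fixes w :: "complex \<Rightarrow> complex"
  assumes w: "smooth_on UNIV w" and W: "open W" "0 \<in> W" and d0: "du w 0 \<noteq> 0" "dv w 0 = \<i> * du w 0"
  obtains U V g where "open U" "0 \<in> U" "U \<subseteq> W" "open V" "homeomorphism U V w g" "smooth_on V g"
    "\<And>y k. y \<in> V \<Longrightarrow> frechet_derivative w (at (g y)) (frechet_derivative g (at y) k) = k"
proof -
  have dw: "(w has_derivative frechet_derivative w (at z)) (at z)" for z
    using smooth_on_has_derivative[OF w] by simp
  note bl = has_derivative_bounded_linear[OF dw]
  define f' where "f' z = Blinfun (frechet_derivative w (at z))" for z
  have f': "blinfun_apply (f' z) = frechet_derivative w (at z)" for z
    unfolding f'_def by (rule bounded_linear_Blinfun_apply[OF bl])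
  have cf: "continuous_on W f'"
    by (rule continuous_on_blinfun_componentwise)
      (auto simp: f' intro!: smooth_on_continuous smooth_on_derivative smooth_on_subset[OF w])
  have inj0: "inj (frechet_derivative w (at 0))"
  proof -
    have "frechet_derivative w (at 0) h = du w 0 * h" for h
      using d0(2) derivative_eq_du_dv[OF dw] by (simp add: scaleR_conv_of_real complex_eq_iff algebra_simps)
    then show ?thesis using d0(1) by (auto intro: injI)
  qed
  obtain l where l: "linear l" "l \<circ> frechet_derivative w (at 0) = id"
    using linear_injective_left_inverse[OF has_derivative_linear[OF dw] inj0] by blast
  have l': "blinfun_apply (Blinfun l) = l"
    using l(1) by (simp add: bounded_linear_Blinfun_apply linear_conv_bounded_linear)
  have "Blinfun l o\<^sub>L f' 0 = id_blinfun"
    using l(2) by (intro blinfun_eqI) (simp add: l' f' fun_eq_iff)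
  from inverse_function_theorem[OF W(1) _ cf W(2) this, of w] dw
  obtain U V g g' where UV: "open U" "U \<subseteq> W" "0 \<in> U" "open V" "homeomorphism U V w g"
    and g': "\<And>y. y \<in> V \<Longrightarrow> (g has_derivative g' y) (at y)"
      "\<And>y. y \<in> V \<Longrightarrow> g' y = inv (frechet_derivative w (at (g y)))"
      "\<And>y. y \<in> V \<Longrightarrow> bij (frechet_derivative w (at (g y)))"
    unfolding f' by (metis (no_types))
  \<comment> \<open>\<open>D\<close> is the Jacobian determinant of \<open>w\<close>, and \<open>\<lambda>k. G k z\<close> is the inverse of its differential by Cramer's rule\<close>
  define D where "D z = Im (cnj (du w z) * dv w z)" for z
  define T where "T = {z. D z \<noteq> 0}"
  define G where "G k z = Complex (- Im (cnj (dv w z) * k) / D z) (Im (cnj (du w z) * k) / D z)" for k z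
  have sD: "smooth_on UNIV D"
    unfolding D_def[abs_def]
    by (intro smooth_on_linear[OF _ bounded_linear_Im] smooth_on_mult smooth_on_linear[OF _ bounded_linear_cnj] smooth_du smooth_dv w) auto
  have oT: "open T"
    unfolding T_def by (intro open_Collect_neq smooth_on_continuous[OF sD] continuous_on_const)
  have sG: "smooth_on T (G k)" for k
    unfolding G_def[abs_def] Complex_eq
    by (intro smooth_on_add smooth_on_mult smooth_on_const smooth_on_linear[OF _ bounded_linear_of_real] smooth_on_divide
        smooth_on_minus smooth_on_linear[OF _ bounded_linear_Im] smooth_on_linear[OF _ bounded_linear_cnj] oT
        smooth_on_subset[OF sD] smooth_on_subset[OF smooth_du[OF w]] smooth_on_subset[OF smooth_dv[OF w]])
      (auto simp: T_def)
  have inD: "D z \<noteq> 0" if "inj (frechet_derivative w (at z))" for z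
  proof
    assume D0: "D z = 0"
    define A B where "A = du w z" and "B = dv w z"
    have L: "frechet_derivative w (at z) h = Re h *\<^sub>R A + Im h *\<^sub>R B" for h
      unfolding A_def B_def by (rule derivative_eq_du_dv[OF dw])
    have AB: "Re A * Im B = Im A * Re B" using D0 by (simp add: D_def A_def B_def)
    have "Re B * Im A - Re A * Im B = 0" "Im B * Re A - Im A * Re B = 0" using AB by algebra+
    then have "frechet_derivative w (at z) (Complex (Re B) (- Re A)) = 0" "frechet_derivative w (at z) (Complex (Im B) (- Im A)) = 0"
      unfolding L complex_eq_iff by simp_all
    moreover have ker: "h = 0" if "frechet_derivative w (at z) h = 0" for h
    proof (rule injD[OF \<open>inj (frechet_derivative w (at z))\<close>])
      show "frechet_derivative w (at z) h = frechet_derivative w (at z) 0"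
        using that linear_0[OF has_derivative_linear[OF dw]] by simp
    qed
    ultimately have "Complex (Re B) (- Re A) = 0" "Complex (Im B) (- Im A) = 0" by blast+
    then have "A = 0" "B = 0" by (auto simp: complex_eq_iff)
    have "(1::complex) = 0" by (rule ker) (simp add: L \<open>A = 0\<close> \<open>B = 0\<close>)
    then show False by simp
  qed
  have LG: "frechet_derivative w (at z) (G k z) = k" if "D z \<noteq> 0" for z k
  proof -
    define A B where "A = du w z" and "B = dv w z"
    have Dz: "D z = Re A * Im B - Im A * Re B" by (simp add: D_def A_def B_def)
    have "(- Im (cnj B * k) * Re A + Im (cnj A * k) * Re B) = D z * Re k"
      "(- Im (cnj B * k) * Im A + Im (cnj A * k) * Im B) = D z * Im k"
      unfolding Dz by (simp_all add: algebra_simps)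
    then have "(- Im (cnj B * k) * Re A + Im (cnj A * k) * Re B) / D z = Re k"
      "(- Im (cnj B * k) * Im A + Im (cnj A * k) * Im B) / D z = Im k"
      using that by simp_all
    then show ?thesis
      unfolding derivative_eq_du_dv[OF dw] G_def A_def[symmetric] B_def[symmetric]
      by (simp add: complex_eq_iff add_divide_distrib)
  qed
  have gG: "(g has_derivative (\<lambda>k. G k (g y))) (at y)" and gT: "g y \<in> T" if "y \<in> V" for y
  proof -
    have bij: "bij (frechet_derivative w (at (g y)))" by (rule g'(3)[OF that])
    show gT: "g y \<in> T" using inD[OF bij_is_inj[OF bij]] by (simp add: T_def)
    have "g' y k = G k (g y)" for k
      unfolding g'(2)[OF that] by (rule inv_f_eq[OF bij_is_inj[OF bij]]) (use LG gT in \<open>simp add: T_def\<close>)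
    then have "g' y = (\<lambda>k. G k (g y))" by (rule ext)
    then show "(g has_derivative (\<lambda>k. G k (g y))) (at y)" using g'(1)[OF that] by simp
  qed
  have sg: "smooth_on V g"
    by (rule smooth_on_inverse_map[OF UV(4) gG sG]) (use gT in auto)
  have "frechet_derivative w (at (g y)) (frechet_derivative g (at y) k) = k" if "y \<in> V" for y k
  proof -
    have "frechet_derivative g (at y) = (\<lambda>k. G k (g y))" by (rule frechet_derivative_at[OF gG[OF that], symmetric])
    then show ?thesis using LG gT[OF that] by (simp add: T_def)
  qed
  then show ?thesis using that UV sg by blast
qed

section \<open>Local isothermal coordinates\<close>

text \<open>Write \<open>J f_u = a f_u + b f_v\<close>.  A function \<open>w\<close> has a differential that carries \<open>J\<close> to
  multiplication by \<open>\<i>\<close> if and only if \<open>a w_u + b w_v = \<i> w_u\<close>, and this is the Beltrami equation with coefficient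
  \<open>\<mu> = (b - 1 - \<i> a) / (b + 1 + \<i> a)\<close>.  The normalization \<open>J f_u = f_v\<close> at the origin means \<open>\<mu> 0 = 0\<close>.\<close>

lemma local_isothermal_normalized:
  fixes f :: "complex \<Rightarrow> quat2"
  assumes R: "0 < R" and f: "smooth_on (ball 0 R) f" and S: "\<And>z. z \<in> ball 0 R \<Longrightarrow> f z \<in> S3 \<times> S3"
    and inj: "\<And>z. z \<in> ball 0 R \<Longrightarrow> inj (frechet_derivative f (at z))"
    and J: "\<And>z. z \<in> ball 0 R \<Longrightarrow> nkJ (f z) (du f z) \<in> range (frechet_derivative f (at z))"
    and J0: "nkJ (f 0) (du f 0) = dv f 0"
  obtains U V H G where "open U" "0 \<in> U" "U \<subseteq> ball 0 R" "open V" "homeomorphism U V H G"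
    "smooth_on U H" "smooth_on V G" "\<And>y. y \<in> V \<Longrightarrow> nkJ (f (G y)) (du (f \<circ> G) y) = dv (f \<circ> G) y"
proof -
  have z0: "0 \<in> ball 0 R" using R by simp
  have df: "(f has_derivative frechet_derivative f (at z)) (at z)" if "z \<in> ball 0 R" for z
    by (rule smooth_on_has_derivative[OF f that])
  define X Y Z where "X z = du f z" and "Y z = dv f z" and "Z z = nkJ (f z) (X z)" for z
  have DF: "frechet_derivative f (at z) h = Re h *\<^sub>R X z + Im h *\<^sub>R Y z" if "z \<in> ball 0 R" for z h
    unfolding X_def Y_def by (rule derivative_eq_du_dv[OF df[OF that]])
  have sX: "smooth_on (ball 0 R) X" unfolding X_def[abs_def] by (rule smooth_du[OF f])
  have sY: "smooth_on (ball 0 R) Y" unfolding Y_def[abs_def] by (rule smooth_dv[OF f])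
  have sZ: "smooth_on (ball 0 R) Z" unfolding Z_def[abs_def] by (rule smooth_nkJ[OF open_ball f sX S])
  \<comment> \<open>the coefficients \<open>a\<close> and \<open>b\<close> are given by inner products, with the Gram determinant \<open>D\<close>, so they are smooth\<close>
  define D where "D z = (X z \<bullet> X z) * (Y z \<bullet> Y z) - (X z \<bullet> Y z) * (X z \<bullet> Y z)" for z
  define a where "a z = ((Z z \<bullet> X z) * (Y z \<bullet> Y z) - (Z z \<bullet> Y z) * (X z \<bullet> Y z)) / D z" for z
  define b where "b z = ((Z z \<bullet> Y z) * (X z \<bullet> X z) - (Z z \<bullet> X z) * (X z \<bullet> Y z)) / D z" for z
  have ker: "h = 0" if "z \<in> ball 0 R" "Re h *\<^sub>R X z + Im h *\<^sub>R Y z = 0" for z h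
    using linear_injective_0[OF has_derivative_linear[OF df[OF that(1)]]] inj[OF that(1)] that DF by metis
  have D0: "D z \<noteq> 0" if z: "z \<in> ball 0 R" for z
  proof
    assume "D z = 0"
    define v where "v = (Y z \<bullet> Y z) *\<^sub>R X z - (X z \<bullet> Y z) *\<^sub>R Y z"
    have "v \<bullet> v = (Y z \<bullet> Y z) * D z"
      by (simp add: v_def D_def inner_diff_left inner_diff_right inner_commute algebra_simps)
    then have "v = 0" using \<open>D z = 0\<close> by simp
    have "Complex (Y z \<bullet> Y z) (- (X z \<bullet> Y z)) = 0"
      by (rule ker[OF z]) (use \<open>v = 0\<close> in \<open>simp add: v_def\<close>)
    then have "Y z = 0" by (simp add: complex_eq_iff)
    have "\<i> = 0" by (rule ker[OF z]) (simp add: \<open>Y z = 0\<close>)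
    then show False by simp
  qed
  have lin: "Z z = a z *\<^sub>R X z + b z *\<^sub>R Y z" if z: "z \<in> ball 0 R" for z
  proof -
    obtain h where h: "Z z = Re h *\<^sub>R X z + Im h *\<^sub>R Y z" using J[OF z] DF[OF z] by (auto simp: Z_def X_def)
    have "(Z z \<bullet> X z) * (Y z \<bullet> Y z) - (Z z \<bullet> Y z) * (X z \<bullet> Y z) = Re h * D z"
      "(Z z \<bullet> Y z) * (X z \<bullet> X z) - (Z z \<bullet> X z) * (X z \<bullet> Y z) = Im h * D z"
      unfolding h by (simp_all add: D_def inner_add_left inner_commute algebra_simps)
    then show ?thesis unfolding a_def b_def using D0[OF z] by (simp add: h)
  qed
  have b0: "b z \<noteq> 0" if z: "z \<in> ball 0 R" for z
  proof
    assume "b z = 0"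
    then have e: "Z z = a z *\<^sub>R X z" using lin[OF z] by simp
    have "- X z = nkJ (f z) (Z z)" using nkJ_nkJ[OF S[OF z]] by (simp add: Z_def)
    also have "\<dots> = (a z * a z) *\<^sub>R X z" unfolding e by (simp add: nkJ_linear Z_def[symmetric] e)
    finally have "(a z * a z + 1) *\<^sub>R X z = 0" unfolding scaleR_left_distrib by (metis add.left_inverse scaleR_one)
    moreover have "a z * a z + 1 \<noteq> 0" using zero_le_square[of "a z"] by linarith
    ultimately have "X z = 0" by simp
    have "(1::complex) = 0" by (rule ker[OF z]) (simp add: \<open>X z = 0\<close>)
    then show False by simp
  qed
  have sD: "smooth_on (ball 0 R) D"
    unfolding D_def[abs_def] by (intro smooth_on_diff smooth_on_mult smooth_on_inner sX sY open_ball)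
  have sa: "smooth_on (ball 0 R) a" unfolding a_def[abs_def]
    by (rule smooth_on_divide[OF open_ball _ sD D0]) (intro smooth_on_diff smooth_on_mult smooth_on_inner sX sY sZ open_ball)
  have sb: "smooth_on (ball 0 R) b" unfolding b_def[abs_def]
    by (rule smooth_on_divide[OF open_ball _ sD D0]) (intro smooth_on_diff smooth_on_mult smooth_on_inner sX sY sZ open_ball)
  have ab0: "a 0 = 0" "b 0 = 1"
  proof -
    have *: "(a 0) *\<^sub>R X 0 + (b 0 - 1) *\<^sub>R Y 0 = 0" using lin[OF z0] J0 by (simp add: Z_def X_def Y_def algebra_simps)
    have "Complex (a 0) (b 0 - 1) = 0" by (rule ker[OF z0]) (simp add: *)
    then show "a 0 = 0" "b 0 = 1" by (auto simp: complex_eq_iff)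
  qed
  define den num where "den z = Complex (b z + 1) (a z)" and "num z = Complex (b z - 1) (- a z)" for z
  have sden: "smooth_on (ball 0 R) den" "smooth_on (ball 0 R) num"
    unfolding den_def[abs_def] num_def[abs_def] Complex_eq
    by (intro smooth_on_add smooth_on_diff smooth_on_minus smooth_on_mult smooth_on_const smooth_on_linear[OF _ bounded_linear_of_real] sa sb open_ball)+
  have "open (ball 0 R \<inter> den -` (- {0}))"
    by (rule continuous_open_preimage[OF smooth_on_continuous[OF sden(1)]]) auto
  moreover have "0 \<in> ball 0 R \<inter> den -` (- {0})" using R ab0 by (simp add: den_def complex_eq_iff)
  ultimately obtain r0 where r0: "0 < r0" "ball 0 r0 \<subseteq> ball 0 R \<inter> den -` (- {0})"
    by (meson open_contains_ball)
  define \<mu> where "\<mu> z = num z / den z" for z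
  have smu: "smooth_on (ball 0 r0) \<mu>" unfolding \<mu>_def[abs_def]
    by (rule smooth_on_divide[OF open_ball smooth_on_subset[OF sden(2)] smooth_on_subset[OF sden(1)]]) (use r0 in auto)
  have "num 0 = 0" using ab0 by (simp add: num_def complex_eq_iff)
  then have mu0: "\<mu> 0 = 0" by (simp add: \<mu>_def)
  from beltrami_local[OF r0(1) smu mu0] obtain r w where r: "0 < r" "r \<le> r0" and w: "smooth_on UNIV w"
    and bel: "\<And>z. norm z < r \<Longrightarrow> du w z + \<i> * dv w z = \<mu> z * (du w z - \<i> * dv w z)"
    and ne: "\<And>z. du w z - \<i> * dv w z \<noteq> 0" by blast
  have rel: "of_real (a z) * du w z + of_real (b z) * dv w z = \<i> * du w z" if "norm z < r" for z
  proof -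
    have "z \<in> ball 0 r0" using r(2) that by simp
    then have "den z \<noteq> 0" using r0(2) by blast
    then have "den z * (du w z + \<i> * dv w z) = num z * (du w z - \<i> * dv w z)"
      unfolding bel[OF that] by (simp add: \<mu>_def)
    then show ?thesis
      unfolding den_def num_def by (simp add: complex_eq_iff algebra_simps)
  qed
  have eq0: "du w 0 = - (\<i> * dv w 0)" using bel[of 0] r mu0 by (simp add: add_eq_0_iff)
  then have i0: "dv w 0 = \<i> * du w 0" by simp
  have "du w 0 \<noteq> 0" using ne[of 0] eq0 by auto
  from smooth_local_inverse[OF w open_ball _ this i0, of 0 r] r(1)
  obtain U V g where U: "open U" "0 \<in> U" "U \<subseteq> ball 0 r" and V: "open V" "homeomorphism U V w g"
    and g: "smooth_on V g"
    and inv: "\<And>y k. y \<in> V \<Longrightarrow> frechet_derivative w (at (g y)) (frechet_derivative g (at y) k) = k" by auto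
  have iso: "nkJ (f (g y)) (du (f \<circ> g) y) = dv (f \<circ> g) y" if y: "y \<in> V" for y
  proof -
    have gU: "g y \<in> U" using V(2) y by (auto simp: homeomorphism_def)
    then have gr: "norm (g y) < r" using U(3) by auto
    then have "g y \<in> ball 0 r0" using r(2) by simp
    then have gR: "g y \<in> ball 0 R" using r0(2) by blast
    define h1 h2 where "h1 = frechet_derivative g (at y) 1" and "h2 = frechet_derivative g (at y) \<i>"
    have D: "frechet_derivative (f \<circ> g) (at y) = (\<lambda>k. frechet_derivative f (at (g y)) (frechet_derivative g (at y) k))"
      unfolding o_def by (rule frechet_derivative_at[OF has_derivative_compose[OF smooth_on_has_derivative[OF g y] df[OF gR]], symmetric])
    define z where "z = g y"
    define A B where "A = du w z" and "B = dv w z"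
    have Dw: "frechet_derivative w (at z) h = of_real (Re h) * A + of_real (Im h) * B" for h
      unfolding A_def B_def using derivative_eq_du_dv[OF smooth_on_has_derivative[OF w]] by (simp add: scaleR_conv_of_real)
    have 1: "of_real (Re h1) * A + of_real (Im h1) * B = 1" and 2: "of_real (Re h2) * A + of_real (Im h2) * B = \<i>"
      using inv[OF y, of 1] inv[OF y, of \<i>] unfolding z_def[symmetric] Dw h1_def h2_def by simp_all
    \<comment> \<open>in the basis \<open>1, a + \<i> b\<close> of the plane, on which \<open>J\<close> acts as a rotation, \<open>h1\<close> has the coefficients \<open>s, t\<close> and \<open>h3 = J h1\<close>\<close>
    define t where "t = Im h1 / b z"
    define s where "s = Re h1 - t * a z"
    have bz: "b z \<noteq> 0" using b0[OF gR] by (simp add: z_def)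
    have h1: "Re h1 = s + t * a z" "Im h1 = t * b z" using bz by (simp_all add: s_def t_def)
    have rl: "of_real (a z) * A + of_real (b z) * B = \<i> * A" using rel[OF gr] by (simp add: A_def B_def z_def)
    have sA: "(of_real s + \<i> * of_real t) * A = 1"
    proof -
      have "(of_real s + \<i> * of_real t) * A = of_real s * A + of_real t * (\<i> * A)" by (simp add: algebra_simps)
      also have "\<dots> = of_real (Re h1) * A + of_real (Im h1) * B" unfolding rl[symmetric] h1 by (simp add: algebra_simps)
      finally show ?thesis using 1 by simp
    qed
    define h3 where "h3 = Complex (s * a z - t) (s * b z)"
    have "of_real (Re h3) * A + of_real (Im h3) * B = of_real s * (of_real (a z) * A + of_real (b z) * B) - of_real t * A"
      by (simp add: h3_def algebra_simps)
    also have "\<dots> = \<i> * ((of_real s + \<i> * of_real t) * A)" unfolding rl by (simp add: algebra_simps)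
    finally have 3: "of_real (Re h3) * A + of_real (Im h3) * B = \<i>" unfolding sA by simp
    have "A \<noteq> 0" using sA by auto
    have "h3 = h2"
    proof -
      define e where "e = h3 - h2"
      have "of_real (Re e) * A + of_real (Im e) * B = 0" using 2 3 by (simp add: e_def algebra_simps)
      then have "of_real (b z) * (of_real (Re e) * A + of_real (Im e) * B) = 0" by simp
      then have "of_real (Re e) * (of_real (b z) * A) + of_real (Im e) * (\<i> * A - of_real (a z) * A) = 0"
        unfolding rl[symmetric] by (simp add: algebra_simps)
      then have "(of_real (Re e * b z - Im e * a z) + \<i> * of_real (Im e)) * A = 0" by (simp add: algebra_simps)
      then have "of_real (Re e * b z - Im e * a z) + \<i> * of_real (Im e) = 0" using \<open>A \<noteq> 0\<close> by simp
      then have "Re e * b z - Im e * a z = 0" "Im e = 0" by (simp_all add: complex_eq_iff)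
      then have "e = 0" using bz by (simp add: complex_eq_iff)
      then show ?thesis by (simp add: e_def)
    qed
    define W where "W = a z *\<^sub>R X z + b z *\<^sub>R Y z"
    have JX: "nkJ (f z) (X z) = W" using lin[OF gR] by (simp add: Z_def z_def W_def)
    have JJ: "nkJ (f z) W = - X z"
      unfolding JX[symmetric] using nkJ_nkJ[OF S[OF gR]] by (simp add: z_def)
    have "du (f \<circ> g) y = Re h1 *\<^sub>R X z + Im h1 *\<^sub>R Y z"
      unfolding du_def D z_def h1_def by (rule DF[OF gR])
    also have "\<dots> = s *\<^sub>R X z + t *\<^sub>R W" unfolding h1 W_def by (simp add: algebra_simps)
    finally have "nkJ (f z) (du (f \<circ> g) y) = s *\<^sub>R W + t *\<^sub>R (- X z)"
      by (simp only: nkJ_linear JX JJ)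
    also have "\<dots> = s *\<^sub>R (a z *\<^sub>R X z + b z *\<^sub>R Y z) - t *\<^sub>R X z" by (simp add: W_def)
    also have "\<dots> = Re h3 *\<^sub>R X z + Im h3 *\<^sub>R Y z" by (simp add: h3_def algebra_simps)
    also have "\<dots> = dv (f \<circ> g) y"
      unfolding \<open>h3 = h2\<close> dv_def D z_def h2_def by (rule DF[OF gR, symmetric])
    finally show ?thesis by (simp add: z_def)
  qed
  have "ball 0 r \<subseteq> ball (0::complex) r0" using r(2) by (rule subset_ball)
  then have "U \<subseteq> ball 0 R" using U(3) r0(2) by blast
  then show ?thesis using that[OF U(1,2) _ V smooth_on_subset[OF w] g iso] by blast
qed

text \<open>A linear change of coordinates that sends \<open>\<i>\<close> to \<open>\<kappa>\<close>, where \<open>J f_u\<close> is the derivative of \<open>f\<close> at \<open>z0\<close> in the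
  direction \<open>\<kappa>\<close>, achieves the normalization.\<close>

lemma local_isothermal:
  fixes f :: "complex \<Rightarrow> quat2"
  assumes Om: "open \<Omega>" "z0 \<in> \<Omega>" and f: "smooth_on \<Omega> f" and S: "\<And>z. z \<in> \<Omega> \<Longrightarrow> f z \<in> S3 \<times> S3"
    and inj: "\<And>z. z \<in> \<Omega> \<Longrightarrow> inj (frechet_derivative f (at z))"
    and J: "\<And>z. z \<in> \<Omega> \<Longrightarrow> nkJ (f z) ` range (frechet_derivative f (at z)) \<subseteq> range (frechet_derivative f (at z))"
  obtains U V H G where "open U" "z0 \<in> U" "U \<subseteq> \<Omega>" "open V" "homeomorphism U V H G"
    "smooth_on U H" "smooth_on V G" "\<And>y. y \<in> V \<Longrightarrow> nkJ (f (G y)) (du (f \<circ> G) y) = dv (f \<circ> G) y"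
proof -
  have df: "(f has_derivative frechet_derivative f (at z)) (at z)" if "z \<in> \<Omega>" for z
    by (rule smooth_on_has_derivative[OF f that])
  obtain \<kappa> where k: "nkJ (f z0) (du f z0) = frechet_derivative f (at z0) \<kappa>"
    using J[OF Om(2)] unfolding du_def by blast
  have lk: "linear (frechet_derivative f (at z0))" using has_derivative_linear[OF df[OF Om(2)]] .
  have kim: "Im \<kappa> \<noteq> 0"
  proof
    assume "Im \<kappa> = 0"
    then have e: "nkJ (f z0) (du f z0) = Re \<kappa> *\<^sub>R du f z0"
      using derivative_eq_du_dv[OF df[OF Om(2)], of \<kappa>] k by simp
    have "- du f z0 = nkJ (f z0) (nkJ (f z0) (du f z0))" using nkJ_nkJ[OF S[OF Om(2)]] by simp
    also have "\<dots> = (Re \<kappa> * Re \<kappa>) *\<^sub>R du f z0" by (simp only: e nkJ_linear scaleR_scaleR)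
    finally have "- du f z0 = (Re \<kappa> * Re \<kappa>) *\<^sub>R du f z0" .
    then have "(Re \<kappa> * Re \<kappa> + 1) *\<^sub>R du f z0 = 0" unfolding scaleR_left_distrib by (metis add.left_inverse scaleR_one)
    moreover have "Re \<kappa> * Re \<kappa> + 1 \<noteq> 0" using zero_le_square[of "Re \<kappa>"] by linarith
    ultimately have "frechet_derivative f (at z0) 1 = frechet_derivative f (at z0) 0"
      using linear_0[OF lk] by (simp add: du_def)
    then have "(1::complex) = 0" by (rule injD[OF inj[OF Om(2)]])
    then show False by simp
  qed
  define l where "l h = of_real (Re h) + of_real (Im h) * \<kappa>" for h
  define l' where "l' h = Complex (Re h - Im h / Im \<kappa> * Re \<kappa>) (Im h / Im \<kappa>)" for h
  have ll: "l (l' h) = h" "l' (l h) = h" for h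
    using kim by (simp_all add: l_def l'_def complex_eq_iff)
  have bl: "bounded_linear l" unfolding l_def[abs_def] linear_conv_bounded_linear[symmetric]
    by (intro linearI) (simp_all add: algebra_simps complex_eq_iff)
  have bl': "bounded_linear l'" unfolding l'_def[abs_def] linear_conv_bounded_linear[symmetric]
    by (intro linearI) (simp_all add: algebra_simps complex_eq_iff add_divide_distrib)
  define L where "L h = z0 + l h" for h
  define L' where "L' z = l' (z - z0)" for z
  have LL: "L (L' z) = z" "L' (L z) = z" for z by (simp_all add: L_def L'_def ll)
  have sL: "smooth_on UNIV L" "smooth_on UNIV L'"
    unfolding L_def[abs_def] L'_def[abs_def]
    by (intro smooth_on_add smooth_on_diff smooth_on_const smooth_on_id smooth_on_linear[OF _ bl] smooth_on_linear[OF _ bl'] open_UNIV)+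
  have cL: "continuous_on X L" "continuous_on X L'" for X
    using smooth_on_continuous sL continuous_on_subset by blast+
  have dL: "(L has_derivative l) (at h)" for h
    unfolding L_def[abs_def] by (auto intro!: derivative_eq_intros bounded_linear_imp_has_derivative[OF bl])
  have "open (L -` \<Omega>)" using open_vimage[OF Om(1)] cL by blast
  moreover have "0 \<in> L -` \<Omega>" using Om(2) by (simp add: L_def l_def)
  ultimately obtain R where R: "0 < R" "ball 0 R \<subseteq> L -` \<Omega>" by (meson open_contains_ball)
  define F where "F h = f (L h)" for h
  have LO: "L h \<in> \<Omega>" if "h \<in> ball 0 R" for h using R that by auto
  have DF: "frechet_derivative F (at h) = (\<lambda>k. frechet_derivative f (at (L h)) (l k))" if "h \<in> ball 0 R" for h
    unfolding F_def[abs_def] by (rule frechet_derivative_at[OF has_derivative_compose[OF dL df[OF LO[OF that]]], symmetric])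
  have injl: "inj l" by (rule inj_on_inverseI[of _ l']) (simp add: ll)
  have surjl: "surj l" by (rule surjI[of l l']) (simp add: ll)
  have rng: "range (frechet_derivative F (at h)) = range (frechet_derivative f (at (L h)))" if "h \<in> ball 0 R" for h
    unfolding DF[OF that] using image_image[of "frechet_derivative f (at (L h))" l UNIV] surjl by simp
  have sF: "smooth_on (ball 0 R) F"
    unfolding F_def[abs_def] by (rule smooth_on_compose[OF open_ball _ smooth_on_subset[OF sL(1)] f]) (use LO in auto)
  have fI: "inj (frechet_derivative F (at h))" if "h \<in> ball 0 R" for h
    unfolding DF[OF that] using inj[OF LO[OF that]] injl by (simp add: inj_def)
  have fJ: "nkJ (F h) (du F h) \<in> range (frechet_derivative F (at h))" if "h \<in> ball 0 R" for h
    unfolding rng[OF that] unfolding F_def[of h]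
    by (rule subsetD[OF J[OF LO[OF that]]]) (use rng[OF that] in \<open>auto simp: du_def\<close>)
  have fJ0: "nkJ (F 0) (du F 0) = dv F 0"
  proof -
    have "0 \<in> ball 0 R" using R by simp
    then show ?thesis using k by (simp add: du_def dv_def DF F_def l_def L_def)
  qed
  have fS: "F h \<in> S3 \<times> S3" if "h \<in> ball 0 R" for h
    unfolding F_def by (rule S[OF LO[OF that]])
  from local_isothermal_normalized[OF R(1) sF fS fI fJ fJ0] obtain U V H G where U: "open U" "0 \<in> U" "U \<subseteq> ball 0 R" and V: "open V" "homeomorphism U V H G"
    and s: "smooth_on U H" "smooth_on V G" and iso: "\<And>y. y \<in> V \<Longrightarrow> nkJ (F (G y)) (du (F \<circ> G) y) = dv (F \<circ> G) y"
    by blast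
  have LU: "L ` U = L' -` U"
  proof (intro equalityI subsetI)
    fix z assume "z \<in> L' -` U"
    then show "z \<in> L ` U" by (intro image_eqI[where x = "L' z"]) (simp_all add: LL)
  qed (auto simp: LL)
  have o: "open (L ` U)" unfolding LU using open_vimage[OF U(1)] cL by blast
  have hL: "homeomorphism (L ` U) U L' L"
    unfolding homeomorphism_def using cL LL by (auto simp: image_image)
  show ?thesis
  proof (rule that[OF o _ _ V(1) homeomorphism_compose[OF hL V(2)]])
    show "z0 \<in> L ` U" using U(2) by (force simp: L_def l_def)
    show "L ` U \<subseteq> \<Omega>" using U(3) LO by auto
    show "smooth_on (L ` U) (H \<circ> L')" unfolding o_def
      by (rule smooth_on_compose[OF o _ smooth_on_subset[OF sL(2)] s(1)]) (auto simp: LL)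
    show "smooth_on V (L \<circ> G)" unfolding o_def
      by (rule smooth_on_compose[OF V(1) _ s(2) sL(1)]) auto
    show "nkJ (f ((L \<circ> G) y)) (du (f \<circ> (L \<circ> G)) y) = dv (f \<circ> (L \<circ> G)) y" if "y \<in> V" for y
      using iso[OF that] by (simp add: F_def[abs_def] o_def)
  qed
qed

section \<open>Charts\<close>

lemma chart_inverse:
  assumes "is_chart c"
  shows "x \<in> fst c \<Longrightarrow> param c (snd c x) = x" "x \<in> fst c \<Longrightarrow> snd c x \<in> cdom c"
    "z \<in> cdom c \<Longrightarrow> snd c (param c z) = z" "z \<in> cdom c \<Longrightarrow> param c z \<in> fst c"
  using assms unfolding is_chart_def homeomorphism_def by auto

lemma overlap_eq: "is_chart c \<Longrightarrow> overlap c d = {z \<in> cdom c. param c z \<in> fst d}"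
  unfolding overlap_def using chart_inverse[of c] by force

lemma open_chart_preimage:
  assumes "is_chart c" "open X" shows "open {z \<in> cdom c. param c z \<in> X}"
proof -
  have "open (cdom c \<inter> param c -` X)"
    using assms by (intro continuous_open_preimage) (auto simp: is_chart_def homeomorphism_def)
  then show ?thesis by (simp add: Int_def vimage_def)
qed

lemma chart_change:
  assumes c: "is_chart c" and U: "open U" "U \<subseteq> cdom c" and V: "open V" and h: "homeomorphism U V H G"
  defines "d \<equiv> (param c ` U, H \<circ> snd c)"
  shows "is_chart d" "cdom d = V" "\<And>y. y \<in> V \<Longrightarrow> param d y = param c (G y)"
proof -
  note ch = chart_inverse[OF c]
  have hc: "homeomorphism (fst c) (cdom c) (snd c) (param c)" and oc: "open (fst c)" using c by (auto simp: is_chart_def)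
  have fd: "param c ` U = fst c \<inter> snd c -` U"
  proof (intro equalityI subsetI)
    fix x assume "x \<in> fst c \<inter> snd c -` U"
    then show "x \<in> param c ` U" by (intro image_eqI[where x = "snd c x"]) (simp_all add: ch)
  next
    fix x assume "x \<in> param c ` U"
    then obtain z where "z \<in> U" "x = param c z" by blast
    then show "x \<in> fst c \<inter> snd c -` U" using U(2) ch(3,4)[of z] by auto
  qed
  have "open (fst c \<inter> snd c -` U)"
    by (rule continuous_open_preimage[OF _ oc U(1)]) (use hc in \<open>simp add: homeomorphism_def\<close>)
  then have od: "open (param c ` U)" by (simp only: fd)
  have "snd c ` param c ` U = (\<lambda>z. z) ` U"
    unfolding image_image by (rule image_cong) (use U(2) ch(3) in auto)
  then have "snd c ` param c ` U = U" by simp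
  from homeomorphism_compose[OF homeomorphism_of_subsets[OF hc _ U(2) this] h]
  have hd: "homeomorphism (param c ` U) V (H \<circ> snd c) (param c \<circ> G)" using fd by simp
  show cd: "cdom d = V" using hd by (simp add: cdom_def d_def homeomorphism_def)
  show pd: "param d y = param c (G y)" if "y \<in> V" for y
  proof -
    have e: "param d y = inv_into (param c ` U) (H \<circ> snd c) y" by (simp only: param_def[of d]) (simp add: d_def)
    show ?thesis unfolding e
    proof (rule inv_into_f_eq)
      show "inj_on (H \<circ> snd c) (param c ` U)" 
      by (rule inj_on_inverseI[of _ "param c \<circ> G"]) (rule homeomorphism_apply1[OF hd])
      show "param c (G y) \<in> param c ` U" using h that by (auto simp: homeomorphism_def)
      show "(H \<circ> snd c) (param c (G y)) = y" using homeomorphism_apply2[OF hd that] by simp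
    qed
  qed
  have "homeomorphism (fst d) (cdom d) (snd d) (param d)"
    unfolding cd
  proof (rule homeomorphism_cong[OF hd])
    show "param d y = (param c \<circ> G) y" if "y \<in> V" for y using pd[OF that] by simp
  qed (simp_all add: d_def)
  then show "is_chart d" using od V cd by (simp add: is_chart_def d_def)
qed

lemma atlas_subset: "smooth_atlas A \<Longrightarrow> A \<subseteq> smooth_charts A"
  by (auto simp: smooth_atlas_def smooth_charts_def)

lemma smooth_transition:
  assumes A: "smooth_atlas A" and c: "c \<in> smooth_charts A" and d: "d \<in> smooth_charts A"
  shows "smooth_on (overlap c d) (transition c d)"
proof (rule smooth_on_local)
  fix z assume "z \<in> overlap c d"
  have cc: "is_chart c" and dd: "is_chart d" using c d by (auto simp: smooth_charts_def)
  then have z: "z \<in> cdom c" "param c z \<in> fst d" using \<open>z \<in> overlap c d\<close> by (auto simp: overlap_eq)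
  obtain e where e: "e \<in> A" "param c z \<in> fst e" using A unfolding smooth_atlas_def by blast
  have ee: "is_chart e" using A e by (auto simp: smooth_atlas_def)
  define T where "T = {z \<in> cdom c. param c z \<in> fst d \<inter> fst e}"
  have oT: "open T" unfolding T_def by (rule open_chart_preimage[OF cc]) (use dd ee in \<open>auto simp: is_chart_def\<close>)
  have ce: "smooth_on (overlap c e) (transition c e)" and ed: "smooth_on (overlap e d) (transition e d)"
    using c d e by (auto simp: smooth_charts_def smoothly_compatible_def)
  have "smooth_on T (\<lambda>z. transition e d (transition c e z))"
    by (rule smooth_on_compose[OF oT _ smooth_on_subset[OF ce] ed])
      (auto simp: T_def overlap_eq[OF cc] overlap_eq[OF ee] transition_def chart_inverse[OF ee])
  then have "smooth_on T (transition c d)"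
    by (rule smooth_on_cong[OF oT, rotated]) (auto simp: T_def transition_def chart_inverse[OF ee])
  then show "\<exists>T. open T \<and> z \<in> T \<and> smooth_on T (transition c d)" using oT z e(2) by (auto simp: T_def)
qed

lemma smooth_in_chart:
  assumes A: "smooth_atlas A" and f: "\<forall>c\<in>A. smooth_on (cdom c) (\<phi> \<circ> param c)" and c: "c \<in> smooth_charts A"
  shows "smooth_on (cdom c) (\<phi> \<circ> param c)"
proof (rule smooth_on_local)
  fix z assume z: "z \<in> cdom c"
  have cc: "is_chart c" using c by (auto simp: smooth_charts_def)
  obtain e where e: "e \<in> A" "param c z \<in> fst e" using A unfolding smooth_atlas_def by blast
  have ee: "is_chart e" using A e by (auto simp: smooth_atlas_def)
  define T where "T = {z \<in> cdom c. param c z \<in> fst e}"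
  have oT: "open T" unfolding T_def by (rule open_chart_preimage[OF cc]) (use ee in \<open>auto simp: is_chart_def\<close>)
  have ce: "smooth_on T (transition c e)"
    using c e by (auto simp: smooth_charts_def smoothly_compatible_def T_def overlap_eq[OF cc, symmetric])
  have "smooth_on T (\<lambda>z. (\<phi> \<circ> param e) (transition c e z))"
    by (rule smooth_on_compose[OF oT _ ce bspec[OF f e(1)]]) (auto simp: T_def transition_def chart_inverse[OF ee])
  then have "smooth_on T (\<phi> \<circ> param c)"
    by (rule smooth_on_cong[OF oT, rotated]) (auto simp: T_def transition_def chart_inverse[OF ee])
  then show "\<exists>T. open T \<and> z \<in> T \<and> smooth_on T (\<phi> \<circ> param c)" using oT z e(2) by (auto simp: T_def)
qed

lemma transition_derivative:
  assumes A: "smooth_atlas A" and c: "c \<in> smooth_charts A" and d: "d \<in> smooth_charts A"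
    and x: "x \<in> fst c" "x \<in> fst d" and f: "smooth_on (cdom d) (\<phi> \<circ> param d)"
  defines "T \<equiv> frechet_derivative (transition c d) (at (snd c x))"
  shows "(transition c d has_derivative T) (at (snd c x))"
    "differential_in \<phi> c x = (\<lambda>h. differential_in \<phi> d x (T h))"
    "frechet_derivative (transition d c) (at (snd d x)) (T h) = h"
proof -
  have cc: "is_chart c" and dd: "is_chart d" using c d by (auto simp: smooth_charts_def)
  define z where "z = snd c x"
  have z: "z \<in> overlap c d" "snd d x \<in> overlap d c" "transition c d z = snd d x"
    using x by (auto simp: z_def overlap_def transition_def chart_inverse[OF cc])
  have o: "open (overlap c d)" unfolding overlap_eq[OF cc] by (rule open_chart_preimage[OF cc]) (use dd in \<open>simp add: is_chart_def\<close>)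
  show T: "(transition c d has_derivative T) (at (snd c x))"
    unfolding T_def z_def[symmetric] by (rule smooth_on_has_derivative[OF smooth_transition[OF A c d] z(1)])
  have "((\<phi> \<circ> param d) has_derivative differential_in \<phi> d x) (at (transition c d z))"
    unfolding z(3) differential_in_def by (rule smooth_on_has_derivative[OF f]) (use chart_inverse[OF dd] x in auto)
  from has_derivative_compose[OF T[folded z_def] this]
  have "((\<phi> \<circ> param c) has_derivative (\<lambda>h. differential_in \<phi> d x (T h))) (at z)"
    by (rule has_derivative_transform_within_open[OF _ o z(1)])
      (auto simp: overlap_eq[OF cc] transition_def chart_inverse[OF dd])
  from frechet_derivative_at[OF this] show "differential_in \<phi> c x = (\<lambda>h. differential_in \<phi> d x (T h))"
    by (simp only: differential_in_def z_def)
  have "(transition d c has_derivative frechet_derivative (transition d c) (at (snd d x))) (at (transition c d z))"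
    unfolding z(3) by (rule smooth_on_has_derivative[OF smooth_transition[OF A d c] z(2)])
  from has_derivative_compose[OF T[folded z_def] this]
  have "((\<lambda>z. z) has_derivative (\<lambda>h. frechet_derivative (transition d c) (at (snd d x)) (T h))) (at z)"
    by (rule has_derivative_transform_within_open[OF _ o z(1)])
      (auto simp: overlap_eq[OF cc] transition_def chart_inverse[OF dd] chart_inverse[OF cc])
  from has_derivative_unique[OF this has_derivative_ident] show "frechet_derivative (transition d c) (at (snd d x)) (T h) = h"
    by metis
qed

lemma immersion_in_chart:
  assumes A: "smooth_atlas A" and im: "smooth_immersion A \<phi>" and c: "c \<in> smooth_charts A" and x: "x \<in> fst c"
  shows "smooth_on (cdom c) (\<phi> \<circ> param c)" "inj (differential_in \<phi> c x)"
    "tangent_plane A \<phi> x = range (differential_in \<phi> c x)"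
proof -
  have sm: "smooth_on (cdom c) (\<phi> \<circ> param c)" if "c \<in> smooth_charts A" for c
    using smooth_in_chart[OF A _ that] im by (auto simp: smooth_immersion_def)
  show "smooth_on (cdom c) (\<phi> \<circ> param c)" by (rule sm[OF c])
  have sub: "range (differential_in \<phi> c x) \<subseteq> range (differential_in \<phi> d x)"
    if "c \<in> smooth_charts A" "d \<in> smooth_charts A" "x \<in> fst c" "x \<in> fst d" for c d
    unfolding transition_derivative(2)[OF A that sm[OF that(2)]] by auto
  obtain e where e: "e \<in> A" "x \<in> fst e" using A unfolding smooth_atlas_def by blast
  have ea: "e \<in> smooth_charts A" using atlas_subset[OF A] e by auto
  have "inj (differential_in \<phi> e x)" using im e by (auto simp: smooth_immersion_def)
  then show "inj (differential_in \<phi> c x)"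
    unfolding transition_derivative(2)[OF A c ea x e(2) sm[OF ea]]
    by (intro injI) (metis injD transition_derivative(3)[OF A c ea x e(2) sm[OF ea]])
  have "tangent_plane A \<phi> x = (\<Union>d\<in>{d \<in> A. x \<in> fst d}. range (differential_in \<phi> d x))"
    unfolding tangent_plane_def by blast
  also have "\<dots> = range (differential_in \<phi> c x)"
    using sub[OF _ c _ x] sub[OF c ea x e(2)] atlas_subset[OF A] e by blast
  finally show "tangent_plane A \<phi> x = range (differential_in \<phi> c x)" .
qed

lemma inner_nkJ_nkJ: 
  assumes "x \<in> S3 \<times> S3"
  shows "nkg x (nkJ x X) (nkJ x Y) = nkg x X Y" "nkg x X (nkJ x X) = 0"
  using nkJ_nkJ[OF assms] by (simp_all add: nkg_def inner_commute)

text \<open>The metric conditions on an isothermal chart follow from \<open>f_v = J f_u\<close>, because \<open>g\<close> is \<open>J\<close>-invariant and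
  \<open>X\<close> is orthogonal to \<open>J X\<close>.\<close>

lemma isothermal_chart_exists:
  assumes "almost_complex_surface A \<phi>"
  obtains c where "c \<in> isothermal_charts A \<phi>" "x \<in> fst c"
proof -
  have A: "smooth_atlas A" and S: "range \<phi> \<subseteq> S3 \<times> S3" and im: "smooth_immersion A \<phi>"
    and J: "\<And>x. nkJ (\<phi> x) ` tangent_plane A \<phi> x \<subseteq> tangent_plane A \<phi> x"
    using assms by (auto simp: almost_complex_surface_def)
  obtain c where c: "c \<in> A" "x \<in> fst c" using A unfolding smooth_atlas_def by blast
  then have ca: "c \<in> smooth_charts A" using atlas_subset[OF A] by auto
  have cc: "is_chart c" using A c by (auto simp: smooth_atlas_def)
  note ch = chart_inverse[OF cc]
  define f where "f = \<phi> \<circ> param c"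
  have fd: "frechet_derivative f (at z) = differential_in \<phi> c (param c z)" if "z \<in> cdom c" for z
    using ch that by (simp add: f_def differential_in_def)
  have oc: "open (cdom c)" using cc by (simp add: is_chart_def)
  have sf: "smooth_on (cdom c) f" unfolding f_def by (rule immersion_in_chart(1)[OF A im ca c(2)])
  have Sf: "f z \<in> S3 \<times> S3" for z using S by (auto simp: f_def)
  have inj: "inj (frechet_derivative f (at z))" if "z \<in> cdom c" for z
    unfolding fd[OF that] by (rule immersion_in_chart(2)[OF A im ca ch(4)[OF that]])
  have Jf: "nkJ (f z) ` range (frechet_derivative f (at z)) \<subseteq> range (frechet_derivative f (at z))" if "z \<in> cdom c" for z
    using J[of "param c z"] unfolding fd[OF that] immersion_in_chart(3)[OF A im ca ch(4)[OF that]] by (simp add: f_def)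
  obtain U V H G where U: "open U" "snd c x \<in> U" "U \<subseteq> cdom c" and V: "open V" "homeomorphism U V H G"
    and s: "smooth_on U H" "smooth_on V G" and iso: "\<And>y. y \<in> V \<Longrightarrow> nkJ (f (G y)) (du (f \<circ> G) y) = dv (f \<circ> G) y"
    using local_isothermal[OF oc ch(2)[OF c(2)] sf Sf inj Jf] by blast
  define d where "d = (param c ` U, H \<circ> snd c)"
  note cd = chart_change[OF cc U(1,3) V, folded d_def]
  have G: "G ` V = U" "\<And>u. u \<in> U \<Longrightarrow> G (H u) = u" using V(2) by (auto simp: homeomorphism_def)
  have compat: "smoothly_compatible d e" if e: "e \<in> A" for e
  proof -
    have ee: "is_chart e" using A e by (auto simp: smooth_atlas_def)
    have ce: "smooth_on (overlap c e) (transition c e)" "smooth_on (overlap e c) (transition e c)"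
      using A c e by (auto simp: smooth_atlas_def smoothly_compatible_def)
    have od: "open (overlap d e)" unfolding overlap_eq[OF cd(1)]
      by (rule open_chart_preimage[OF cd(1)]) (use ee in \<open>simp add: is_chart_def\<close>)
    have oe: "open (overlap e d)" unfolding overlap_eq[OF ee]
      by (rule open_chart_preimage[OF ee]) (use cd(1) in \<open>simp add: is_chart_def\<close>)
    have "smooth_on (overlap d e) (\<lambda>z. transition c e (G z))"
      by (rule smooth_on_compose[OF od _ smooth_on_subset[OF s(2)] ce(1)])
        (use G U(3) in \<open>auto simp: overlap_eq[OF cd(1)] overlap_eq[OF cc] cd(2,3)\<close>)
    then have 1: "smooth_on (overlap d e) (transition d e)"
      by (rule smooth_on_cong[OF od, rotated]) (auto simp: overlap_eq[OF cd(1)] cd(2,3) transition_def)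
    have sub: "overlap e d \<subseteq> overlap e c" "transition e c ` overlap e d \<subseteq> U"
      using ch U(3) by (auto simp: overlap_eq[OF ee] d_def transition_def)
    have "smooth_on (overlap e d) (\<lambda>z. H (transition e c z))"
      by (rule smooth_on_compose[OF oe sub(2) smooth_on_subset[OF ce(2) sub(1)] s(1)])
    moreover have "(\<lambda>z. H (transition e c z)) = transition e d" by (simp add: transition_def d_def fun_eq_iff)
    ultimately show ?thesis using 1 by (simp add: smoothly_compatible_def)
  qed
  have "d \<in> isothermal_charts A \<phi>"
  proof -
    have "nkJ ((\<phi> \<circ> param d) z) (du (\<phi> \<circ> param d) z) = dv (\<phi> \<circ> param d) z" if z: "z \<in> V" for z
    proof -
      have "(f \<circ> G) differentiable (at z)"
      proof -
        have "smooth_on V (\<lambda>z. f (G z))" by (rule smooth_on_compose[OF V(1) _ s(2) sf]) (use G U(3) in auto)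
        from smooth_on_has_derivative[OF this z] show ?thesis by (auto simp: differentiable_def o_def)
      qed
      then have "((f \<circ> G) has_derivative frechet_derivative (f \<circ> G) (at z)) (at z)" using frechet_derivative_works by blast
      then have "((\<phi> \<circ> param d) has_derivative frechet_derivative (f \<circ> G) (at z)) (at z)"
        by (rule has_derivative_transform_within_open[OF _ V(1) z]) (simp add: f_def cd(3))
      from frechet_derivative_at[OF this]
      have "du (\<phi> \<circ> param d) z = du (f \<circ> G) z" "dv (\<phi> \<circ> param d) z = dv (f \<circ> G) z" by (simp_all add: du_def dv_def)
      then show ?thesis using iso[OF z] by (simp add: f_def cd(3)[OF z])
    qed
    note j = this
    have "nkg (\<phi> (param d z)) (du (\<phi> \<circ> param d) z) (du (\<phi> \<circ> param d) z)
        = nkg (\<phi> (param d z)) (dv (\<phi> \<circ> param d) z) (dv (\<phi> \<circ> param d) z)"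
      "nkg (\<phi> (param d z)) (du (\<phi> \<circ> param d) z) (dv (\<phi> \<circ> param d) z) = 0" if "z \<in> V" for z
    proof -
      have "\<phi> (param d z) \<in> S3 \<times> S3" using S by blast
      note n = inner_nkJ_nkJ(1)[OF this, of "du (\<phi> \<circ> param d) z" "du (\<phi> \<circ> param d) z"]
        inner_nkJ_nkJ(2)[OF this, of "du (\<phi> \<circ> param d) z"]
      show "nkg (\<phi> (param d z)) (du (\<phi> \<circ> param d) z) (du (\<phi> \<circ> param d) z)
        = nkg (\<phi> (param d z)) (dv (\<phi> \<circ> param d) z) (dv (\<phi> \<circ> param d) z)"
        "nkg (\<phi> (param d z)) (du (\<phi> \<circ> param d) z) (dv (\<phi> \<circ> param d) z) = 0"
        using n j[OF that] by (simp_all only: o_apply)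
    qed
    then show ?thesis
      using j compat cd(1,2) unfolding isothermal_charts_def smooth_charts_def Let_def by simp
  qed
  moreover have "x \<in> fst d" using U(2) ch(1)[OF c(2)] by (force simp: d_def)
  ultimately show ?thesis by (rule that)
qed

section \<open>The structure equations of an almost complex surface\<close>

text \<open>Schwarz's theorem, obtained by differentiating \<open>f (x, y) = f (a, y) + \<integral> f_u (s, y) ds\<close>, integrated from \<open>a\<close> to
  \<open>x\<close>, first in \<open>y\<close> under the integral sign and then in \<open>x\<close>.\<close>

lemma mixed_derivatives_commute:
  fixes f :: "complex \<Rightarrow> 'a::euclidean_space"
  assumes Om: "open \<Omega>" "z \<in> \<Omega>" and f: "smooth_on \<Omega> f"
  shows "dv (du f) z = du (dv f) z"
proof -
  obtain e' where e': "0 < e'" "cball z e' \<subseteq> \<Omega>" using Om open_contains_cball by blast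
  define e where "e = e' / 2"
  define x0 y0 a b c d where "x0 = Re z" and "y0 = Im z" and "a = x0 - e" and "b = x0 + e" and "c = y0 - e" and "d = y0 + e"
  note defs = a_def b_def c_def d_def
  have e: "0 < e" using e' by (simp add: e_def)
  have z: "z = Complex x0 y0" by (simp add: x0_def y0_def)
  have R: "Complex x y \<in> \<Omega>" if "x \<in> {a..b}" "y \<in> {c..d}" for x y
  proof -
    have "norm (z - Complex x y) \<le> \<bar>x0 - x\<bar> + \<bar>y0 - y\<bar>" using cmod_le[of "z - Complex x y"] by (simp add: x0_def y0_def)
    also have "\<dots> \<le> e'" using that by (auto simp: defs e_def)
    finally show ?thesis using e'(2) by (auto simp: dist_norm)
  qed
  have sl: "((\<lambda>x. g (Complex x y)) has_vector_derivative du g (Complex x y)) (at x)"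
    "((\<lambda>y. g (Complex x y)) has_vector_derivative dv g (Complex x y)) (at y)"
    if "smooth_on \<Omega> g" "x \<in> {a..b}" "y \<in> {c..d}" for g :: "complex \<Rightarrow> 'a" and x y
    using slice_derivatives_at[OF smooth_on_has_derivative[OF that(1) R[OF that(2,3)]]] by blast+
  have cont: "continuous_on ({c..d} \<times> {a..b}) (\<lambda>p. g (Complex (snd p) (fst p)))"
    if "smooth_on \<Omega> g" for g :: "complex \<Rightarrow> 'a"
  proof (rule continuous_on_compose2[OF smooth_on_continuous[OF that]])
    show "continuous_on ({c..d} \<times> {a..b}) (\<lambda>p. Complex (snd p) (fst p))"
      unfolding Complex_eq by (intro continuous_intros)
  qed (use R in auto)
  have c1: "continuous_on {a..b} (\<lambda>x. g (Complex x y))" if "smooth_on \<Omega> g" "y \<in> {c..d}" for g :: "complex \<Rightarrow> 'a" and y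
    by (rule continuous_on_compose2[OF cont[OF that(1)], where f = "\<lambda>x. (y, x)", simplified]) (use that(2) in \<open>auto intro!: continuous_intros\<close>)
  note su = smooth_du[OF f] and sv = smooth_dv[OF f]
  have y0: "y0 \<in> {c..d}" "at y0 within {c..d} = at y0" and x0: "x0 \<in> {a..b}" "at x0 within {a..b} = at x0" and a: "a \<in> {a..b}"
    using e by (auto simp: defs at_within_Icc_at)
  have star: "dv f (Complex x y0) = dv f (Complex a y0) + integral {a..x} (\<lambda>s. dv (du f) (Complex s y0))"
    if x: "x \<in> {a..b}" for x
  proof -
    have ftc: "integral {a..x} (\<lambda>s. du f (Complex s y)) = f (Complex x y) - f (Complex a y)" if "y \<in> {c..d}" for y
      by (rule integral_unique[OF fundamental_theorem_of_calculus[OF _ has_vector_derivative_at_within[OF sl(1)[OF f]]]])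
        (use x that in auto)
    have "((\<lambda>y. integral (cbox a x) (\<lambda>s. du f (Complex s y))) has_vector_derivative
        integral (cbox a x) (\<lambda>s. dv (du f) (Complex s y0))) (at y0 within {c..d})"
    proof (rule leibniz_rule_vector_derivative)
      show "((\<lambda>y. du f (Complex s y)) has_vector_derivative dv (du f) (Complex s y)) (at y within {c..d})"
        if "y \<in> {c..d}" "s \<in> cbox a x" for y s
        by (rule has_vector_derivative_at_within[OF sl(2)[OF su]]) (use that x in auto)
      show "(\<lambda>s. du f (Complex s y)) integrable_on cbox a x" if "y \<in> {c..d}" for y
        using x by (auto intro!: integrable_continuous_real continuous_on_subset[OF c1[OF su that]])
      show "continuous_on ({c..d} \<times> cbox a x) (\<lambda>(y, s). dv (du f) (Complex s y))"
        unfolding split_def by (rule continuous_on_subset[OF cont[OF smooth_dv[OF su]]]) (use x in auto)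
    qed (use y0 in auto)
    then have "((\<lambda>y. f (Complex x y) - f (Complex a y)) has_vector_derivative
        integral {a..x} (\<lambda>s. dv (du f) (Complex s y0))) (at y0 within {c..d})"
      unfolding cbox_interval by (rule has_vector_derivative_transform[OF y0(1), rotated]) (simp add: ftc)
    moreover have "((\<lambda>y. f (Complex x y) - f (Complex a y)) has_vector_derivative dv f (Complex x y0) - dv f (Complex a y0)) (at y0)"
      by (intro has_vector_derivative_diff sl(2)[OF f] x a y0)
    ultimately have "integral {a..x} (\<lambda>s. dv (du f) (Complex s y0)) = dv f (Complex x y0) - dv f (Complex a y0)"
      unfolding y0(2) by (rule vector_derivative_unique_at)
    then show ?thesis by simp
  qed
  have "((\<lambda>x. dv f (Complex a y0) + integral {a..x} (\<lambda>s. dv (du f) (Complex s y0))) has_vector_derivative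
      0 + dv (du f) (Complex x0 y0)) (at x0 within {a..b})"
    by (intro has_vector_derivative_add has_vector_derivative_const integral_has_vector_derivative c1[OF smooth_dv[OF su] y0(1)] x0)
  then have "((\<lambda>x. dv f (Complex x y0)) has_vector_derivative dv (du f) z) (at x0 within {a..b})"
    unfolding z[symmetric] add_0 by (rule has_vector_derivative_transform[OF x0(1), rotated]) (rule star)
  moreover have "((\<lambda>x. dv f (Complex x y0)) has_vector_derivative du (dv f) z) (at x0)"
    unfolding z by (rule sl(1)[OF sv x0(1) y0(1)])
  ultimately show ?thesis unfolding x0(2) by (rule vector_derivative_unique_at)
qed

lemma derivative_of_product:
  fixes f :: "complex \<Rightarrow> 'a::real_normed_vector" and g :: "complex \<Rightarrow> 'b::real_normed_vector"
    and B :: "'a \<Rightarrow> 'b \<Rightarrow> 'c::real_normed_vector"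
  assumes B: "bounded_bilinear B" and f: "f differentiable (at z)" and g: "g differentiable (at z)"
  shows "(\<lambda>z. B (f z) (g z)) differentiable (at z)"
    "du (\<lambda>z. B (f z) (g z)) z = B (du f z) (g z) + B (f z) (du g z)"
    "dv (\<lambda>z. B (f z) (g z)) z = B (dv f z) (g z) + B (f z) (dv g z)"
proof -
  note d = bounded_bilinear.FDERIV[OF B f[unfolded frechet_derivative_works] g[unfolded frechet_derivative_works]]
  from d show "(\<lambda>z. B (f z) (g z)) differentiable (at z)" by (auto simp: differentiable_def)
  from frechet_derivative_at[OF d, symmetric]
  show "du (\<lambda>z. B (f z) (g z)) z = B (du f z) (g z) + B (f z) (du g z)"
    "dv (\<lambda>z. B (f z) (g z)) z = B (dv f z) (g z) + B (f z) (dv g z)"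
    by (simp_all add: du_def dv_def add.commute)
qed

lemma derivative_of_linear:
  fixes f :: "complex \<Rightarrow> 'a::real_normed_vector"
  assumes L: "bounded_linear L" and f: "f differentiable (at z)"
  shows "(\<lambda>z. L (f z)) differentiable (at z)" "du (\<lambda>z. L (f z)) z = L (du f z)" "dv (\<lambda>z. L (f z)) z = L (dv f z)"
proof -
  note d = bounded_linear.has_derivative[OF L f[unfolded frechet_derivative_works]]
  from d show "(\<lambda>z. L (f z)) differentiable (at z)" by (auto simp: differentiable_def)
  from frechet_derivative_at[OF d, symmetric]
  show "du (\<lambda>z. L (f z)) z = L (du f z)" "dv (\<lambda>z. L (f z)) z = L (dv f z)" by (simp_all add: du_def dv_def)
qed

lemma derivative_of_combination:
  fixes f g :: "complex \<Rightarrow> 'a::real_normed_vector"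
  assumes f: "f differentiable (at z)" and g: "g differentiable (at z)"
  shows "(\<lambda>z. r *\<^sub>R f z + s *\<^sub>R g z) differentiable (at z)"
    "du (\<lambda>z. r *\<^sub>R f z + s *\<^sub>R g z) z = r *\<^sub>R du f z + s *\<^sub>R du g z"
    "dv (\<lambda>z. r *\<^sub>R f z + s *\<^sub>R g z) z = r *\<^sub>R dv f z + s *\<^sub>R dv g z"
proof -
  have d: "((\<lambda>z. r *\<^sub>R f z + s *\<^sub>R g z) has_derivative
      (\<lambda>h. r *\<^sub>R frechet_derivative f (at z) h + s *\<^sub>R frechet_derivative g (at z) h)) (at z)"
    by (intro has_derivative_add bounded_linear.has_derivative[OF bounded_linear_scaleR_right]
        f[unfolded frechet_derivative_works] g[unfolded frechet_derivative_works])
  from d show "(\<lambda>z. r *\<^sub>R f z + s *\<^sub>R g z) differentiable (at z)" by (auto simp: differentiable_def)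
  from frechet_derivative_at[OF d, symmetric]
  show "du (\<lambda>z. r *\<^sub>R f z + s *\<^sub>R g z) z = r *\<^sub>R du f z + s *\<^sub>R du g z"
    "dv (\<lambda>z. r *\<^sub>R f z + s *\<^sub>R g z) z = r *\<^sub>R dv f z + s *\<^sub>R dv g z"
    by (simp_all add: du_def dv_def)
qed

lemma derivatives_cong:
  assumes "open S" "z \<in> S" "\<And>x. x \<in> S \<Longrightarrow> f x = g x" "f differentiable (at z)"
  shows "du f z = du g z" "dv f z = dv g z"
proof -
  have "(g has_derivative frechet_derivative f (at z)) (at z)"
    by (rule has_derivative_transform_within_open[OF assms(4)[unfolded frechet_derivative_works] assms(1,2,3)])
  from frechet_derivative_at[OF this] show "du f z = du g z" "dv f z = dv g z" by (simp_all add: du_def dv_def)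
qed

lemma smooth_on_differentiable: "smooth_on S f \<Longrightarrow> z \<in> S \<Longrightarrow> f differentiable (at z)"
  using smooth_on_has_derivative differentiable_def by blast

lemma inner_quat: "(x :: quat) \<bullet> y = fst x * fst y + snd x \<bullet> snd y" by (simp add: inner_prod_def)

lemma qconj_qmult: "qconj (x *\<^sub>q y) = qconj y *\<^sub>q qconj x"
  by (simp add: qmult_def qconj_def prod_eq_iff vec_eq_iff forall_3 cross3_simps inner_vec_def sum_3)

lemma qconj_S3: "x \<in> S3 \<Longrightarrow> qconj x \<in> S3"
  by (simp add: S3_def qconj_def norm_Pair norm_prod_def)

lemma qmult_S3_inner:
  assumes "x \<in> S3" shows "(x *\<^sub>q y) \<bullet> (x *\<^sub>q z) = y \<bullet> z"
proof -
  have "(x *\<^sub>q y) \<bullet> (x *\<^sub>q z) = ((fst x)\<^sup>2 + snd x \<bullet> snd x) * (y \<bullet> z)"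
    by (simp add: inner_quat qmult_def cross3_simps inner_vec_def sum_3 power2_eq_square)
  then show ?thesis using S3_norm[OF assms] by simp
qed

lemma fst_qconj_qmult: "fst (qconj x *\<^sub>q y) = x \<bullet> y"
  by (simp add: qconj_def qmult_def inner_quat)

lemma qmult_cancel:
  "x \<in> S3 \<Longrightarrow> qconj x *\<^sub>q (x *\<^sub>q y) = y" "x \<in> S3 \<Longrightarrow> x *\<^sub>q (qconj x *\<^sub>q y) = y"
  by (simp_all add: qmult_qconj flip: qmult_assoc)

text \<open>Solving the first component of \<open>J (U, V) = (U', V')\<close> for \<open>p q^-1 V\<close>, and inserting the result into the
  second one.\<close>

lemma nkJ_components:
  assumes "p \<in> S3" "q \<in> S3" and J: "nkJ (p, q) (U, V) = (U', V')"
  defines "a \<equiv> p *\<^sub>q qconj q"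
  shows "a *\<^sub>q V = (1/2) *\<^sub>R (sqrt 3 *\<^sub>R U' + U)" "a *\<^sub>q V' = (1/2) *\<^sub>R (U' - sqrt 3 *\<^sub>R U)"
proof -
  have ab: "a *\<^sub>q (q *\<^sub>q qconj p *\<^sub>q y) = y" for y
    using assms(1,2) by (simp add: a_def qmult_assoc qmult_cancel)
  have U': "U' = (1 / sqrt 3) *\<^sub>R (2 *\<^sub>R (a *\<^sub>q V) - U)" and V': "V' = (1 / sqrt 3) *\<^sub>R ((-2) *\<^sub>R (q *\<^sub>q qconj p *\<^sub>q U) + V)"
    using J nkJ_unit[of "(p, q)" "(U, V)"] assms(1,2) by (auto simp: a_def)
  have "sqrt 3 *\<^sub>R U' = 2 *\<^sub>R (a *\<^sub>q V) - U" unfolding U' by simp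
  then have "sqrt 3 *\<^sub>R U' + U = 2 *\<^sub>R (a *\<^sub>q V)" by simp
  then show W: "a *\<^sub>q V = (1/2) *\<^sub>R (sqrt 3 *\<^sub>R U' + U)" by simp
  have "a *\<^sub>q V' = (1 / sqrt 3) *\<^sub>R ((-2) *\<^sub>R U + a *\<^sub>q V)"
    unfolding V' by (simp only: qm.scaleR_right qm.add_right ab)
  also have "\<dots> = (1/2) *\<^sub>R (U' - sqrt 3 *\<^sub>R U)"
  proof -
    have r: "3 / sqrt 3 = sqrt (3::real)" by (simp add: real_div_sqrt)
    have "(-2) *\<^sub>R U + a *\<^sub>q V = (sqrt 3 / 2) *\<^sub>R U' - (3/2) *\<^sub>R U"
      unfolding W by (simp add: prod_eq_iff vec_eq_iff algebra_simps)
    then show ?thesis using r by (simp add: scaleR_diff_right)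
  qed
  finally show "a *\<^sub>q V' = (1/2) *\<^sub>R (U' - sqrt 3 *\<^sub>R U)" .
qed

text \<open>For imaginary \<open>a\<close> and \<open>b\<close> the equation determines \<open>c\<close> as a real quaternion plus a multiple of the vector
  product of \<open>a\<close> and \<open>b\<close>.\<close>

lemma laplacian_algebra:
  fixes a b c :: quat
  assumes "fst a = 0" "fst b = 0"
    and s: "s = (1/2) *\<^sub>R (sqrt 3 *\<^sub>R b + a)" and t: "t = (1/2) *\<^sub>R (b - sqrt 3 *\<^sub>R a)"
    and eq: "t *\<^sub>q s + qconj b *\<^sub>q s + (sqrt 3 / 2) *\<^sub>R c = s *\<^sub>q t + qconj a *\<^sub>q t"
  shows "a \<bullet> c = 0" "b \<bullet> c = 0"
proof -
  define A B where "A = snd a" and "B = snd b"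
  have ab: "a = (0, A)" "b = (0, B)" using assms by (auto simp: A_def B_def prod_eq_iff)
  have c: "(sqrt 3 / 2) *\<^sub>R c = s *\<^sub>q t + qconj a *\<^sub>q t - t *\<^sub>q s - qconj b *\<^sub>q s"
    using eq by (simp add: algebra_simps)
  have "(sqrt 3 / 2) * (a \<bullet> c) = 0" "(sqrt 3 / 2) * (b \<bullet> c) = 0"
    unfolding inner_scaleR_right[symmetric] c s t ab
    by (simp_all add: inner_quat qmult_def qconj_def cross3_simps inner_vec_def sum_3 algebra_simps)
  then show "a \<bullet> c = 0" "b \<bullet> c = 0" by simp_all
qed

text \<open>By \<open>nkJ_components\<close>, \<open>q_u = q p^-1 s\<close> and \<open>q_v = q p^-1 t\<close>, where \<open>s\<close> and \<open>t\<close> are combinations of \<open>p_u\<close> and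
  \<open>p_v\<close>.  In \<open>q_uv = q_vu\<close> the second derivatives of \<open>p\<close> enter only through \<open>s_v - t_u\<close>, which is a multiple
  of \<open>p_uu + p_vv\<close>, and everything else is quadratic in the imaginary quaternions \<open>p^-1 p_u\<close> and \<open>p^-1 p_v\<close>.\<close>

lemma laplacian_orthogonal:
  fixes p q :: "complex \<Rightarrow> quat"
  assumes Om: "open \<Omega>" and p: "smooth_on \<Omega> p" and q: "smooth_on \<Omega> q"
    and S: "\<And>z. z \<in> \<Omega> \<Longrightarrow> p z \<in> S3 \<and> q z \<in> S3"
    and J: "\<And>z. z \<in> \<Omega> \<Longrightarrow> nkJ (p z, q z) (du p z, du q z) = (dv p z, dv q z)"
    and z: "z \<in> \<Omega>"
  shows "p z \<bullet> du p z = 0" "p z \<bullet> dv p z = 0"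
    "du p z \<bullet> (du (du p) z + dv (dv p) z) = 0" "dv p z \<bullet> (du (du p) z + dv (dv p) z) = 0"
proof -
  note su = smooth_du[OF p] and sv = smooth_dv[OF p]
  note dp = smooth_on_differentiable[OF p z] and dq = smooth_on_differentiable[OF q z]
    and dpu = smooth_on_differentiable[OF su z] and dpv = smooth_on_differentiable[OF sv z]
  note der = derivative_of_product[OF bounded_bilinear_inner dp dp]
  have one: "p x \<bullet> p x = 1" if "x \<in> \<Omega>" for x using S[OF that] by (simp add: S3_def norm_eq_1)
  have "du (\<lambda>z. p z \<bullet> p z) z = du (\<lambda>z. 1) z" "dv (\<lambda>z. p z \<bullet> p z) z = dv (\<lambda>z. 1) z"
    by (rule derivatives_cong[OF Om z one der(1)], assumption)+
  then show t: "p z \<bullet> du p z = 0" "p z \<bullet> dv p z = 0"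
    unfolding der(2,3) by (simp_all add: du_def dv_def inner_commute)
  define s where "s z = (1/2) *\<^sub>R (sqrt 3 *\<^sub>R dv p z + du p z)" for z
  define t where "t z = (1/2) *\<^sub>R (dv p z - sqrt 3 *\<^sub>R du p z)" for z
  have st: "s = (\<lambda>z. (sqrt 3 / 2) *\<^sub>R dv p z + (1/2) *\<^sub>R du p z)" "t = (\<lambda>z. (1/2) *\<^sub>R dv p z + (- sqrt 3 / 2) *\<^sub>R du p z)"
    by (auto simp: s_def t_def fun_eq_iff scaleR_add_right scaleR_diff_right)
  note ds = derivative_of_combination[OF dpv dpu, of "sqrt 3 / 2" "1/2", folded st]
    and dt = derivative_of_combination[OF dpv dpu, of "1/2" "- sqrt 3 / 2", folded st]
  note cp = derivative_of_linear[OF bounded_linear_qconj dp]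
  note E1 = derivative_of_product[OF bounded_bilinear_qmult cp(1) ds(1)]
    and E2 = derivative_of_product[OF bounded_bilinear_qmult cp(1) dt(1)]
  note F1 = derivative_of_product[OF bounded_bilinear_qmult dq E1(1)]
    and F2 = derivative_of_product[OF bounded_bilinear_qmult dq E2(1)]
  have qs: "q x *\<^sub>q (qconj (p x) *\<^sub>q s x) = du q x" "q x *\<^sub>q (qconj (p x) *\<^sub>q t x) = dv q x" if x: "x \<in> \<Omega>" for x
  proof -
    note n = nkJ_components[OF conjunct1[OF S[OF x]] conjunct2[OF S[OF x]] J[OF x]]
    have c: "q x *\<^sub>q (qconj (p x) *\<^sub>q (p x *\<^sub>q qconj (q x) *\<^sub>q y)) = y" for y
      using S[OF x] by (simp add: qmult_assoc qmult_cancel)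
    show "q x *\<^sub>q (qconj (p x) *\<^sub>q s x) = du q x" "q x *\<^sub>q (qconj (p x) *\<^sub>q t x) = dv q x"
      unfolding s_def t_def n[symmetric] by (rule c)+
  qed
  have "dv (du q) z = du (dv q) z" by (rule mixed_derivatives_commute[OF Om z q])
  moreover have "dv (\<lambda>z. q z *\<^sub>q (qconj (p z) *\<^sub>q s z)) z = dv (du q) z"
    by (rule derivatives_cong(2)[OF Om z qs(1) F1(1)])
  moreover have "du (\<lambda>z. q z *\<^sub>q (qconj (p z) *\<^sub>q t z)) z = du (dv q) z"
    by (rule derivatives_cong(1)[OF Om z qs(2) F2(1)])
  ultimately have eq: "dv q z *\<^sub>q (qconj (p z) *\<^sub>q s z) + q z *\<^sub>q (qconj (dv p z) *\<^sub>q s z + qconj (p z) *\<^sub>q dv s z)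
    = du q z *\<^sub>q (qconj (p z) *\<^sub>q t z) + q z *\<^sub>q (qconj (du p z) *\<^sub>q t z + qconj (p z) *\<^sub>q du t z)"
    unfolding F1 E1 F2 E2 cp by simp
  define P where "P = qconj (p z)"
  have PS: "P \<in> S3" "p z \<in> S3" "q z \<in> S3" using S[OF z] qconj_S3 by (auto simp: P_def)
  define a b c where "a = P *\<^sub>q du p z" and "b = P *\<^sub>q dv p z" and "c = P *\<^sub>q (du (du p) z + dv (dv p) z)"
  have conj: "qconj (du p z) *\<^sub>q y = qconj a *\<^sub>q (P *\<^sub>q y)" "qconj (dv p z) *\<^sub>q y = qconj b *\<^sub>q (P *\<^sub>q y)" for y
  proof -
    have "qconj x *\<^sub>q y = qconj (P *\<^sub>q x) *\<^sub>q (P *\<^sub>q y)" for x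
    proof -
      have "qconj (P *\<^sub>q x) *\<^sub>q (P *\<^sub>q y) = qconj x *\<^sub>q (qconj P *\<^sub>q (P *\<^sub>q y))"
        by (simp add: qconj_qmult qmult_assoc)
      then show ?thesis using qmult_cancel(1)[OF PS(1)] by simp
    qed
    then show "qconj (du p z) *\<^sub>q y = qconj a *\<^sub>q (P *\<^sub>q y)" "qconj (dv p z) *\<^sub>q y = qconj b *\<^sub>q (P *\<^sub>q y)"
      by (simp_all add: a_def b_def)
  qed
  define s' t' where "s' = P *\<^sub>q s z" and "t' = P *\<^sub>q t z"
  have s': "s' = (1/2) *\<^sub>R (sqrt 3 *\<^sub>R b + a)" and t': "t' = (1/2) *\<^sub>R (b - sqrt 3 *\<^sub>R a)"
    by (simp_all add: s'_def t'_def s_def t_def a_def b_def qm.scaleR_right qm.add_right qm.diff_right)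
  have quv: "dv q z = q z *\<^sub>q t'" "du q z = q z *\<^sub>q s'" using qs[OF z] by (simp_all add: s'_def t'_def P_def)
  have "q z *\<^sub>q (t' *\<^sub>q s' + (qconj b *\<^sub>q s' + P *\<^sub>q dv s z)) = q z *\<^sub>q (s' *\<^sub>q t' + (qconj a *\<^sub>q t' + P *\<^sub>q du t z))"
    using eq unfolding quv conj P_def[symmetric] s'_def[symmetric] t'_def[symmetric] by (simp add: qm.add_right qmult_assoc)
  from arg_cong[OF this, of "\<lambda>y. qconj (q z) *\<^sub>q y"]
  have eq2: "t' *\<^sub>q s' + (qconj b *\<^sub>q s' + P *\<^sub>q dv s z) = s' *\<^sub>q t' + (qconj a *\<^sub>q t' + P *\<^sub>q du t z)"
    unfolding qmult_cancel(1)[OF PS(3)] .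
  have "dv s z - du t z = (sqrt 3 / 2) *\<^sub>R (du (du p) z + dv (dv p) z)"
    unfolding ds dt mixed_derivatives_commute[OF Om z p] by (simp add: scaleR_add_right)
  then have "(sqrt 3 / 2) *\<^sub>R c = P *\<^sub>q dv s z - P *\<^sub>q du t z"
    by (simp add: c_def flip: qm.scaleR_right qm.diff_right)
  then have eq3: "t' *\<^sub>q s' + qconj b *\<^sub>q s' + (sqrt 3 / 2) *\<^sub>R c = s' *\<^sub>q t' + qconj a *\<^sub>q t'"
  proof -
    have "t' *\<^sub>q s' + qconj b *\<^sub>q s' + (P *\<^sub>q dv s z - P *\<^sub>q du t z)
      = (t' *\<^sub>q s' + (qconj b *\<^sub>q s' + P *\<^sub>q dv s z)) - P *\<^sub>q du t z" by simp
    also have "\<dots> = s' *\<^sub>q t' + qconj a *\<^sub>q t'" unfolding eq2 by simp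
    finally show ?thesis using \<open>(sqrt 3 / 2) *\<^sub>R c = _\<close> by simp
  qed
  have "fst a = 0" "fst b = 0" using t by (simp_all add: a_def b_def P_def fst_qconj_qmult)
  from laplacian_algebra[OF this s' t' eq3]
  show "du p z \<bullet> (du (du p) z + dv (dv p) z) = 0" "dv p z \<bullet> (du (du p) z + dv (dv p) z) = 0"
    by (simp_all add: a_def b_def c_def qmult_S3_inner[OF PS(1)])
qed

section \<open>The quadratic differential\<close>

definition nkgP :: "quat2 \<Rightarrow> quat2 \<Rightarrow> quat2 \<Rightarrow> real" where
  "nkgP x X Y = nkg x (nkP x X) Y"

lemma nkP_eq: "nkP x X = (fst x *\<^sub>q qinv (snd x) *\<^sub>q snd X, snd x *\<^sub>q qinv (fst x) *\<^sub>q fst X)"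
  by (metis nkP.simps prod.collapse)

lemma nkgP_bilinear:
  "nkgP x (X + Y) Z = nkgP x X Z + nkgP x Y Z" "nkgP x (r *\<^sub>R X) Z = r * nkgP x X Z"
  "nkgP x Z (X + Y) = nkgP x Z X + nkgP x Z Y" "nkgP x Z (r *\<^sub>R X) = r * nkgP x Z X"
proof -
  have "nkP x (X + Y) = nkP x X + nkP x Y" "nkP x (r *\<^sub>R X) = r *\<^sub>R nkP x X"
    by (simp_all add: nkP_eq qm.add_right qm.scaleR_right)
  then show "nkgP x (X + Y) Z = nkgP x X Z + nkgP x Y Z" "nkgP x (r *\<^sub>R X) Z = r * nkgP x X Z"
    "nkgP x Z (X + Y) = nkgP x Z X + nkgP x Z Y" "nkgP x Z (r *\<^sub>R X) = r * nkgP x Z X"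
    unfolding nkgP_def nkg_def
    by (simp_all only: nkJ_linear inner_add_left inner_add_right inner_scaleR_left inner_scaleR_right) (simp_all add: algebra_simps add_divide_distrib)
qed

text \<open>The isometry \<open>y \<mapsto> p q^-1 y\<close> moves the second components into the first factor.  After this
  identification \<open>P\<close> interchanges the two components, and \<open>J\<close> has constant coefficients.\<close>

lemma nkgP_trivialized:
  assumes "p \<in> S3" "q \<in> S3"
  defines "a \<equiv> p *\<^sub>q qconj q"
  shows "nkgP (p, q) (U, V) (U', V')
    = 4/3 * ((a *\<^sub>q V) \<bullet> U' + U \<bullet> (a *\<^sub>q V')) - 2/3 * ((a *\<^sub>q V) \<bullet> (a *\<^sub>q V') + U \<bullet> U')"
proof -
  define b where "b = q *\<^sub>q qconj p"
  have ab: "a *\<^sub>q (b *\<^sub>q y) = y" for y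
    using assms(1,2) by (simp add: a_def b_def qmult_assoc qmult_cancel)
  have iso: "x \<bullet> y = (a *\<^sub>q x) \<bullet> (a *\<^sub>q y)" for x y
    using assms(1,2) qconj_S3 by (simp add: a_def qmult_assoc qmult_S3_inner)
  define W W' where "W = a *\<^sub>q V" and "W' = a *\<^sub>q V'"
  define r where "r = 1 / sqrt 3"
  have rr: "r * r = 1/3" by (simp add: r_def)
  have J: "nkJ (p, q) (u, v) = (r *\<^sub>R (2 *\<^sub>R (a *\<^sub>q v) - u), r *\<^sub>R ((-2) *\<^sub>R (b *\<^sub>q u) + v))" for u v
    using nkJ_unit[of "(p, q)" "(u, v)"] assms(1,2) by (simp add: a_def b_def r_def)
  have P: "nkP (p, q) (U, V) = (W, b *\<^sub>q U)" using assms(1,2) by (simp add: a_def b_def W_def qinv_unit)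
  have "nkg (p, q) (u, v) (u', v') = ((u \<bullet> u' + (a *\<^sub>q v) \<bullet> (a *\<^sub>q v')) +
     (r * r) * ((2 *\<^sub>R (a *\<^sub>q v) - u) \<bullet> (2 *\<^sub>R (a *\<^sub>q v') - u') + ((-2) *\<^sub>R u + a *\<^sub>q v) \<bullet> ((-2) *\<^sub>R u' + a *\<^sub>q v'))) / 2"
    for u v u' v'
  proof -
    have "((-2) *\<^sub>R (b *\<^sub>q u) + v) \<bullet> ((-2) *\<^sub>R (b *\<^sub>q u') + v') = ((-2) *\<^sub>R u + a *\<^sub>q v) \<bullet> ((-2) *\<^sub>R u' + a *\<^sub>q v')"
      by (subst iso) (simp only: qm.add_right qm.scaleR_right ab)
    then show ?thesis
      unfolding nkg_def J by (simp only: inner_Pair inner_scaleR_left inner_scaleR_right iso[of v v'] mult.assoc distrib_left)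
  qed
  from this[of W "b *\<^sub>q U" U' V'] show ?thesis
    unfolding nkgP_def P ab rr W_def[symmetric] W'_def[symmetric]
    by (simp add: inner_add_left inner_add_right inner_diff_left inner_diff_right inner_commute field_simps)
qed

text \<open>In particular the form is symmetric on the span of \<open>X\<close> and \<open>Y = J X\<close>, and its values at \<open>(X, X)\<close> and
  \<open>(Y, Y)\<close> are opposite.\<close>

lemma nkgP_formula:
  assumes S: "x \<in> S3 \<times> S3" and Y: "nkJ x X = Y"
  defines "d \<equiv> fst X \<bullet> fst X - fst Y \<bullet> fst Y" and "m \<equiv> fst X \<bullet> fst Y"
  shows "nkgP x X X = d / 2 + sqrt 3 * m" "nkgP x Y Y = - (d / 2 + sqrt 3 * m)"
    "nkgP x X Y = m - sqrt 3 / 2 * d" "nkgP x Y X = m - sqrt 3 / 2 * d"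
proof -
  obtain p q U V U' V' where e: "x = (p, q)" "X = (U, V)" "Y = (U', V')" by (metis surj_pair)
  have pq: "p \<in> S3" "q \<in> S3" using S e by auto
  define r where "r = sqrt (3::real)"
  have rr: "r * r = 3" "r * (r * y) = 3 * y" for y by (simp_all add: r_def flip: mult.assoc)
  note W = nkJ_components[OF pq Y[unfolded e]]
  have F: "fst X = U" "fst Y = U'" by (simp_all add: e)
  show "nkgP x X X = d / 2 + sqrt 3 * m" "nkgP x Y Y = - (d / 2 + sqrt 3 * m)"
    "nkgP x X Y = m - sqrt 3 / 2 * d" "nkgP x Y X = m - sqrt 3 / 2 * d"
    unfolding e nkgP_trivialized[OF pq] W d_def m_def fst_conv r_def[symmetric]
    by (simp_all add: inner_add_left inner_add_right inner_diff_left inner_diff_right inner_commute[of U' U] field_simps rr)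
qed

lemma Lam_eq:
  "Lam \<phi> c z = Complex ((nkgP ((\<phi> \<circ> param c) z) (du (\<phi> \<circ> param c) z) (du (\<phi> \<circ> param c) z)
      - nkgP ((\<phi> \<circ> param c) z) (dv (\<phi> \<circ> param c) z) (dv (\<phi> \<circ> param c) z)) / 4)
    (- (nkgP ((\<phi> \<circ> param c) z) (du (\<phi> \<circ> param c) z) (dv (\<phi> \<circ> param c) z)
      + nkgP ((\<phi> \<circ> param c) z) (dv (\<phi> \<circ> param c) z) (du (\<phi> \<circ> param c) z)) / 4)"
  unfolding Lam_def Let_def dz_def nkP_cx.simps nkg_cx.simps nkgP_def[symmetric] nkgP_bilinear
  by (simp add: complex_eq_iff field_simps)

lemma complex_derivativeI:
  assumes f: "(f has_derivative D) (at z)" and D: "D \<i> = \<i> * D 1"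
  shows "(f has_field_derivative D 1) (at z)"
proof -
  have l: "linear D" using has_derivative_linear[OF f] .
  have "D h = D 1 * h" for h
  proof -
    have "h = Re h *\<^sub>R 1 + Im h *\<^sub>R \<i>" by (simp add: complex_eq_iff)
    then have "D h = D (Re h *\<^sub>R 1 + Im h *\<^sub>R \<i>)" by simp
    also have "\<dots> = Re h *\<^sub>R D 1 + Im h *\<^sub>R (\<i> * D 1)" by (simp only: linear_add[OF l] linear_scale[OF l] D)
    also have "\<dots> = D 1 * h" by (simp add: complex_eq_iff algebra_simps)
    finally show ?thesis .
  qed
  then have "D = (*) (D 1)" by (rule ext)
  then show ?thesis using f by (simp add: has_field_derivative_def)
qed

context
  fixes A :: "'m::{t2_space,second_countable_topology} chart set" and \<phi> :: "'m \<Rightarrow> quat2"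
  assumes acs: "almost_complex_surface A \<phi>"
begin

lemma surface_facts:
  shows "smooth_atlas A" "smooth_immersion A \<phi>" "\<phi> x \<in> S3 \<times> S3"
  using acs by (auto simp: almost_complex_surface_def)

lemma isothermal_chart:
  assumes c: "c \<in> isothermal_charts A \<phi>"
  shows "c \<in> smooth_charts A" "is_chart c" "open (cdom c)" "smooth_on (cdom c) (\<phi> \<circ> param c)"
    "\<And>z. z \<in> cdom c \<Longrightarrow> nkJ (\<phi> (param c z)) (du (\<phi> \<circ> param c) z) = dv (\<phi> \<circ> param c) z"
proof -
  show s: "c \<in> smooth_charts A" using c by (simp add: isothermal_charts_def)
  show "is_chart c" using s by (simp add: smooth_charts_def)
  then show "open (cdom c)" by (simp add: is_chart_def)
  show "smooth_on (cdom c) (\<phi> \<circ> param c)"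
    by (rule smooth_in_chart[OF surface_facts(1) _ s]) (use surface_facts(2) in \<open>simp add: smooth_immersion_def\<close>)
  show "\<And>z. z \<in> cdom c \<Longrightarrow> nkJ (\<phi> (param c z)) (du (\<phi> \<circ> param c) z) = dv (\<phi> \<circ> param c) z"
    using c by (simp only: isothermal_charts_def Let_def mem_Collect_eq o_apply)
qed

lemma isothermal_components:
  assumes c: "c \<in> isothermal_charts A \<phi>"
  defines "p \<equiv> fst \<circ> \<phi> \<circ> param c" and "q \<equiv> snd \<circ> \<phi> \<circ> param c"
  shows "smooth_on (cdom c) p" "smooth_on (cdom c) q"
    "\<And>z. z \<in> cdom c \<Longrightarrow> p z \<in> S3 \<and> q z \<in> S3"
    "\<And>z. z \<in> cdom c \<Longrightarrow> nkJ (p z, q z) (du p z, du q z) = (dv p z, dv q z)"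
    "\<And>z. z \<in> cdom c \<Longrightarrow> du p z = fst (du (\<phi> \<circ> param c) z) \<and> dv p z = fst (dv (\<phi> \<circ> param c) z)"
proof -
  note ic = isothermal_chart[OF c]
  define f where "f = \<phi> \<circ> param c"
  have p: "p = (\<lambda>z. fst (f z))" and q: "q = (\<lambda>z. snd (f z))" by (auto simp: p_def q_def f_def)
  note sf = ic(4)[folded f_def]
  show "smooth_on (cdom c) p" "smooth_on (cdom c) q"
    unfolding p q by (rule smooth_on_linear[OF ic(3) bounded_linear_fst sf], rule smooth_on_linear[OF ic(3) bounded_linear_snd sf])
  show "\<And>z. z \<in> cdom c \<Longrightarrow> p z \<in> S3 \<and> q z \<in> S3"
    using surface_facts(3) by (simp add: p_def q_def mem_Times_iff)
  fix z assume z: "z \<in> cdom c"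
  note df = smooth_on_differentiable[OF sf z]
  note d = derivative_of_linear(2,3)[OF bounded_linear_fst df] derivative_of_linear(2,3)[OF bounded_linear_snd df]
  show "du p z = fst (du (\<phi> \<circ> param c) z) \<and> dv p z = fst (dv (\<phi> \<circ> param c) z)"
    unfolding f_def[symmetric] p d by simp
  show "nkJ (p z, q z) (du p z, du q z) = (dv p z, dv q z)"
    unfolding p q d prod.collapse using ic(5)[OF z] by (simp only: f_def o_apply)
qed

text \<open>The constant factor is \<open>exp (\<i> \<pi> / 3) / 2\<close>; it enters when \<open>q_u\<close> and \<open>q_v\<close> are expressed by \<open>p_u\<close> and \<open>p_v\<close>.\<close>

lemma Lam_formula:
  assumes c: "c \<in> isothermal_charts A \<phi>" and z: "z \<in> cdom c"
  defines "p \<equiv> fst \<circ> \<phi> \<circ> param c"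
  shows "Lam \<phi> c z = Complex (1/4) (sqrt 3 / 4)
    * Complex (du p z \<bullet> du p z - dv p z \<bullet> dv p z) (- 2 * (du p z \<bullet> dv p z))"
proof -
  have S: "(\<phi> \<circ> param c) z \<in> S3 \<times> S3" using surface_facts(3) by simp
  have J: "nkJ ((\<phi> \<circ> param c) z) (du (\<phi> \<circ> param c) z) = dv (\<phi> \<circ> param c) z"
    using isothermal_chart(5)[OF c z] by (simp only: o_apply)
  have "sqrt 3 * (sqrt 3 * y) = 3 * y" for y :: real by (simp flip: mult.assoc)
  then show ?thesis
    unfolding Lam_eq nkgP_formula[OF S J] using isothermal_components(5)[OF c z, folded p_def]
    by (simp add: complex_eq_iff field_simps)
qed

text \<open>Up to the constant factor, the Cauchy-Riemann equations for \<open>\<Lambda>\<close> are the two orthogonality relations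
  of \<open>laplacian_orthogonal\<close>.\<close>

lemma Lam_holomorphic:
  assumes c: "c \<in> isothermal_charts A \<phi>"
  shows "Lam \<phi> c holomorphic_on cdom c"
proof -
  define p where "p = fst \<circ> \<phi> \<circ> param c"
  note oc = isothermal_chart(3)[OF c] and comp = isothermal_components[OF c, folded p_def]
  define d m where "d z = du p z \<bullet> du p z - dv p z \<bullet> dv p z" and "m z = du p z \<bullet> dv p z" for z
  have "\<exists>D. ((\<lambda>z. Complex (d z) (- 2 * m z)) has_field_derivative D) (at z)" if z: "z \<in> cdom c" for z
  proof -
    note su = smooth_on_differentiable[OF smooth_du[OF comp(1)] z] and sv = smooth_on_differentiable[OF smooth_dv[OF comp(1)] z]
    note uu = derivative_of_product[OF bounded_bilinear_inner su su] and vv = derivative_of_product[OF bounded_bilinear_inner sv sv]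
      and uv = derivative_of_product[OF bounded_bilinear_inner su sv]
    have de: "d = (\<lambda>z. 1 *\<^sub>R (du p z \<bullet> du p z) + (-1) *\<^sub>R (dv p z \<bullet> dv p z))" by (simp add: fun_eq_iff d_def)
    have me: "m = (\<lambda>z. du p z \<bullet> dv p z)" by (simp add: fun_eq_iff m_def)
    note dd = derivative_of_combination[OF uu(1) vv(1), of 1 "-1", folded de] and mm = uv[folded me]
    have mix: "dv (du p) z = du (dv p) z" by (rule mixed_derivatives_commute[OF oc z comp(1)])
    note lap = laplacian_orthogonal(3,4)[OF oc comp(1-4) z]
    have cr: "dv d z = 2 * du m z" "du d z = - 2 * dv m z"
      unfolding dd mm uu vv using lap mix by (simp_all add: inner_add_right inner_commute)
    have "((\<lambda>z. of_real (d z) + \<i> * of_real (- 2 * m z)) has_derivative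
       (\<lambda>h. of_real (frechet_derivative d (at z) h) + \<i> * of_real (- 2 * frechet_derivative m (at z) h))) (at z)"
      by (intro has_derivative_add has_derivative_of_real has_derivative_mult_right
          dd(1)[unfolded frechet_derivative_works] mm(1)[unfolded frechet_derivative_works])
    then have "((\<lambda>z. Complex (d z) (- 2 * m z)) has_derivative
       (\<lambda>h. Complex (frechet_derivative d (at z) h) (- 2 * frechet_derivative m (at z) h))) (at z)"
      by (simp only: Complex_eq)
    from complex_derivativeI[OF this] show ?thesis
      using cr by (auto simp: complex_eq_iff du_def dv_def)
  qed
  then have "(\<lambda>z. Complex (d z) (- 2 * m z)) holomorphic_on cdom c"
    unfolding holomorphic_on_open[OF oc] by blast
  then have "(\<lambda>z. Complex (1/4) (sqrt 3 / 4) * Complex (d z) (- 2 * m z)) holomorphic_on cdom c"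
    by (intro holomorphic_intros)
  then show ?thesis
    by (rule holomorphic_transform) (simp add: Lam_formula[OF c] p_def[symmetric] d_def m_def)
qed

text \<open>In both charts \<open>J\<close> corresponds to multiplication by \<open>\<i>\<close>.  The differential of the transition map
  therefore commutes with \<open>\<i>\<close>, as the immersion has an injective differential.\<close>

lemma isothermal_transition:
  assumes c: "c \<in> isothermal_charts A \<phi>" and d: "d \<in> isothermal_charts A \<phi>" and z: "z \<in> overlap c d"
  obtains \<tau> where "(transition c d has_field_derivative \<tau>) (at z)"
    "du (\<phi> \<circ> param c) z = Re \<tau> *\<^sub>R du (\<phi> \<circ> param d) (transition c d z) + Im \<tau> *\<^sub>R dv (\<phi> \<circ> param d) (transition c d z)"
    "dv (\<phi> \<circ> param c) z = (- Im \<tau>) *\<^sub>R du (\<phi> \<circ> param d) (transition c d z) + Re \<tau> *\<^sub>R dv (\<phi> \<circ> param d) (transition c d z)"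
proof -
  note ic = isothermal_chart[OF c] and id = isothermal_chart[OF d] and A = surface_facts(1) and im = surface_facts(2)
  define x where "x = param c z"
  have zx: "z \<in> cdom c" "x \<in> fst d" using z by (auto simp: overlap_eq[OF ic(2)] x_def)
  have x: "x \<in> fst c" "snd c x = z" "snd d x = transition c d z"
    using chart_inverse[OF ic(2)] zx by (auto simp: x_def transition_def)
  define y where "y = transition c d z"
  have y: "y \<in> cdom d" "param d y = x"
    unfolding y_def x(3)[symmetric] using chart_inverse(1,2)[OF id(2) zx(2)] by simp_all
  define T where "T = frechet_derivative (transition c d) (at z)"
  note td = transition_derivative[OF A ic(1) id(1) x(1) zx(2) id(4), unfolded x(2), folded T_def]
  define X Y where "X = du (\<phi> \<circ> param d) y" and "Y = dv (\<phi> \<circ> param d) y"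
  have Dd: "differential_in \<phi> d x h = Re h *\<^sub>R X + Im h *\<^sub>R Y" for h
    unfolding differential_in_def x(3) y_def[symmetric] X_def Y_def
    by (rule derivative_eq_du_dv[OF smooth_on_has_derivative[OF id(4) y(1)]])
  have Dc: "du (\<phi> \<circ> param c) z = differential_in \<phi> d x (T 1)" "dv (\<phi> \<circ> param c) z = differential_in \<phi> d x (T \<i>)"
    using td(2) by (simp_all only: du_def dv_def differential_in_def x(2))
  have JX: "nkJ (\<phi> x) X = Y" using id(5)[OF y(1)] by (simp only: y(2) X_def Y_def)
  have JY: "nkJ (\<phi> x) Y = - X" unfolding JX[symmetric] by (rule nkJ_nkJ[OF surface_facts(3)])
  have Ji: "nkJ (\<phi> x) (differential_in \<phi> d x h) = differential_in \<phi> d x (\<i> * h)" for h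
    unfolding Dd nkJ_linear JX JY by simp
  have "differential_in \<phi> d x (T \<i>) = differential_in \<phi> d x (\<i> * T 1)"
    using ic(5)[OF zx(1)] unfolding Dc x_def[symmetric] Ji by simp
  then have Ti: "T \<i> = \<i> * T 1" by (rule injD[OF immersion_in_chart(2)[OF A im id(1) zx(2)]])
  show ?thesis
  proof (rule that[of "T 1"])
    show "(transition c d has_field_derivative T 1) (at z)" by (rule complex_derivativeI[OF td(1) Ti])
  qed (unfold Dc Ti Dd y_def[symmetric] X_def Y_def, simp_all)
qed

lemma Lam_transformation:
  assumes c: "c \<in> isothermal_charts A \<phi>" and d: "d \<in> isothermal_charts A \<phi>" and z: "z \<in> overlap c d"
  shows "Lam \<phi> c z = Lam \<phi> d (transition c d z) * (deriv (transition c d) z)\<^sup>2"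
proof -
  obtain \<tau> where t: "(transition c d has_field_derivative \<tau>) (at z)"
    "du (\<phi> \<circ> param c) z = Re \<tau> *\<^sub>R du (\<phi> \<circ> param d) (transition c d z) + Im \<tau> *\<^sub>R dv (\<phi> \<circ> param d) (transition c d z)"
    "dv (\<phi> \<circ> param c) z = (- Im \<tau>) *\<^sub>R du (\<phi> \<circ> param d) (transition c d z) + Re \<tau> *\<^sub>R dv (\<phi> \<circ> param d) (transition c d z)"
    by (rule isothermal_transition[OF c d z])
  have "param d (transition c d z) = param c z"
    using z chart_inverse[OF isothermal_chart(2)[OF d]] by (auto simp: overlap_eq[OF isothermal_chart(2)[OF c]] transition_def)
  then have x: "(\<phi> \<circ> param c) z = (\<phi> \<circ> param d) (transition c d z)" by simp
  show ?thesis
    unfolding Lam_eq x t(2,3) nkgP_bilinear DERIV_imp_deriv[OF t(1)]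
    by (simp add: complex_eq_iff power2_eq_square field_simps)
qed

end

theorem theorem5p1:
  fixes A :: "'m::{t2_space,second_countable_topology} chart set"
    and \<phi> :: "'m \<Rightarrow> quat2"
  assumes "almost_complex_surface A \<phi>"
  defines "I \<equiv> isothermal_charts A \<phi>"
  shows "holomorphic_quadratic_differential I (Lam \<phi>) \<and>
    ((\<forall>c\<in>I. \<forall>z\<in>cdom c. Lam \<phi> c z = 0) \<longleftrightarrow>
     (\<forall>c\<in>I. \<forall>z\<in>cdom c.
        snd (alpha \<phi> c z) \<bullet> snd (alpha \<phi> c z) - snd (beta \<phi> c z) \<bullet> snd (beta \<phi> c z) = 0 \<and>
        snd (alpha \<phi> c z) \<bullet> snd (beta \<phi> c z) = 0)) \<and>
    ((\<forall>c\<in>I. \<forall>z\<in>cdom c. Lam \<phi> c z = 0) \<longleftrightarrow>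
     (\<forall>x. \<forall>X\<in>tangent_plane A \<phi> x. \<forall>Y\<in>tangent_plane A \<phi> x. nkg (\<phi> x) (nkP (\<phi> x) X) Y = 0))"
proof (intro conjI)
  note acs = assms(1)
  note ic = isothermal_chart[OF acs, folded I_def] and A = surface_facts(1)[OF acs] and im = surface_facts(2)[OF acs]
  show "holomorphic_quadratic_differential I (Lam \<phi>)"
    unfolding holomorphic_quadratic_differential_def complex_atlas_def
  proof (intro conjI ballI)
    show "(\<Union>c\<in>I. fst c) = UNIV" using isothermal_chart_exists[OF acs] unfolding I_def by blast
    fix c assume c: "c \<in> I"
    show "is_chart c" by (rule ic(2)[OF c])
    show "Lam \<phi> c holomorphic_on cdom c" using Lam_holomorphic[OF acs] c by (simp add: I_def)
    fix d assume d: "d \<in> I"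
    have "open (overlap c d)" unfolding overlap_eq[OF ic(2)[OF c]]
      by (rule open_chart_preimage[OF ic(2)[OF c]]) (use ic(2)[OF d] in \<open>simp add: is_chart_def\<close>)
    then show "transition c d holomorphic_on overlap c d"
      unfolding holomorphic_on_open[OF \<open>open (overlap c d)\<close>]
      using isothermal_transition[OF acs c[unfolded I_def] d[unfolded I_def]] by metis
    fix z assume "z \<in> overlap c d"
    then show "Lam \<phi> c z = Lam \<phi> d (transition c d z) * (deriv (transition c d) z)\<^sup>2"
      using Lam_transformation[OF acs] c d by (simp add: I_def)
  qed
  have "Lam \<phi> c z = 0 \<longleftrightarrow> snd (alpha \<phi> c z) \<bullet> snd (alpha \<phi> c z) - snd (beta \<phi> c z) \<bullet> snd (beta \<phi> c z) = 0 \<and>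
        snd (alpha \<phi> c z) \<bullet> snd (beta \<phi> c z) = 0" if c: "c \<in> I" and z: "z \<in> cdom c" for c z
  proof -
    define p where "p = fst \<circ> \<phi> \<circ> param c"
    note cI = c[unfolded I_def]
    note comp = isothermal_components[OF acs cI, folded p_def]
    have ps: "p z \<in> S3" using comp(3)[OF z] by blast
    note t = laplacian_orthogonal(1,2)[OF ic(3)[OF c] comp(1-4) z]
    have ab: "alpha \<phi> c z = qconj (p z) *\<^sub>q du p z" "beta \<phi> c z = qconj (p z) *\<^sub>q dv p z"
      by (simp_all add: alpha_def beta_def Let_def p_def[symmetric] qinv_unit[OF ps])
    have inn: "snd (qconj (p z) *\<^sub>q v) \<bullet> snd (qconj (p z) *\<^sub>q w) = v \<bullet> w" if "p z \<bullet> v = 0" for v w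
      using qmult_S3_inner[OF qconj_S3[OF ps], of v w] that by (simp add: inner_quat[of "qconj (p z) *\<^sub>q v"] fst_qconj_qmult)
    have "Lam \<phi> c z = 0 \<longleftrightarrow> Complex (du p z \<bullet> du p z - dv p z \<bullet> dv p z) (- 2 * (du p z \<bullet> dv p z)) = 0"
    proof -
      have "Complex (1/4) (sqrt 3 / 4) \<noteq> 0" by (simp add: complex_eq_iff)
      then show ?thesis unfolding Lam_formula[OF acs cI z, folded p_def] by (simp only: mult_eq_0_iff simp_thms)
    qed
    moreover have "snd (alpha \<phi> c z) \<bullet> snd (alpha \<phi> c z) = du p z \<bullet> du p z"
      "snd (alpha \<phi> c z) \<bullet> snd (beta \<phi> c z) = du p z \<bullet> dv p z"
      "snd (beta \<phi> c z) \<bullet> snd (beta \<phi> c z) = dv p z \<bullet> dv p z"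
      unfolding ab using inn[OF t(1)] inn[OF t(2)] by blast+
    ultimately show ?thesis by (simp only:) (simp add: complex_eq_iff)
  qed
  then show "(\<forall>c\<in>I. \<forall>z\<in>cdom c. Lam \<phi> c z = 0) \<longleftrightarrow>
     (\<forall>c\<in>I. \<forall>z\<in>cdom c.
        snd (alpha \<phi> c z) \<bullet> snd (alpha \<phi> c z) - snd (beta \<phi> c z) \<bullet> snd (beta \<phi> c z) = 0 \<and>
        snd (alpha \<phi> c z) \<bullet> snd (beta \<phi> c z) = 0)" by blast
  show "(\<forall>c\<in>I. \<forall>z\<in>cdom c. Lam \<phi> c z = 0) \<longleftrightarrow>
     (\<forall>x. \<forall>X\<in>tangent_plane A \<phi> x. \<forall>Y\<in>tangent_plane A \<phi> x. nkg (\<phi> x) (nkP (\<phi> x) X) Y = 0)"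
  proof
    assume L: "\<forall>c\<in>I. \<forall>z\<in>cdom c. Lam \<phi> c z = 0"
    show "\<forall>x. \<forall>X\<in>tangent_plane A \<phi> x. \<forall>Y\<in>tangent_plane A \<phi> x. nkg (\<phi> x) (nkP (\<phi> x) X) Y = 0"
    proof (intro allI ballI)
      fix x X Y assume XY: "X \<in> tangent_plane A \<phi> x" "Y \<in> tangent_plane A \<phi> x"
      obtain c where c: "c \<in> I" "x \<in> fst c" using isothermal_chart_exists[OF acs] unfolding I_def by blast
      define z where "z = snd c x"
      have z: "z \<in> cdom c" "param c z = x" using chart_inverse[OF ic(2)[OF c(1)]] c(2) by (auto simp: z_def)
      define X' Y' where "X' = du (\<phi> \<circ> param c) z" and "Y' = dv (\<phi> \<circ> param c) z"
      have J: "nkJ (\<phi> x) X' = Y'" using ic(5)[OF c(1) z(1)] by (simp only: z(2) X'_def Y'_def)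
      note F = nkgP_formula[OF surface_facts(3)[OF acs] J]
      have "Lam \<phi> c z = 0" using L c(1) z(1) by blast
      then have "nkgP (\<phi> x) X' X' - nkgP (\<phi> x) Y' Y' = 0" "nkgP (\<phi> x) X' Y' + nkgP (\<phi> x) Y' X' = 0"
        unfolding Lam_eq by (simp_all add: complex_eq_iff z(2) X'_def Y'_def)
      then have zero: "nkgP (\<phi> x) X' X' = 0" "nkgP (\<phi> x) Y' Y' = 0" "nkgP (\<phi> x) X' Y' = 0" "nkgP (\<phi> x) Y' X' = 0"
        using F by linarith+
      have "\<exists>h. v = Re h *\<^sub>R X' + Im h *\<^sub>R Y'" if "v \<in> tangent_plane A \<phi> x" for v
        using that derivative_eq_du_dv[OF smooth_on_has_derivative[OF ic(4)[OF c(1)] z(1)]]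
        unfolding immersion_in_chart(3)[OF A im ic(1)[OF c(1)] c(2)] differential_in_def X'_def Y'_def z_def by auto
      then obtain h k where "X = Re h *\<^sub>R X' + Im h *\<^sub>R Y'" "Y = Re k *\<^sub>R X' + Im k *\<^sub>R Y'" using XY by blast
      then have "nkgP (\<phi> x) X Y = 0" by (simp add: nkgP_bilinear zero)
      then show "nkg (\<phi> x) (nkP (\<phi> x) X) Y = 0" by (simp add: nkgP_def)
    qed
  next
    assume R: "\<forall>x. \<forall>X\<in>tangent_plane A \<phi> x. \<forall>Y\<in>tangent_plane A \<phi> x. nkg (\<phi> x) (nkP (\<phi> x) X) Y = 0"
    show "\<forall>c\<in>I. \<forall>z\<in>cdom c. Lam \<phi> c z = 0"
    proof (intro ballI)
      fix c z assume c: "c \<in> I" and z: "z \<in> cdom c"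
      note ch = chart_inverse(3,4)[OF ic(2)[OF c] z]
      have "du (\<phi> \<circ> param c) z \<in> tangent_plane A \<phi> (param c z)" "dv (\<phi> \<circ> param c) z \<in> tangent_plane A \<phi> (param c z)"
        unfolding immersion_in_chart(3)[OF A im ic(1)[OF c] ch(2)] differential_in_def ch(1) du_def dv_def by simp_all
      then show "Lam \<phi> c z = 0" unfolding Lam_eq nkgP_def using R by (simp add: complex_eq_iff)
    qed
  qed
qed

end
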